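(* Fix $q>1$ and let $\Pi_n\sim\mathrm{Mallows}(n,q)$. There exist constants $\mu_2,\mu_4,\ldots$ and an infinite matrix $Q\in\mathbb{R}^{\mathbb{N}\times\mathbb{N}}$ such that for all $\ell\ge1$, $$\frac{1}{\sqrt n}\bigl(C_2(\Pi_n)-\mu_2 n,\ \ldots,\ C_{2\ell}(\Pi_n)-\mu_{2\ell}n\bigr)\ \xrightarrow[n\to\infty]{d}\ \mathcal{N}_\ell(\vec 0,Q_\ell),$$ where $\mathcal{N}_\ell(\cdot,\cdot)$ denotes the $\ell$-dimensional multivariate normal distribution and $Q_\ell$ is the submatrix of $Q$ on the indices $[\ell]\times[\ell]$.
   Context: For $n\in\mathbb{N}$, $S_n$ is the set of permutations of $[n]=\{1,\dots,n\}$. For $\pi\in S_n$, a pair $(i,j)$ with $i<j$ and $\pi(i)>\pi(j)$ is an inversion; $\mathrm{inv}(\pi)$ is the number of inversions. For $q>0$, $\Pi_n\sim\mathrm{Mallows}(n,q)$ means $\mathbb{P}(\Pi_n=\pi)=q^{\mathrm{inv}(\pi)}/\sum_{\sigma\in S_n}q^{\mathrm{inv}(\sigma)}$ for every $\pi\in S_n$. For a permutation $\pi$, $C_i(\pi)$ denotes the number of cycles of length $i$ of $\pi$. *)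

theory Defs
  imports "HOL-Probability.Probability" "HOL-Combinatorics.Combinatorics"
begin

definition perms :: "nat \<Rightarrow> (nat \<Rightarrow> nat) set" where
  "perms n = {\<pi>. \<pi> permutes {1..n}}"

definition inv_count :: "nat \<Rightarrow> (nat \<Rightarrow> nat) \<Rightarrow> nat" where
  "inv_count n \<pi> = card {(i, j). i \<in> {1..n} \<and> j \<in> {1..n} \<and> i < j \<and> \<pi> i > \<pi> j}"

definition mallows_prob :: "nat \<Rightarrow> real \<Rightarrow> (nat \<Rightarrow> nat) \<Rightarrow> real" where
  "mallows_prob n q \<pi> =
     q ^ inv_count n \<pi> / (\<Sum>\<sigma>\<in>perms n. q ^ inv_count n \<sigma>)"

definition mallows_expect :: "nat \<Rightarrow> real \<Rightarrow> ((nat \<Rightarrow> nat) \<Rightarrow> real) \<Rightarrow> real" where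
  "mallows_expect n q g = (\<Sum>\<pi>\<in>perms n. mallows_prob n q \<pi> * g \<pi>)"

definition cycle_count :: "nat \<Rightarrow> nat \<Rightarrow> (nat \<Rightarrow> nat) \<Rightarrow> nat" where
  "cycle_count n i \<pi> = card {orbit \<pi> x | x. x \<in> {1..n} \<and> card (orbit \<pi> x) = i}"

text \<open>Vectors in R^l are represented as extensional functions {1..l} -> real,
  i.e. elements of the space of PiM {1..l} (\<lambda>_. borel).\<close>
definition vec_space :: "nat \<Rightarrow> (nat \<Rightarrow> real) measure" where
  "vec_space l = PiM {1..l} (\<lambda>_. borel)"

definition is_mvnormal0 :: "nat \<Rightarrow> (nat \<Rightarrow> nat \<Rightarrow> real) \<Rightarrow> (nat \<Rightarrow> real) measure \<Rightarrow> bool" where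
  "is_mvnormal0 l Q M \<longleftrightarrow> prob_space M \<and> sets M = sets (vec_space l) \<and>
     (\<forall>t \<in> PiE {1..l} (\<lambda>_. UNIV).
        (LINT x|M. cis (\<Sum>i\<in>{1..l}. t i * x i)) =
        complex_of_real (exp (- (\<Sum>i\<in>{1..l}. \<Sum>j\<in>{1..l}. t i * Q i j * t j) / 2)))"

definition mallows_conv_distr ::
  "real \<Rightarrow> nat \<Rightarrow> (nat \<Rightarrow> (nat \<Rightarrow> nat) \<Rightarrow> (nat \<Rightarrow> real)) \<Rightarrow> (nat \<Rightarrow> real) measure \<Rightarrow> bool" where
  "mallows_conv_distr q l V M \<longleftrightarrow>
     (\<forall>f :: (nat \<Rightarrow> real) \<Rightarrow> real.
        f \<in> borel_measurable (vec_space l) \<longrightarrow>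
        continuous_on (PiE {1..l} (\<lambda>_. UNIV)) f \<longrightarrow>
        bounded (f ` PiE {1..l} (\<lambda>_. UNIV)) \<longrightarrow>
        ((\<lambda>n. mallows_expect n q (\<lambda>\<pi>. f (V n \<pi>))) \<longlonglongrightarrow> (LINT x|M. f x)))"

end

(* Idea. With p = 1/q, the weight q^inv is proportional to p^noninv, so a typical permutation is close to
the reversal. Number the positions symmetrically around 0. A cut at level j means that the permutation
exchanges the positions x > j with the positions x < -j; then it is the product of a permutation of
|x| <= j and one of j < |x| <= n, there are no non-inversions between the two parts, and both weights
and cycle counts factor. Cutting at every possible level turns the generating function
sum p^noninv cis(x * statistic) into the solution of a scalar renewal equation whose coefficients are
perturbations of a probability distribution a. At x = 0 the renewal sequence is explicit,
prod (1 - p^i)^2, hence converges exponentially fast, and this alone gives a a finite second moment.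
A renewal sequence perturbed at scale x ~ 1 / sqrt n is asymptotically exponential in n x^2, which is
the Gaussian characteristic function; Levy's continuity theorem in R^l concludes. *)

theory Submission
  imports Defs
begin

text \<open>Estimating the size of a typical block between two cuts directly would need
  combinatorial control of permutations without inner cuts. This is avoided by reasoning backwards:
  the renewal sequence is known, and the moments of the gap distribution are read off from it. The
  perturbed sequence is compared with an exponential by an exact convolution identity. The statistic
  enters only through additivity over blocks, invariance under relabelling and a linear bound.
  Centring makes its mean over a random block vanish, so that the perturbation is quadratic in x.
  Even lengths are the ones that can grow linearly: outside the innermost block every cycle
  alternates between the two sides of 0. The parity of n decides whether there is a central
  position; this affects only the innermost block, whose contribution cancels in the limiting
  quotient of generating functions. A level carries two positions, hence the factors 1/2 in the
  constants.\<close>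

section \<open>Weak convergence and Gaussian measures on \<open>\<real>\<^sup>l\<close>\<close>

text \<open>Cholesky factorization by induction: the new index contributes one column, and the Schur
  complement \<open>Q'\<close> of its diagonal entry is again positive semidefinite.\<close>

lemma psd_gram:
  fixes Q :: "'i \<Rightarrow> 'i \<Rightarrow> real"
  assumes "finite I" "\<And>i j. Q i j = Q j i"
    and "\<And>t. 0 \<le> (\<Sum>i\<in>I. \<Sum>j\<in>I. t i * Q i j * t j)"
  shows "\<exists>A. \<forall>i\<in>I. \<forall>j\<in>I. Q i j = (\<Sum>k\<in>I. A i k * A j k)"
  using assms
proof (induction I arbitrary: Q rule: finite_induct)
  case empty
  then show ?case by simp
next
  case (insert x F)
  define q where "q = Q x x"
  define B where "B = (\<lambda>t. \<Sum>j\<in>F. Q x j * t j)"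
  \<comment> \<open>For \<open>q = 0\<close> the quotient is 0 by convention, so \<open>Q'\<close>
    is \<open>Q\<close>; the fact \<open>zero\<close> then says that the row of \<open>x\<close>
    vanishes.\<close>
  define Q' where "Q' = (\<lambda>i j. Q i j - Q i x * Q j x / q)"
  have full: "(\<Sum>i\<in>insert x F. \<Sum>j\<in>insert x F. t i * Q i j * t j) =
      (\<Sum>i\<in>F. \<Sum>j\<in>F. t i * Q i j * t j) + 2 * t x * B t + q * (t x)\<^sup>2" for t
  proof -
    have "(\<Sum>i\<in>F. t i * Q i x * t x) = t x * B t" "(\<Sum>j\<in>F. t x * Q x j * t j) = t x * B t"
      unfolding B_def sum_distrib_left by (auto intro!: sum.cong simp: insert.prems(1)[of _ x])
    then show ?thesis
      using insert.hyps by (simp add: sum.distrib q_def power2_eq_square)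
  qed
  have "0 \<le> (\<Sum>i\<in>insert x F. \<Sum>j\<in>insert x F. of_bool (i = x) * Q i j * of_bool (j = x))"
    by (rule insert.prems(2))
  also have "\<dots> = q" 
  proof -
    have "(of_bool (i = x) :: real) = 0" if "i \<in> F" for i using that insert.hyps by auto
    then show ?thesis unfolding full by (simp add: B_def cong: sum.cong)
  qed
  finally have q0: "q \<ge> 0" .
  have zero: "Q x j = 0" if "q = 0" "j \<in> F" for j
  proof (rule ccontr)
    assume ne: "Q x j \<noteq> 0"
    \<comment> \<open>Solves \<open>Q j j + 2 * s * Q x j = -1\<close>; for \<open>q = 0\<close> the
      left side is the value of the form at \<open>t\<close>.\<close>
    define s where "s = - (Q j j + 1) / (2 * Q x j)"
    define t where "t = (\<lambda>i. if i = x then s else of_bool (i = j))"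
    have "x \<noteq> j" using insert.hyps that by auto
    have t1: "t i = of_bool (i = j)" if "i \<in> F" for i using that insert.hyps by (auto simp: t_def)
    have "B t = (\<Sum>i\<in>F. if i = j then Q x j else 0)"
      unfolding B_def by (intro sum.cong) (auto simp: t1)
    then have Bt: "B t = Q x j" using that insert.hyps by simp
    have "(\<Sum>i\<in>F. \<Sum>k\<in>F. t i * Q i k * t k) = (\<Sum>i\<in>F. \<Sum>k\<in>F. if k = j then (if i = j then Q j j else 0) else 0)"
      by (intro sum.cong) (auto simp: t1)
    then have "(\<Sum>i\<in>F. \<Sum>k\<in>F. t i * Q i k * t k) = Q j j"
      using that insert.hyps by simp
    then have "0 \<le> Q j j + 2 * s * Q x j"
      using full[of t] insert.prems(2)[of t] Bt that by (simp add: t_def)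
    moreover have "2 * s * Q x j = - (Q j j + 1)" using ne by (simp add: s_def)
    ultimately show False by simp
  qed
  have "0 \<le> (\<Sum>i\<in>F. \<Sum>j\<in>F. t i * Q' i j * t j)" for t
  proof -
    \<comment> \<open>For \<open>q > 0\<close> this choice at \<open>x\<close> minimizes the full
      form over that coordinate, and the minimum is the form of \<open>Q'\<close> at
      \<open>t\<close>.\<close>
    define t' where "t' = t(x := - B t / q)"
    have eqF: "t' i = t i" if "i \<in> F" for i using that insert.hyps by (auto simp: t'_def)
    have BB: "B t' = B t" unfolding B_def using eqF by simp
    have "(\<Sum>i\<in>F. \<Sum>j\<in>F. t i * Q' i j * t j) =
      (\<Sum>i\<in>F. \<Sum>j\<in>F. t i * Q i j * t j) - (\<Sum>i\<in>F. \<Sum>j\<in>F. (Q x i * t i) * (Q x j * t j)) / q"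
      unfolding Q'_def sum_divide_distrib sum_subtractf[symmetric]
      by (auto intro!: sum.cong simp: algebra_simps diff_divide_distrib insert.prems(1)[of _ x])
    also have "(\<Sum>i\<in>F. \<Sum>j\<in>F. (Q x i * t i) * (Q x j * t j)) = (B t)\<^sup>2"
      by (simp add: B_def power2_eq_square sum_product)
    also have "(\<Sum>i\<in>F. \<Sum>j\<in>F. t i * Q i j * t j) - (B t)\<^sup>2 / q =
      (\<Sum>i\<in>insert x F. \<Sum>j\<in>insert x F. t' i * Q i j * t' j)"
      unfolding full BB using eqF by (simp add: t'_def power2_eq_square field_simps)
    finally show ?thesis using insert.prems(2)[of t'] by simp
  qed
  moreover have "Q' i j = Q' j i" for i j by (simp add: Q'_def insert.prems(1)[of i j])
  ultimately obtain A where A: "\<forall>i\<in>F. \<forall>j\<in>F. Q' i j = (\<Sum>k\<in>F. A i k * A j k)"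
    using insert.IH[of Q'] by blast
  define A' where "A' = (\<lambda>i k. if k = x then Q i x / sqrt q else if i = x then 0 else A i k)"
  have "Q i j = (\<Sum>k\<in>insert x F. A' i k * A' j k)" if "i \<in> insert x F" "j \<in> insert x F" for i j
  proof -
    have s: "(\<Sum>k\<in>F. A' i k * A' j k) = (if i = x \<or> j = x then 0 else \<Sum>k\<in>F. A i k * A j k)"
      using insert.hyps by (auto simp: A'_def intro!: sum.cong sum.neutral)
    have "(\<Sum>k\<in>insert x F. A' i k * A' j k) =
       Q i x * Q j x / q + (if i = x \<or> j = x then 0 else Q' i j)"
      using insert.hyps that A q0 unfolding sum.insert[OF insert.hyps] s by (auto simp: A'_def)
    also have "\<dots> = Q i j"
    proof (cases "i = x \<or> j = x")
      case True
      have sym: "Q i x = Q x i" "Q j x = Q x j" by (rule insert.prems(1))+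
      show ?thesis
      proof (cases "q = 0")
        case True
        then have "Q x i = 0" "Q x j = 0" using zero that by (auto simp: q_def)
        with True \<open>i = x \<or> j = x\<close> sym show ?thesis by auto
      next
        case False
        with \<open>i = x \<or> j = x\<close> sym show ?thesis by (auto simp: q_def)
      qed
    qed (simp add: Q'_def)
    finally show ?thesis by simp
  qed
  then show ?case by blast
qed

text \<open>Take the image of \<open>l\<close> independent standard normals under the matrix of a
  Gram factorization. This covers singular \<open>Q\<close>, for which there is no density.\<close>

lemma mvnormal0_exists:
  assumes "\<And>i j. Q i j = Q j i"
    and "\<And>t. 0 \<le> (\<Sum>i\<in>{1..l}. \<Sum>j\<in>{1..l}. t i * Q i j * t j)"
  shows "\<exists>M. is_mvnormal0 l Q M"
proof -
  obtain A where A: "\<And>i j. i \<in> {1..l} \<Longrightarrow> j \<in> {1..l} \<Longrightarrow> Q i j = (\<Sum>k\<in>{1..l}. A i k * A j k)"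
    using psd_gram[of "{1..l}" Q, OF finite_atLeastAtMost assms] by auto
  let ?G = "PiM {1..l} (\<lambda>_. std_normal_distribution)"
  define T where "T = (\<lambda>z::nat \<Rightarrow> real. \<lambda>i\<in>{1..l}. \<Sum>k\<in>{1..l}. A i k * z k)"
  interpret S: real_distribution std_normal_distribution by (rule real_dist_normal_dist)
  interpret P: product_prob_space "\<lambda>_. std_normal_distribution" "{1..l}"
    by unfold_locales
  have G: "prob_space ?G" by (rule prob_space_PiM) unfold_locales
  have Tm: "T \<in> measurable ?G (vec_space l)"
    unfolding T_def vec_space_def by measurable
  have "continuous_on UNIV cis" by (intro continuous_intros)
  then have cm [measurable]: "cis \<in> borel_measurable borel"
    by (rule borel_measurable_continuous_onI)
  have "(LINT x|distr ?G (vec_space l) T. cis (\<Sum>i\<in>{1..l}. t i * x i)) =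
        complex_of_real (exp (- (\<Sum>i\<in>{1..l}. \<Sum>j\<in>{1..l}. t i * Q i j * t j) / 2))" for t
  proof -
    define b where "b = (\<lambda>k. \<Sum>i\<in>{1..l}. t i * A i k)"
    have lin: "(\<Sum>i\<in>{1..l}. t i * T z i) = (\<Sum>k\<in>{1..l}. b k * z k)" for z
      unfolding T_def b_def by (simp add: sum_distrib_left sum_distrib_right mult.assoc) (rule sum.swap)
    have cis_sum: "cis (\<Sum>k\<in>K. h k) = (\<Prod>k\<in>K. cis (h k))" for K :: "nat set" and h
      by (induction K rule: infinite_finite_induct) (auto simp: cis_mult[symmetric])
    have m: "(\<lambda>x. cis (\<Sum>i\<in>{1..l}. t i * x i)) \<in> borel_measurable (vec_space l)"
      unfolding vec_space_def by measurable
    have "(LINT x|distr ?G (vec_space l) T. cis (\<Sum>i\<in>{1..l}. t i * x i)) =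
          (LINT z|?G. cis (\<Sum>k\<in>{1..l}. b k * z k))"
      by (simp only: integral_distr[OF Tm m] lin)
    also have "\<dots> = (LINT z|?G. (\<Prod>k\<in>{1..l}. cis (b k * z k)))"
      by (simp only: cis_sum)
    also have "\<dots> = (\<Prod>k\<in>{1..l}. LINT x|std_normal_distribution. cis (b k * x))"
      by (rule P.product_integral_prod) (auto intro!: S.integrable_const_bound[of _ 1])
    also have "\<dots> = (\<Prod>k\<in>{1..l}. char std_normal_distribution (b k))"
      by (simp add: char_def cis_conv_exp)
    also have "\<dots> = complex_of_real (\<Prod>k\<in>{1..l}. exp (- (b k)\<^sup>2 / 2))"
      by (simp add: char_std_normal_distribution)
    also have "(\<Prod>k\<in>{1..l}. exp (- (b k)\<^sup>2 / 2)) = exp (- (\<Sum>k\<in>{1..l}. (b k)\<^sup>2) / 2)"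
      by (simp add: exp_sum[symmetric] sum_negf sum_divide_distrib)
    also have "(\<Sum>k\<in>{1..l}. (b k)\<^sup>2) = (\<Sum>k\<in>{1..l}. \<Sum>i\<in>{1..l}. \<Sum>j\<in>{1..l}. t i * (A i k * A j k) * t j)"
      unfolding b_def power2_eq_square sum_product by (simp add: algebra_simps)
    also have "\<dots> = (\<Sum>i\<in>{1..l}. \<Sum>k\<in>{1..l}. \<Sum>j\<in>{1..l}. t i * (A i k * A j k) * t j)"
      by (rule sum.swap)
    also have "\<dots> = (\<Sum>i\<in>{1..l}. \<Sum>j\<in>{1..l}. \<Sum>k\<in>{1..l}. t i * (A i k * A j k) * t j)"
      by (intro sum.cong refl sum.swap)
    also have "\<dots> = (\<Sum>i\<in>{1..l}. \<Sum>j\<in>{1..l}. t i * Q i j * t j)"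
      by (intro sum.cong refl) (simp add: A sum_distrib_left sum_distrib_right)
    finally show ?thesis .
  qed
  then have "is_mvnormal0 l Q (distr ?G (vec_space l) T)"
    unfolding is_mvnormal0_def using prob_space.prob_space_distr[OF G Tm] by simp
  then show ?thesis by blast
qed

section \<open>Trigonometric polynomials and Levy continuity in several dimensions\<close>

text \<open>On the span of the characters, convergence of characteristic functions is literally
  convergence of integrals; being an algebra, it is open to Stone-Weierstrass.\<close>

inductive_set trig :: "nat \<Rightarrow> ((nat \<Rightarrow> real) \<Rightarrow> complex) set" for l where
  trig_cis: "(\<lambda>x. c * cis (\<Sum>i\<in>{1..l}. t i * x i)) \<in> trig l"
| trig_add: "f \<in> trig l \<Longrightarrow> g \<in> trig l \<Longrightarrow> (\<lambda>x. f x + g x) \<in> trig l"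

lemma trig_mult_cis:
  assumes "f \<in> trig l"
  shows "(\<lambda>x. c * cis (\<Sum>i\<in>{1..l}. t i * x i) * f x) \<in> trig l"
  using assms
proof induction
  case (trig_cis d s)
  have "(\<lambda>x. c * cis (\<Sum>i\<in>{1..l}. t i * x i) * (d * cis (\<Sum>i\<in>{1..l}. s i * x i))) =
        (\<lambda>x. (c * d) * cis (\<Sum>i\<in>{1..l}. (t i + s i) * x i))"
    by (simp add: fun_eq_iff cis_mult[symmetric] sum.distrib ring_distribs)
  then show ?case by (simp only: trig.trig_cis)
next
  case (trig_add f g)
  then show ?case by (simp only: ring_distribs trig.trig_add)
qed

lemma trig_mult:
  assumes "f \<in> trig l" "g \<in> trig l"
  shows "(\<lambda>x. f x * g x) \<in> trig l"
  using assms
proof induction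
  case (trig_cis d s)
  then show ?case by (simp only: trig_mult_cis)
next
  case (trig_add f g)
  then show ?case by (simp only: ring_distribs trig.trig_add)
qed

lemma trig_const: "(\<lambda>x. c) \<in> trig l"
  using trig.trig_cis[of c "\<lambda>_. 0" l] by simp

lemma trig_sin:
  assumes "k \<in> {1..l}"
  shows "(\<lambda>x. complex_of_real (sin (c * x k))) \<in> trig l"
proof -
  have s: "(\<Sum>i\<in>{1..l}. (if i = k then b else 0) * x i) = b * x k" for b and x :: "nat \<Rightarrow> real"
    using assms by (simp add: if_distrib[of "\<lambda>y. y * _"] cong: if_cong)
  have "(\<lambda>x. complex_of_real (sin (c * x k))) =
     (\<lambda>x. (- \<i> / 2) * cis (\<Sum>i\<in>{1..l}. (if i = k then c else 0) * x i) +
          (\<i> / 2) * cis (\<Sum>i\<in>{1..l}. (if i = k then - c else 0) * x i))"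
    unfolding s by (auto simp: fun_eq_iff complex_eq_iff)
  then show ?thesis
    by (simp only: trig.trig_add trig.trig_cis)
qed

lemma space_vec_space: "space (vec_space l) = PiE {1..l} (\<lambda>_. UNIV)"
  by (simp add: vec_space_def space_PiM)

lemma vec_space_component [measurable]:
  "k \<in> {1..l} \<Longrightarrow> (\<lambda>x. x k) \<in> borel_measurable (vec_space l)"
  unfolding vec_space_def by measurable

lemma trig_measurable: "f \<in> trig l \<Longrightarrow> f \<in> borel_measurable (vec_space l)"
proof (induction rule: trig.induct)
  case (trig_cis c t)
  have "continuous_on UNIV cis" by (intro continuous_intros)
  then have [measurable]: "cis \<in> borel_measurable borel"
    by (rule borel_measurable_continuous_onI)
  show ?case by measurable
qed measurable

lemma trig_bounded: "f \<in> trig l \<Longrightarrow> \<exists>B. \<forall>x. cmod (f x) \<le> B"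
proof (induction rule: trig.induct)
  case (trig_cis c t)
  then show ?case by (intro exI[of _ "cmod c"]) (auto simp: norm_mult)
next
  case (trig_add f g)
  then obtain B C where "\<forall>x. cmod (f x) \<le> B" "\<forall>x. cmod (g x) \<le> C" by blast
  then show ?case
    by (intro exI[of _ "B + C"]) (auto intro: norm_triangle_le add_mono)
qed

lemma trig_integrable:
  assumes "f \<in> trig l" "prob_space M" "sets M = sets (vec_space l)"
  shows "integrable M f"
proof -
  interpret prob_space M by fact
  obtain B where "\<forall>x. cmod (f x) \<le> B" using trig_bounded[OF assms(1)] by blast
  then show ?thesis
    using trig_measurable[OF assms(1)] assms(3)
    by (intro integrable_const_bound[of _ B]) (auto cong: measurable_cong_sets)
qed

text \<open>Since \<open>sin\<close> maps the cube \<open>[-K, K]\<^sup>l\<close> homeomorphically onto \<open>[-1, 1]\<^sup>l\<close> after rescaling, the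
  approximating polynomial in the sines keeps its bound on all of \<open>\<real>\<^sup>l\<close>.\<close>
lemma trig_approx:
  fixes f :: "(nat \<Rightarrow> real) \<Rightarrow> real"
  assumes f: "continuous_on (PiE {1..l} (\<lambda>_. UNIV)) f"
    and C: "\<And>x. x \<in> PiE {1..l} (\<lambda>_. UNIV) \<Longrightarrow> \<bar>f x\<bar> \<le> C"
    and "K > 0" "e > 0"
  obtains g where "(\<lambda>x. complex_of_real (g x)) \<in> trig l" "\<And>x. \<bar>g x\<bar> \<le> C + e"
    "\<And>x. x \<in> PiE {1..l} (\<lambda>_. {-K..K}) \<Longrightarrow> \<bar>f x - g x\<bar> \<le> e"
proof -
  define c where "c = pi / (2 * K)"
  have "c > 0" using \<open>K > 0\<close> by (simp add: c_def)
  define S :: "(nat \<Rightarrow> real) set" where "S = PiE {1..l} (\<lambda>_. {-1..1})"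
  define h where "h = (\<lambda>u::nat \<Rightarrow> real. \<lambda>k\<in>{1..l}. arcsin (u k) / c)"
  define \<sigma> where "\<sigma> = (\<lambda>x::nat \<Rightarrow> real. \<lambda>k\<in>{1..l}. sin (c * x k))"
  \<comment> \<open>The admissible approximants are functions of the vector of sines whose pullback
    along \<open>\<sigma>\<close> is a trigonometric polynomial; coordinates are among them by
    \<open>trig_sin\<close> and separate points.\<close>
  define P where "P = (\<lambda>G. continuous_on S G \<and> (\<lambda>x. complex_of_real (G (\<sigma> x))) \<in> trig l)"
  have comp: "continuous_on S (\<lambda>u. u k)" for k
    by (rule continuous_on_subset[OF continuous_on_product_coordinates]) auto
  have hc: "continuous_on S (\<lambda>u. f (h u))"
  proof (rule continuous_on_compose2[OF f])
    show "continuous_on S h"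
    proof (rule continuous_on_coordinatewise_then_product)
      fix k
      show "continuous_on S (\<lambda>x. h x k)"
      proof (cases "k \<in> {1..l}")
        case True
        then show ?thesis unfolding h_def using \<open>c > 0\<close>
          by (simp, intro continuous_intros comp) (auto simp: S_def PiE_def Pi_def)
      next
        case False
        then have "(\<lambda>x. h x k) = (\<lambda>x. undefined)" by (auto simp: h_def)
        then show ?thesis by (simp only: continuous_on_const)
      qed
    qed
    show "h ` S \<subseteq> PiE {1..l} (\<lambda>_. UNIV)" by (auto simp: h_def)
  qed
  have "\<exists>G. P G \<and> (\<forall>x\<in>S. \<bar>(\<lambda>u. f (h u)) x - G x\<bar> < e)"
  proof (rule Stone_Weierstrass_HOL)
    \<comment> \<open>Off \<open>{1..l}\<close> an extensional function is \<open>undefined\<close>,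
      so the cube is a full product with one-point factors there, and Tychonoff's theorem
      applies.\<close>
    have "S = PiE UNIV (\<lambda>k. if k \<in> {1..l} then {-1..1} else {undefined})"
      unfolding S_def by (auto simp: PiE_def Pi_def extensional_def split: if_splits)
    moreover have "compactin (product_topology (\<lambda>_. euclidean) UNIV) \<dots>"
      by (subst compactin_PiE) auto
    ultimately show "compact S"
      by (simp add: euclidean_product_topology)
    show "P (\<lambda>x. a)" for a by (simp add: P_def trig_const)
    show "continuous_on S G" if "P G" for G using that by (simp add: P_def)
    show "P (\<lambda>x. G x + H x)" if "P G \<and> P H" for G H
      using that by (auto simp: P_def intro!: continuous_intros trig.trig_add)
    show "P (\<lambda>x. G x * H x)" if "P G \<and> P H" for G H
      using that by (auto simp: P_def intro!: continuous_intros trig_mult)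
    show "\<exists>G. P G \<and> G x \<noteq> G y" if "x \<in> S \<and> y \<in> S \<and> x \<noteq> y" for x y
    proof -
      have "\<exists>k\<in>{1..l}. x k \<noteq> y k"
      proof (rule ccontr)
        assume "\<not> (\<exists>k\<in>{1..l}. x k \<noteq> y k)"
        then have "x = y" using that unfolding S_def
          by (intro PiE_ext[of x "{1..l}" "\<lambda>_. {-1..1}" y]) simp_all
        with that show False by simp
      qed
      then obtain k where k: "k \<in> {1..l}" "x k \<noteq> y k" by (rule bexE)
      have "P (\<lambda>u. u k)"
        using k trig_sin[OF k(1), of c] by (auto simp: P_def comp \<sigma>_def)
      with k show ?thesis by blast
    qed
    show "continuous_on S (\<lambda>u. f (h u))" by fact
    show "e > 0" by fact
  qed
  then obtain G where G: "P G" "\<And>u. u \<in> S \<Longrightarrow> \<bar>f (h u) - G u\<bar> < e" by blast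
  have \<sigma>S: "\<sigma> x \<in> S" for x by (auto simp: \<sigma>_def S_def)
  show ?thesis
  proof
    show "(\<lambda>x. complex_of_real (G (\<sigma> x))) \<in> trig l" using G by (simp add: P_def)
    show "\<bar>G (\<sigma> x)\<bar> \<le> C + e" for x
    proof -
      have "\<bar>f (h (\<sigma> x))\<bar> \<le> C" by (rule C) (auto simp: h_def)
      with G(2)[OF \<sigma>S, of x] show ?thesis by linarith
    qed
    show "\<bar>f x - G (\<sigma> x)\<bar> \<le> e" if x: "x \<in> PiE {1..l} (\<lambda>_. {-K..K})" for x
    proof -
      have "arcsin (sin (c * x k)) / c = x k" if "k \<in> {1..l}" for k
      proof -
        have "\<bar>x k\<bar> \<le> K" using x that by (auto simp: PiE_def Pi_def abs_le_iff)
        then have "\<bar>c * x k\<bar> \<le> pi / 2"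
          using \<open>c > 0\<close> \<open>K > 0\<close> by (simp add: c_def abs_mult field_simps)
        then have "arcsin (sin (c * x k)) = c * x k"
          by (intro arcsin_sin) (auto simp: abs_le_iff)
        with \<open>c > 0\<close> show ?thesis by simp
      qed
      then have "h (\<sigma> x) = x"
        using x by (auto simp: h_def \<sigma>_def fun_eq_iff PiE_def extensional_def)
      with G(2)[OF \<sigma>S, of x] show ?thesis by simp
    qed
  qed
qed

text \<open>A continuous stand-in for the indicator of \<open>\<bar>x\<bar> > j\<close>, so that
  tail masses pass to weak limits.\<close>

definition ramp :: "nat \<Rightarrow> real \<Rightarrow> real" where
  "ramp j x = min 1 (max 0 (\<bar>x\<bar> - real j))"

lemma ramp_bounds: "0 \<le> ramp j x" "ramp j x \<le> 1"
  by (auto simp: ramp_def)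

lemma ramp_eq_1: "\<bar>x\<bar> \<ge> real j + 1 \<Longrightarrow> ramp j x = 1"
  by (auto simp: ramp_def)

lemma continuous_ramp: "isCont (ramp j) x"
  unfolding ramp_def by (intro continuous_intros)

lemma ramp_measurable [measurable]: "ramp j \<in> borel_measurable borel"
  unfolding ramp_def by measurable

lemma ramp_small:
  assumes "real_distribution M" "e > 0"
  shows "\<exists>j. (LINT x|M. ramp j x) < e"
proof -
  interpret real_distribution M by fact
  have "(\<lambda>j. LINT x|M. ramp j x) \<longlonglongrightarrow> (LINT x|M. 0)"
  proof (rule integral_dominated_convergence[where w = "\<lambda>_. 1"])
    show "AE x in M. (\<lambda>j. ramp j x) \<longlonglongrightarrow> 0"
    proof (rule AE_I2, rule tendsto_eventually)
      fix x
      obtain J :: nat where J: "\<bar>x\<bar> \<le> real J" using real_arch_simple by blast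
      have "ramp j x = 0" if "j \<ge> J" for j using J that by (simp add: ramp_def)
      then show "\<forall>\<^sub>F j in sequentially. ramp j x = 0"
        using eventually_sequentially by blast
    qed
    show "AE x in M. norm (ramp i x) \<le> 1" for i using ramp_bounds by (auto intro!: AE_I2)
  qed auto
  then have "\<forall>\<^sub>F j in sequentially. (LINT x|M. ramp j x) < e"
    using \<open>e > 0\<close> by (intro order_tendstoD) auto
  then show ?thesis by (auto simp: eventually_sequentially)
qed

text \<open>Tightness comes from the one-dimensional continuity theorem applied to each coordinate:
  the ramps of all coordinates have small integrals under \<open>M\<close>, hence eventually under
  \<open>N n\<close>. On the remaining cube \<open>f\<close> is replaced by a trigonometric
  polynomial, whose integrals converge by hypothesis and whose global bound controls the error
  outside.\<close>

lemma vec_levy_continuity: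
  fixes N :: "nat \<Rightarrow> (nat \<Rightarrow> real) measure"
  assumes N: "\<And>n. prob_space (N n)" "\<And>n. sets (N n) = sets (vec_space l)"
    and M: "prob_space M" "sets M = sets (vec_space l)"
    and conv: "\<And>t. t \<in> PiE {1..l} (\<lambda>_. UNIV) \<Longrightarrow>
      (\<lambda>n. LINT x|N n. cis (\<Sum>i\<in>{1..l}. t i * x i)) \<longlonglongrightarrow> (LINT x|M. cis (\<Sum>i\<in>{1..l}. t i * x i))"
    and fm: "f \<in> borel_measurable (vec_space l)"
    and f: "continuous_on (PiE {1..l} (\<lambda>_. UNIV)) f" "bounded (f ` PiE {1..l} (\<lambda>_. UNIV))"
  shows "(\<lambda>n. LINT x|N n. f x) \<longlonglongrightarrow> (LINT x|M. f x :: real)"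
proof -
  have meas: "g \<in> borel_measurable (vec_space l) \<Longrightarrow> g \<in> borel_measurable (N n)"
       "g \<in> borel_measurable (vec_space l) \<Longrightarrow> g \<in> borel_measurable M"
    for n and g :: "(nat \<Rightarrow> real) \<Rightarrow> 'b::topological_space"
    using N(2) M(2) by (auto cong: measurable_cong_sets)
  interpret N: prob_space "N n" for n by fact
  interpret M: prob_space M by fact
  have conv': "(\<lambda>n. LINT x|N n. cis (\<Sum>i\<in>{1..l}. t i * x i)) \<longlonglongrightarrow> (LINT x|M. cis (\<Sum>i\<in>{1..l}. t i * x i))" for t
    using conv[of "restrict t {1..l}"] by simp
  have trig_conv: "(\<lambda>n. LINT x|N n. g x) \<longlonglongrightarrow> (LINT x|M. g x)" if "g \<in> trig l" for g
    using that
  proof induction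
    case (trig_cis c t)
    then show ?case using conv'[of t] by (auto intro!: tendsto_intros)
  next
    case (trig_add f g)
    then show ?case
      using trig_integrable N M by (simp add: tendsto_add)
  qed
  have ramp_conv: "(\<lambda>n. LINT x|N n. ramp j (x k)) \<longlonglongrightarrow> (LINT x|M. ramp j (x k))"
    and ramp_lim: "e > 0 \<Longrightarrow> \<exists>j. (LINT x|M. ramp j (x k)) < e"
    if k: "k \<in> {1..l}" for j k and e :: real
  proof -
    note [measurable] = meas[OF vec_space_component[OF k]]
    let ?N = "\<lambda>n. distr (N n) borel (\<lambda>x. x k)" and ?M = "distr M borel (\<lambda>x. x k)"
    have rN: "real_distribution (?N n)" for n
      by (intro N.real_distribution_distr) measurable
    have rM: "real_distribution ?M"
      by (intro M.real_distribution_distr) measurable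
    \<comment> \<open>At a multiple of the \<open>k\<close>-th unit vector the joint characteristic
      function is that of the \<open>k\<close>-th marginal.\<close>
    have s: "(\<Sum>i\<in>{1..l}. (if i = k then b else 0) * x i) = b * x k" for b and x :: "nat \<Rightarrow> real"
      using k by (simp add: if_distrib[of "\<lambda>y. y * _"] cong: if_cong)
    have weak: "weak_conv_m ?N ?M"
    proof (rule levy_continuity[OF rN rM])
      fix t
      show "(\<lambda>n. char (?N n) t) \<longlonglongrightarrow> char ?M t"
        using conv'[of "\<lambda>i. if i = k then t else 0"]
        unfolding s char_def by (simp add: integral_distr cis_conv_exp)
    qed
    have "(\<lambda>n. LINT x|?N n. ramp j x) \<longlonglongrightarrow> (LINT x|?M. ramp j x)"
      by (rule weak_conv_imp_integral_bdd_continuous_conv[OF rN rM weak, where B = 1])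
         (use continuous_ramp ramp_bounds in auto)
    then show "(\<lambda>n. LINT x|N n. ramp j (x k)) \<longlonglongrightarrow> (LINT x|M. ramp j (x k))"
      by (simp add: integral_distr)
    show "\<exists>j. (LINT x|M. ramp j (x k)) < e" if "e > 0"
      using ramp_small[OF rM that] by (simp add: integral_distr)
  qed
  obtain C where C: "\<And>x. x \<in> PiE {1..l} (\<lambda>_. UNIV) \<Longrightarrow> \<bar>f x\<bar> \<le> C"
    using f(2) by (auto simp: bounded_iff)
  have C0: "C \<ge> 0" using C[of "\<lambda>_. undefined"] by (auto intro: order_trans[OF abs_ge_zero])
  show ?thesis
  proof (rule LIMSEQ_I)
    fix e :: real assume "e > 0"
    \<comment> \<open>The budget: \<open>2 * d\<close> for replacing \<open>f\<close> by
      \<open>g\<close> under \<open>N n\<close>, the same under \<open>M\<close>, and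
      \<open>d\<close> for the convergence of the integrals of \<open>g\<close>.\<close>
    define d where "d = min 1 (e / 5)"
    have d: "0 < d" "d \<le> 1" "5 * d \<le> e" using \<open>e > 0\<close> by (auto simp: d_def)
    \<comment> \<open>Off the cube \<open>f\<close> and \<open>g\<close> differ by at most
      \<open>2 * C + 2\<close>; times the sum of \<open>l\<close> tails below \<open>b\<close> this
      stays within \<open>d\<close>. The added constants keep the denominator positive for
      \<open>C = 0\<close> or \<open>l = 0\<close>.\<close>
    define b where "b = d / ((2 * C + 2) * (real l + 1))"
    have b: "b > 0" using d C0 by (simp add: b_def)
    have "\<forall>k\<in>{1..l}. \<exists>j. (LINT x|M. ramp j (x k)) < b"
      using ramp_lim b by blast
    then obtain J where J: "\<And>k. k \<in> {1..l} \<Longrightarrow> (LINT x|M. ramp (J k) (x k)) < b"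
      by metis
    define K where "K = real (\<Sum>k\<in>{1..l}. J k) + 1"
    have "K > 0" unfolding K_def by linarith
    have JK: "real (J k) + 1 \<le> K" if "k \<in> {1..l}" for k
      unfolding K_def using member_le_sum[OF that, of J] by (simp del: of_nat_sum)
    obtain g where g: "(\<lambda>x. complex_of_real (g x)) \<in> trig l" "\<And>x. \<bar>g x\<bar> \<le> C + d"
      "\<And>x. x \<in> PiE {1..l} (\<lambda>_. {-K..K}) \<Longrightarrow> \<bar>f x - g x\<bar> \<le> d"
      using trig_approx[OF f(1) C \<open>K > 0\<close> d(1)] by blast
    have gm: "g \<in> borel_measurable (vec_space l)"
      using measurable_compose[OF trig_measurable[OF g(1)] borel_measurable_Re] by simp
    have key: "\<bar>f x - g x\<bar> \<le> d + (2 * C + 2) * (\<Sum>k\<in>{1..l}. ramp (J k) (x k))"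
      if x: "x \<in> PiE {1..l} (\<lambda>_. UNIV)" for x
    proof (cases "x \<in> PiE {1..l} (\<lambda>_. {-K..K})")
      case True
      then show ?thesis using g(3)[of x] C0 ramp_bounds
        by (smt (verit, best) mult_nonneg_nonneg sum_nonneg)
    next
      case False
      then obtain k where k: "k \<in> {1..l}" "x k \<notin> {-K..K}" using x by (auto simp: PiE_def Pi_def)
      then have "\<bar>x k\<bar> \<ge> real (J k) + 1" using JK[OF k(1)] by auto
      then have "1 \<le> (\<Sum>k\<in>{1..l}. ramp (J k) (x k))"
        using member_le_sum[OF k(1), of "\<lambda>k. ramp (J k) (x k)"] ramp_bounds by (simp add: ramp_eq_1)
      then have "(2 * C + 2) * 1 \<le> (2 * C + 2) * (\<Sum>k\<in>{1..l}. ramp (J k) (x k))"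
        using C0 by (intro mult_left_mono) auto
      moreover have "\<bar>f x - g x\<bar> \<le> 2 * C + d"
        using g(2)[of x] C[OF x] abs_triangle_ineq4[of "f x" "g x"] by linarith
      ultimately show ?thesis by (simp only: mult_1_right)
    qed
    have int: "\<bar>(LINT x|L. f x) - (LINT x|L. g x)\<bar> \<le> d + (2 * C + 2) * (\<Sum>k\<in>{1..l}. LINT x|L. ramp (J k) (x k))"
      if L: "prob_space L" "sets L = sets (vec_space l)" for L
    proof -
      interpret L: prob_space L by fact
      have sL: "space L = PiE {1..l} (\<lambda>_. UNIV)"
        using sets_eq_imp_space_eq[OF L(2)] by (auto simp: space_vec_space)
      have mL: "h \<in> borel_measurable L" if "h \<in> borel_measurable (vec_space l)" for h :: "(nat \<Rightarrow> real) \<Rightarrow> real"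
        using L(2) that by (auto cong: measurable_cong_sets)
      have fi: "integrable L f"
        using C by (intro L.integrable_const_bound[of _ C] mL fm AE_I2) (simp add: sL)
      have gi: "integrable L g"
        using g(2) by (intro L.integrable_const_bound[of _ "C + d"] mL gm AE_I2) simp
      have ri: "integrable L (\<lambda>x. ramp (J k) (x k))" if k: "k \<in> {1..l}" for k
        using ramp_bounds measurable_compose[OF vec_space_component[OF k] ramp_measurable]
        by (intro L.integrable_const_bound[of _ 1] mL AE_I2) simp_all
      have "\<bar>(LINT x|L. f x) - (LINT x|L. g x)\<bar> = \<bar>LINT x|L. f x - g x\<bar>"
        using fi gi by simp
      also have "\<dots> \<le> (LINT x|L. \<bar>f x - g x\<bar>)" by (rule integral_abs_bound)
      also have "\<dots> \<le> (LINT x|L. d + (2 * C + 2) * (\<Sum>k\<in>{1..l}. ramp (J k) (x k)))"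
      proof (rule integral_mono)
        show "integrable L (\<lambda>x. \<bar>f x - g x\<bar>)" using fi gi by simp
        show "integrable L (\<lambda>x. d + (2 * C + 2) * (\<Sum>k\<in>{1..l}. ramp (J k) (x k)))"
          by (intro Bochner_Integration.integrable_add L.integrable_const
              integrable_mult_right Bochner_Integration.integrable_sum ri)
        show "\<bar>f x - g x\<bar> \<le> d + (2 * C + 2) * (\<Sum>k\<in>{1..l}. ramp (J k) (x k))" if "x \<in> space L" for x
          using that unfolding sL by (rule key)
      qed
      also have "\<dots> = d + (2 * C + 2) * (\<Sum>k\<in>{1..l}. LINT x|L. ramp (J k) (x k))"
        using ri by (subst Bochner_Integration.integral_add) (auto simp: L.prob_space)
      finally show ?thesis .
    qed
    have bb: "(2 * C + 2) * (\<Sum>k\<in>{1..l}. r k) \<le> d" if "\<And>k. k \<in> {1..l} \<Longrightarrow> r k < b" for r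
    proof -
      have "(\<Sum>k\<in>{1..l}. r k) \<le> (\<Sum>k\<in>{1..l}. b)" using that by (intro sum_mono) force
      also have "\<dots> \<le> (real l + 1) * b" using b by simp
      finally have "(2 * C + 2) * (\<Sum>k\<in>{1..l}. r k) \<le> (2 * C + 2) * ((real l + 1) * b)"
        using C0 by (intro mult_left_mono) auto
      also have "\<dots> = d"
      proof -
        have "(2 * C + 2) * (real l + 1) \<noteq> 0" using C0 by auto
        then show ?thesis
          unfolding b_def mult.assoc[symmetric] times_divide_eq_right
          by (rule nonzero_mult_div_cancel_left)
      qed
      finally show ?thesis .
    qed
    have M': "\<bar>(LINT x|M. f x) - (LINT x|M. g x)\<bar> \<le> 2 * d"
      using int[OF M] bb[of "\<lambda>k. LINT x|M. ramp (J k) (x k)", OF J] by linarith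
    have "(\<lambda>n. complex_of_real (LINT x|N n. g x)) \<longlonglongrightarrow> complex_of_real (LINT x|M. g x)"
      using trig_conv[OF g(1)] by simp
    then have "(\<lambda>n. LINT x|N n. g x) \<longlonglongrightarrow> (LINT x|M. g x)"
      by (simp only: tendsto_of_real_iff)
    then have ev1: "\<forall>\<^sub>F n in sequentially. \<bar>(LINT x|N n. g x) - (LINT x|M. g x)\<bar> < d"
      unfolding dist_real_def[symmetric] using d(1) by (rule tendstoD)
    have ev2: "\<forall>\<^sub>F n in sequentially. \<forall>k\<in>{1..l}. (LINT x|N n. ramp (J k) (x k)) < b"
      using order_tendstoD(2)[OF ramp_conv J] by (intro eventually_ball_finite) auto
    from ev1 ev2 have "\<forall>\<^sub>F n in sequentially. norm ((LINT x|N n. f x) - (LINT x|M. f x)) < e"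
    proof eventually_elim
      case (elim n)
      have "(2 * C + 2) * (\<Sum>k\<in>{1..l}. LINT x|N n. ramp (J k) (x k)) \<le> d"
        using elim(2) by (intro bb) (rule bspec)
      then have "\<bar>(LINT x|N n. f x) - (LINT x|N n. g x)\<bar> \<le> 2 * d"
        using int[OF N(1)[of n] N(2)[of n]] by linarith
      with M' elim(1) d show ?case unfolding real_norm_def by linarith
    qed
    then show "\<exists>no. \<forall>n\<ge>no. norm ((LINT x|N n. f x) - (LINT x|M. f x)) < e"
      by (simp add: eventually_sequentially)
  qed
qed

section \<open>Perturbed renewal sequences\<close>

text \<open>Formal power series turn convolution equations into ring identities without questions of
  convergence; both real and complex sequences are treated this way.\<close>

lemma renewal_fps:
  fixes u a :: "nat \<Rightarrow> 'a::comm_ring_1"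
  assumes "\<And>n. u n = (if n = 0 then 1 else \<Sum>m=1..n. a m * u (n - m))" "a 0 = 0"
  shows "Abs_fps u * (1 - Abs_fps a) = 1"
proof -
  have "fps_nth (Abs_fps a * Abs_fps u) n = u n - (if n = 0 then 1 else 0)" for n
    using assms(1)[of n] assms(2)
    by (auto simp: fps_mult_nth sum.atLeast_Suc_atMost[of 0 n])
  then have "Abs_fps a * Abs_fps u = Abs_fps u - 1"
    by (intro fps_ext) simp
  then show ?thesis by (simp add: algebra_simps)
qed

lemma tail_tendsto_0:
  fixes f :: "nat \<Rightarrow> 'a::real_normed_vector"
  assumes "summable f"
  shows "(\<lambda>n. suminf f - (\<Sum>k\<le>n. f k)) \<longlonglongrightarrow> 0"
  using tendsto_diff[OF tendsto_const summable_LIMSEQ'[OF assms], of "suminf f"] by simp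

lemma sum_mult_index_by_tails:
  fixes f :: "nat \<Rightarrow> real"
  defines "T \<equiv> \<lambda>n. suminf f - (\<Sum>k\<le>n. f k)"
  shows "(\<Sum>k\<le>N. real k * f k) = (\<Sum>n<N. T n) - real N * T N"
proof (induction N)
  case (Suc N)
  have "T N = T (Suc N) + f (Suc N)" by (simp add: T_def)
  then have "real N * T N = real N * T (Suc N) + real N * f (Suc N)" by (simp add: algebra_simps)
  with Suc \<open>T N = _\<close> show ?case by (simp add: algebra_simps)
qed simp

text \<open>Summation by parts leaves the boundary term \<open>real N * T N\<close>. Its sign alone
  gives summability of \<open>real k * f k\<close>; it is then dominated by the tail of that very
  series and tends to 0.\<close>

lemma sums_mult_index_by_tails:
  fixes f :: "nat \<Rightarrow> real"
  defines "T \<equiv> \<lambda>n. suminf f - (\<Sum>k\<le>n. f k)"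
  assumes "\<And>k. f k \<ge> 0" "summable f" "summable T"
  shows "(\<lambda>k. real k * f k) sums suminf T"
proof -
  have T0: "T n \<ge> 0" for n
    unfolding T_def using sum_le_suminf[OF assms(3), of "{..n}"] assms(2) by simp
  have id: "(\<Sum>k\<le>N. real k * f k) = (\<Sum>n<N. T n) - real N * T N" for N
    unfolding T_def by (rule sum_mult_index_by_tails)
  have bd: "(\<Sum>k\<le>N. real k * f k) \<le> suminf T" for N
  proof -
    have "(\<Sum>k\<le>N. real k * f k) \<le> (\<Sum>n<N. T n)" unfolding id using T0 by simp
    also have "\<dots> \<le> suminf T" by (rule sum_le_suminf[OF assms(4)]) (auto simp: T0)
    finally show ?thesis .
  qed
  have s: "summable (\<lambda>k. real k * f k)"
  proof (rule summableI_nonneg_bounded)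
    show "(\<Sum>k<n. real k * f k) \<le> suminf T" for n
      using bd[of n] assms(2) by (intro order_trans[OF sum_mono2 bd[of n]]) auto
  qed (simp add: assms(2))
  have le: "real N * T N \<le> suminf (\<lambda>k. real k * f k) - (\<Sum>k\<le>N. real k * f k)" for N
  proof -
    have sf: "summable (\<lambda>k. f (k + Suc N))" using assms(3) by (rule summable_ignore_initial_segment)
    have sg: "summable (\<lambda>k. real (k + Suc N) * f (k + Suc N))" using s by (rule summable_ignore_initial_segment)
    have "real N * T N = (\<Sum>k. real N * f (k + Suc N))"
      using suminf_minus_initial_segment[OF assms(3), of "Suc N"] sf
      by (simp add: T_def suminf_mult lessThan_Suc_atMost)
    also have "\<dots> \<le> (\<Sum>k. real (k + Suc N) * f (k + Suc N))"
      by (intro suminf_le sg summable_mult sf mult_right_mono) (auto simp: assms(2))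
    also have "\<dots> = suminf (\<lambda>k. real k * f k) - (\<Sum>k\<le>N. real k * f k)"
      using suminf_minus_initial_segment[OF s, of "Suc N"] by (simp add: lessThan_Suc_atMost)
    finally show ?thesis .
  qed
  have ge: "0 \<le> real N * T N" for N using T0 by (rule mult_nonneg_nonneg[OF of_nat_0_le_iff])
  have "(\<lambda>N. real N * T N) \<longlonglongrightarrow> 0"
    by (rule tendsto_sandwich[OF always_eventually always_eventually tendsto_const tail_tendsto_0[OF s]])
       (use le ge in blast)+
  then have "(\<lambda>N. (\<Sum>n<N. T n) - real N * T N) \<longlonglongrightarrow> suminf T - 0"
    by (intro tendsto_diff summable_LIMSEQ assms)
  then have "(\<lambda>N. \<Sum>k\<le>N. real k * f k) \<longlonglongrightarrow> suminf T" by (simp add: id)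
  then show ?thesis by (simp add: sums_def_le)
qed

lemma convolution_bound:
  fixes f g :: "nat \<Rightarrow> complex"
  assumes "\<And>n. cmod (g n) \<le> G" "(\<Sum>i\<le>n. cmod (f i)) \<le> F"
  shows "cmod (fps_nth (Abs_fps f * Abs_fps g) n) \<le> F * G"
proof -
  have "G \<ge> 0" using assms(1)[of 0] norm_ge_zero order_trans by blast
  have "cmod (fps_nth (Abs_fps f * Abs_fps g) n) \<le> (\<Sum>i\<le>n. cmod (f i * g (n - i)))"
    by (auto simp: fps_mult_nth atLeast0AtMost intro: norm_sum)
  also have "\<dots> \<le> (\<Sum>i\<le>n. cmod (f i) * G)"
    by (intro sum_mono) (auto simp: norm_mult intro!: mult_left_mono assms)
  also have "\<dots> \<le> F * G"
    unfolding sum_distrib_right[symmetric] by (intro mult_right_mono assms \<open>G \<ge> 0\<close>)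
  finally show ?thesis .
qed

section \<open>Moments of the gap distribution, recovered from the renewal sequence\<close>

text \<open>The data sit on the side of \<open>u\<close>: neither the total mass nor any moment of
  \<open>a\<close> is assumed, all of this is deduced from monotonicity and the summable excess over
  \<open>c\<close>.\<close>

locale renewal =
  fixes a u :: "nat \<Rightarrow> real" and c :: real
  assumes a_0: "a 0 = 0" and a_nonneg: "a m \<ge> 0"
    and u_rec: "u n = (if n = 0 then 1 else \<Sum>m=1..n. a m * u (n - m))"
    and u_decseq: "decseq u" and u_lim: "u \<longlonglongrightarrow> c" and c_pos: "c > 0"
    and u_summable: "summable (\<lambda>n. u n - c)"
begin

lemma u_ge: "u n \<ge> c"
  using u_decseq u_lim by (simp add: decseq_ge)

lemma u_0: "u 0 = 1"
  using u_rec[of 0] by simp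

lemma u_le_1: "u n \<le> 1"
  using u_decseq u_0 by (metis decseqD le0)

text \<open>By monotonicity every factor \<open>u (n - m)\<close> in the renewal equation is at
  least \<open>u n\<close>, which is positive.\<close>

lemma sum_a_le: "(\<Sum>m\<le>n. a m) \<le> 1"
proof (cases "n = 0")
  case False
  have "u n * (\<Sum>m=1..n. a m) \<le> (\<Sum>m=1..n. a m * u (n - m))"
    unfolding sum_distrib_left using u_decseq
    by (intro sum_mono) (auto simp: mult.commute decseqD intro!: mult_left_mono a_nonneg)
  also have "\<dots> = u n * 1" using u_rec[of n] False by simp
  finally have "(\<Sum>m=1..n. a m) \<le> 1" using u_ge[of n] c_pos by simp
  then show ?thesis using a_0 by (simp add: atMost_atLeast0 sum.atLeast_Suc_atMost)
qed (simp add: a_0)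

lemma a_summable: "summable a"
proof (rule summableI_nonneg_bounded)
  show "(\<Sum>k<n. a k) \<le> 1" for n
    using sum_a_le[of n] a_nonneg by (intro order_trans[OF sum_mono2 sum_a_le[of n]]) auto
qed (rule a_nonneg)

text \<open>The survival function of the gap, once the total mass is known to be 1.\<close>

definition B :: "nat \<Rightarrow> real" where "B k = 1 - (\<Sum>m\<le>k. a m)"

lemma B_nonneg: "B k \<ge> 0"
  using sum_a_le by (simp add: B_def)

text \<open>Probabilistically: the last renewal up to time \<open>n\<close> is at some
  \<open>n - k\<close>, and the gap following it exceeds \<open>k\<close>. Algebraically:
  \<open>1 - X\<close> times the series of \<open>B\<close> is one minus the series of
  \<open>a\<close>, the inverse of the series of \<open>u\<close>.\<close>

lemma B_conv_u: "(\<Sum>k\<le>n. B k * u (n - k)) = 1"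
proof -
  have "(1 - fps_X) * Abs_fps B = 1 - Abs_fps a"
  proof (rule fps_ext)
    fix n
    show "fps_nth ((1 - fps_X) * Abs_fps B) n = fps_nth (1 - Abs_fps a) n"
      by (cases n) (auto simp: left_diff_distrib B_def a_0)
  qed
  moreover have "Abs_fps u * (1 - Abs_fps a) = 1"
    by (rule renewal_fps) (use u_rec a_0 in auto)
  ultimately have *: "(1 - fps_X) * (Abs_fps B * Abs_fps u) = 1"
    by (simp add: ac_simps)
  have **: "(1 - fps_X) * Abs_fps (\<lambda>_. 1::real) = 1"
  proof (rule fps_ext)
    fix n
    show "fps_nth ((1 - fps_X) * Abs_fps (\<lambda>_. 1::real)) n = fps_nth 1 n"
      by (cases n) (auto simp: left_diff_distrib)
  qed
  have "Abs_fps B * Abs_fps u = ((1 - fps_X) * Abs_fps (\<lambda>_. 1::real)) * (Abs_fps B * Abs_fps u)"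
    by (simp add: **)
  also have "\<dots> = Abs_fps (\<lambda>_. 1) * ((1 - fps_X) * (Abs_fps B * Abs_fps u))"
    by (simp only: ac_simps)
  also have "\<dots> = Abs_fps (\<lambda>_. 1)" by (simp add: *)
  finally have "fps_nth (Abs_fps B * Abs_fps u) n = 1" by simp
  then show ?thesis by (simp add: fps_mult_nth atLeast0AtMost)
qed

text \<open>As \<open>u\<close> never drops below \<open>c\<close>, \<open>B_conv_u\<close> bounds
  \<open>c\<close> times each partial sum by 1.\<close>

lemma B_summable: "summable B"
proof (rule summableI_nonneg_bounded)
  show "(\<Sum>k<n. B k) \<le> 1 / c" for n
  proof -
    have "(\<Sum>k<n. B k) \<le> (\<Sum>k\<le>n. B k)" using B_nonneg by (intro sum_mono2) auto
    moreover have "(\<Sum>k\<le>n. B k) * c \<le> (\<Sum>k\<le>n. B k * u (n - k))"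
      unfolding sum_distrib_right by (intro sum_mono mult_left_mono u_ge B_nonneg)
    ultimately have "(\<Sum>k<n. B k) * c \<le> 1"
      unfolding B_conv_u using c_pos by (smt (verit) mult_right_mono)
    then show ?thesis using c_pos by (simp add: field_simps)
  qed
qed (rule B_nonneg)

lemma B_excess: "1 - c * (\<Sum>k\<le>n. B k) = (\<Sum>k\<le>n. B k * (u (n - k) - c))"
  using B_conv_u[of n] by (simp add: right_diff_distrib sum_subtractf sum_distrib_left mult.commute)

lemma B_excess_summable: "summable (\<lambda>n. \<Sum>k\<le>n. B k * (u (n - k) - c))"
  using B_summable u_summable B_nonneg u_ge
  by (intro summable_Cauchy_product) auto

text \<open>The renewal theorem read backwards: the limiting density is the reciprocal of the mean
  gap. The defect of the partial sums is a convolution of two summable sequences, hence a null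
  sequence.\<close>

lemma suminf_B: "c * suminf B = 1"
proof -
  have "(\<lambda>n. 1 - c * (\<Sum>k\<le>n. B k)) \<longlonglongrightarrow> 1 - c * suminf B"
    by (intro tendsto_intros summable_LIMSEQ' B_summable)
  moreover have "(\<lambda>n. 1 - c * (\<Sum>k\<le>n. B k)) \<longlonglongrightarrow> 0"
    unfolding B_excess by (rule summable_LIMSEQ_zero[OF B_excess_summable])
  ultimately show ?thesis using LIMSEQ_unique by fastforce
qed

lemma suminf_a: "suminf a = 1"
proof -
  have "(\<lambda>n. 1 - B n) \<longlonglongrightarrow> 1 - 0"
    by (intro tendsto_intros summable_LIMSEQ_zero B_summable)
  then have "a sums 1" unfolding sums_def_le B_def by simp
  then show ?thesis by (simp add: sums_iff)
qed

lemma B_tail: "B = (\<lambda>n. suminf a - (\<Sum>k\<le>n. a k))"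
  by (simp add: fun_eq_iff B_def suminf_a)

lemma first_moment: "(\<lambda>m. real m * a m) sums (1 / c)"
proof -
  have "suminf B = 1 / c" using suminf_B c_pos by (simp add: field_simps)
  then show ?thesis
    using sums_mult_index_by_tails[OF a_nonneg a_summable] B_summable
    unfolding B_tail[symmetric] by simp
qed

text \<open>Up to the factor \<open>c\<close>, the tails of \<open>B\<close> are the convolution of \<open>B\<close> with the summable
  sequence \<open>u - c\<close>; this is what gives \<open>a\<close> a finite second moment.\<close>
lemma B_tail_summable: "summable (\<lambda>n. suminf B - (\<Sum>k\<le>n. B k))"
proof -
  have "(\<lambda>n. suminf B - (\<Sum>k\<le>n. B k)) = (\<lambda>n. (1 / c) * (\<Sum>k\<le>n. B k * (u (n - k) - c)))"
    unfolding B_excess[symmetric] using suminf_B c_pos by (auto simp: fun_eq_iff field_simps)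
  then show ?thesis
    using summable_mult[OF B_excess_summable] by simp
qed

lemma B_first_moment: "summable (\<lambda>k. real k * B k)"
  using sums_mult_index_by_tails[OF B_nonneg B_summable B_tail_summable] by (simp add: sums_iff)

text \<open>Summability of these tails gives the second moment of \<open>a\<close>; they also bound
  the cost of truncating first-order sums in the residual below.\<close>

definition G :: "nat \<Rightarrow> real" where "G n = (\<Sum>m. real m * a m) - (\<Sum>m\<le>n. real m * a m)"

lemma G_eq: "G n = suminf B - (\<Sum>k<n. B k) + real n * B n"
proof -
  have "suminf B = 1 / c" using suminf_B c_pos by (simp add: field_simps)
  moreover have "(\<Sum>m\<le>n. real m * a m) = (\<Sum>k<n. B k) - real n * B n"
    using sum_mult_index_by_tails[of a n] unfolding B_tail[symmetric] by (simp add: B_def suminf_a)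
  ultimately show ?thesis using first_moment by (simp add: sums_iff G_def)
qed

lemma G_summable: "summable G"
proof -
  have "G = (\<lambda>n. (suminf B - (\<Sum>k\<le>n. B k)) + B n + real n * B n)"
    by (simp add: fun_eq_iff G_eq lessThan_Suc_atMost[symmetric])
  then show ?thesis
    using B_tail_summable B_summable B_first_moment by (auto intro!: summable_add)
qed

lemma second_moment: "summable (\<lambda>m. (real m)\<^sup>2 * a m)"
proof -
  have "summable (\<lambda>k. real k * (real k * a k))"
    using sums_mult_index_by_tails[of "\<lambda>m. real m * a m"] first_moment a_nonneg G_summable
    unfolding G_def[abs_def] by (auto simp: sums_iff)
  then show ?thesis by (simp add: power2_eq_square mult.assoc)
qed

end

lemma tail_norm_le:
  fixes h :: "nat \<Rightarrow> complex"
  assumes "\<And>m. cmod (h m) \<le> g m" "summable g"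
  shows "cmod (suminf h - (\<Sum>m\<le>j. h m)) \<le> suminf g - (\<Sum>m\<le>j. g m)"
proof -
  have sh: "summable h" by (rule summable_comparison_test'[OF assms(2), of 0]) (rule assms(1))
  have "suminf h - (\<Sum>m\<le>j. h m) = (\<Sum>m. h (m + Suc j))"
    using suminf_minus_initial_segment[OF sh, of "Suc j"] by (simp add: lessThan_Suc_atMost)
  moreover have "suminf g - (\<Sum>m\<le>j. g m) = (\<Sum>m. g (m + Suc j))"
    using suminf_minus_initial_segment[OF assms(2), of "Suc j"] by (simp add: lessThan_Suc_atMost)
  moreover have "cmod (\<Sum>m. h (m + Suc j)) \<le> (\<Sum>m. g (m + Suc j))"
    using assms by (intro norm_suminf_le summable_ignore_initial_segment) auto
  ultimately show ?thesis by simp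
qed

text \<open>Multiply \<open>1 - y \<le> exp (- y)\<close> by \<open>(1 + y) * exp y\<close>.\<close>

lemma exp_remainder_2:
  fixes y :: real
  assumes "y \<ge> 0"
  shows "exp y - 1 - y \<le> y\<^sup>2 * exp y"
proof -
  have "(1 + y) * (1 - y) \<le> (1 + y) * exp (- y)"
    using exp_ge_add_one_self[of "- y"] assms by (intro mult_left_mono) auto
  then have "(1 + y) * (1 - y) * exp y \<le> (1 + y) * exp (- y) * exp y"
    by (intro mult_right_mono) auto
  also have "\<dots> = 1 + y" by (simp add: mult.assoc exp_minus_inverse[symmetric] mult.commute[of "exp (-y)"]) (simp add: exp_minus)
  finally show ?thesis by (simp add: algebra_simps power2_eq_square)
qed

section \<open>Renewal equations with perturbed complex coefficients\<close>

text \<open>The model: blocks of size \<open>m\<close> have total mass \<open>a m\<close> and carry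
  a reward of modulus at most \<open>K * m\<close>; \<open>\<alpha> x m\<close> integrates
  \<open>cis\<close> of \<open>x\<close> times the reward over them.\<close>

locale perturbed_renewal = renewal a u c for a u c +
  fixes \<alpha> ut :: "real \<Rightarrow> nat \<Rightarrow> complex" and K :: real
  assumes \<alpha>_le: "cmod (\<alpha> x m) \<le> a m"
    and \<alpha>_lipschitz: "cmod (\<alpha> x m - of_real (a m)) \<le> K * \<bar>x\<bar> * (real m * a m)"
    and K_nonneg: "K \<ge> 0"
    and ut_rec: "ut x n = (if n = 0 then 1 else \<Sum>m=1..n. \<alpha> x m * ut x (n - m))"
begin

lemma ut_le: "cmod (ut x n) \<le> u n"
proof (induction n rule: less_induct)
  case (less n)
  show ?case
  proof (cases "n = 0")
    case False
    have "cmod (ut x n) \<le> (\<Sum>m=1..n. cmod (\<alpha> x m * ut x (n - m)))"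
      using False by (subst ut_rec) (auto intro: norm_sum)
    also have "\<dots> \<le> (\<Sum>m=1..n. a m * u (n - m))"
      using less by (intro sum_mono) (auto simp: norm_mult intro!: mult_mono \<alpha>_le a_nonneg)
    also have "\<dots> = u n" using False by (subst (2) u_rec) simp
    finally show ?thesis .
  qed (use ut_rec[of x 0] u_0 in simp)
qed

lemma ut_le_1: "cmod (ut x n) \<le> 1"
  using ut_le u_le_1 by (rule order_trans)

lemma \<alpha>_0: "\<alpha> x 0 = 0"
  using \<alpha>_le[of x 0] a_0 by simp

lemma ut_fps: "Abs_fps (ut x) * (1 - Abs_fps (\<alpha> x)) = 1"
  by (rule renewal_fps) (use ut_rec \<alpha>_0 in auto)

lemma u_fps: "Abs_fps (\<lambda>n. complex_of_real (u n)) * (1 - Abs_fps (\<lambda>n. complex_of_real (a n))) = 1"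
proof (rule renewal_fps)
  fix n
  show "complex_of_real (u n) = (if n = 0 then 1 else \<Sum>m=1..n. of_real (a m) * of_real (u (n - m)))"
    by (subst u_rec) simp
qed (simp add: a_0)

text \<open>The resolvent identity writes the series of \<open>ut x\<close> minus that of
  \<open>u\<close> as the product of both with the difference of the coefficients. After
  multiplication by \<open>1 - X\<close> one factor consists of the increments of \<open>u\<close>,
  with summable variation, and the rest is of order \<open>\<bar>x\<bar>\<close> uniformly in
  \<open>n\<close>.\<close>

lemma ut_step:
  "cmod (ut x (Suc n) - ut x n) \<le> (u n - u (Suc n)) + 2 * (K * \<bar>x\<bar> / c)"
proof -
  define v where "v = (\<lambda>n. complex_of_real (u n - (if n = 0 then 0 else u (n - 1))))"
  define d where "d = (\<lambda>m. \<alpha> x m - of_real (a m))"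
  let ?U = "Abs_fps (\<lambda>n. complex_of_real (u n))" and ?T = "Abs_fps (ut x)"
  let ?a = "Abs_fps (\<lambda>n. complex_of_real (a n))" and ?\<alpha> = "Abs_fps (\<alpha> x)"
  have v: "(1 - fps_X) * ?U = Abs_fps v"
    by (rule fps_ext) (auto simp: v_def left_diff_distrib)
  have "?T - ?U = ?T * (?U * (1 - ?a)) - ?U * (?T * (1 - ?\<alpha>))"
    by (simp add: ut_fps u_fps)
  also have "\<dots> = ?U * ((?\<alpha> - ?a) * ?T)" by (simp add: algebra_simps)
  finally have "(1 - fps_X) * (?T - ?U) = ((1 - fps_X) * ?U) * ((?\<alpha> - ?a) * ?T)"
    by (simp add: mult.assoc)
  also have "?\<alpha> - ?a = Abs_fps d" by (rule fps_ext) (simp add: d_def)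
  finally have id: "(1 - fps_X) * (?T - ?U) = Abs_fps v * Abs_fps (fps_nth (Abs_fps d * ?T))"
    by (simp only: v fps_nth_inverse)
  have dl: "(\<Sum>i\<le>n. cmod (d i)) \<le> K * \<bar>x\<bar> / c" for n
  proof -
    have "(\<Sum>i\<le>n. cmod (d i)) \<le> K * \<bar>x\<bar> * (\<Sum>i\<le>n. real i * a i)"
      unfolding d_def sum_distrib_left by (intro sum_mono \<alpha>_lipschitz)
    also have "\<dots> \<le> K * \<bar>x\<bar> * (1 / c)"
      using first_moment a_nonneg K_nonneg
      by (intro mult_left_mono) (auto simp: sums_iff intro!: sum_le_suminf[THEN order_trans])
    finally show ?thesis by simp
  qed
  have "cmod (fps_nth (Abs_fps d * ?T) n) \<le> K * \<bar>x\<bar> / c * 1" for n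
    by (rule convolution_bound[OF ut_le_1 dl])
  then have dT: "cmod (fps_nth (Abs_fps d * ?T) n) \<le> K * \<bar>x\<bar> / c" for n by simp
  \<comment> \<open>The initial jump \<open>v 0 = 1\<close> plus the total decrease
    \<open>1 - u n\<close>; this is the origin of the factor 2 in the statement.\<close>
  have "(\<Sum>i\<le>n. cmod (v i)) = 2 - u n" for n
  proof (induction n)
    case 0
    then show ?case by (simp add: v_def u_0)
  next
    case (Suc n)
    have "u (Suc n) \<le> u n" using u_decseq by (simp add: decseq_Suc_iff)
    then have "cmod (v (Suc n)) = u n - u (Suc n)"
      unfolding v_def by (simp only: norm_of_real) simp
    with Suc show ?case by simp
  qed
  then have vl: "(\<Sum>i\<le>n. cmod (v i)) \<le> 2" for n using u_ge[of n] c_pos by simp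
  have "cmod (fps_nth ((1 - fps_X) * (?T - ?U)) (Suc n)) \<le> 2 * (K * \<bar>x\<bar> / c)"
    unfolding id by (rule convolution_bound[OF dT vl])
  then have "cmod ((ut x (Suc n) - ut x n) - (of_real (u (Suc n)) - of_real (u n))) \<le> 2 * (K * \<bar>x\<bar> / c)"
    by (simp add: left_diff_distrib algebra_simps)
  then have "cmod (ut x (Suc n) - ut x n) \<le> 2 * (K * \<bar>x\<bar> / c) + cmod (of_real (u (Suc n) - u n))"
    by (smt (verit, best) norm_triangle_sub of_real_diff)
  also have "cmod (of_real (u (Suc n) - u n)) = u n - u (Suc n)"
    unfolding norm_of_real using u_decseq by (simp add: decseq_Suc_iff)
  finally show ?thesis by simp
qed

lemma ut_steps:
  "cmod (ut x (n + j) - ut x n) \<le> (u n - u (n + j)) + real j * (2 * (K * \<bar>x\<bar> / c))"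
proof (induction j)
  case (Suc j)
  have "cmod (ut x (n + Suc j) - ut x n) \<le> cmod (ut x (n + Suc j) - ut x (n + j)) + cmod (ut x (n + j) - ut x n)"
    using norm_triangle_ineq[of "ut x (n + Suc j) - ut x (n + j)" "ut x (n + j) - ut x n"] by simp
  with Suc ut_step[of x "n + j"] show ?case by (simp add: algebra_simps add_divide_distrib)
qed simp

text \<open>\<open>ut\<close> varies slowly (\<open>ut_steps\<close>), so convolving it with a summable sequence of total mass \<open>0\<close> is negligible.\<close>
lemma convolution_null_sum_tendsto_0:
  fixes q :: "nat \<Rightarrow> complex"
  assumes q: "summable (\<lambda>j. cmod (q j))" "suminf q = 0"
    and s: "s \<longlonglongrightarrow> 0" and N: "filterlim N at_top sequentially"
  shows "(\<lambda>n. \<Sum>j\<le>N n. q j * ut (s n) (N n - j)) \<longlonglongrightarrow> 0"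
proof -
  \<comment> \<open>Only the variation of \<open>ut\<close> is kept here, extended by 0 beyond
    \<open>N n\<close> for dominated convergence; the constant \<open>ut (s n) (N n)\<close>
    multiplies partial sums of a series with sum 0.\<close>
  define f where "f = (\<lambda>j n. if j \<le> N n then q j * (ut (s n) (N n - j) - ut (s n) (N n)) else 0)"
  have lim: "(\<lambda>n. f j n) \<longlonglongrightarrow> 0" for j
  proof -
    have Nj: "filterlim (\<lambda>n. N n - j) at_top sequentially"
      using N filterlim_compose[OF filterlim_minus_const_nat_at_top N] by simp
    have "(\<lambda>n. cmod (q j) * ((u (N n - j) - u (N n)) + real j * (2 * (K * \<bar>s n\<bar> / c))))
        \<longlonglongrightarrow> cmod (q j) * ((c - c) + real j * (2 * (K * \<bar>0\<bar> / c)))"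
      by (intro tendsto_intros filterlim_compose[OF u_lim] Nj N s) (use c_pos in auto)
    moreover have "\<forall>\<^sub>F n in sequentially. N n \<ge> j"
      using N by (simp add: filterlim_at_top)
    then have "\<forall>\<^sub>F n in sequentially. norm (f j n) \<le>
        cmod (q j) * ((u (N n - j) - u (N n)) + real j * (2 * (K * \<bar>s n\<bar> / c)))"
    proof eventually_elim
      case (elim n)
      show ?case using elim ut_steps[of "s n" "N n - j" j]
        by (auto simp: f_def norm_mult norm_minus_commute intro!: mult_left_mono)
    qed
    ultimately show ?thesis by (auto intro: Lim_null_comparison)
  qed
  have bound: "norm (f j n) \<le> 2 * cmod (q j)" for j n
  proof -
    have "cmod (ut (s n) (N n - j) - ut (s n) (N n)) \<le> 2"
      using norm_triangle_ineq4[of "ut (s n) (N n - j)" "ut (s n) (N n)"]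
        ut_le_1[of "s n" "N n - j"] ut_le_1[of "s n" "N n"] by linarith
    then have "cmod (q j) * cmod (ut (s n) (N n - j) - ut (s n) (N n)) \<le> cmod (q j) * 2"
      by (rule mult_left_mono) simp
    then show ?thesis by (auto simp: f_def norm_mult mult.commute)
  qed
  have "(\<lambda>n. suminf (\<lambda>j. f j n)) \<longlonglongrightarrow> suminf (\<lambda>_. 0)"
    using tannerys_theorem[where a = f and b = "\<lambda>_. 0" and M = "\<lambda>j. 2 * cmod (q j)", OF lim]
      bound q(1) by (auto intro!: always_eventually summable_mult)
  moreover have "suminf (\<lambda>j. f j n) = (\<Sum>j\<le>N n. f j n)" for n
    by (rule suminf_finite) (auto simp: f_def)
  ultimately have A: "(\<lambda>n. \<Sum>j\<le>N n. f j n) \<longlonglongrightarrow> 0" by simp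
  have qs: "(\<lambda>n. \<Sum>j\<le>N n. q j) \<longlonglongrightarrow> 0"
    using filterlim_compose[OF summable_LIMSEQ'[OF summable_norm_cancel[OF q(1)]] N] q(2) by simp
  have "(\<lambda>n. ut (s n) (N n) * (\<Sum>j\<le>N n. q j)) \<longlonglongrightarrow> 0"
  proof (rule Lim_null_comparison)
    show "\<forall>\<^sub>F n in sequentially. norm (ut (s n) (N n) * (\<Sum>j\<le>N n. q j)) \<le> norm (\<Sum>j\<le>N n. q j)"
      using ut_le_1 by (auto simp: norm_mult intro!: always_eventually mult_left_le_one_le)
    show "(\<lambda>n. norm (\<Sum>j\<le>N n. q j)) \<longlonglongrightarrow> 0" using qs by (rule tendsto_norm_zero)
  qed
  from tendsto_add[OF A this]
  have "(\<lambda>n. (\<Sum>j\<le>N n. f j n) + ut (s n) (N n) * (\<Sum>j\<le>N n. q j)) \<longlonglongrightarrow> 0" by simp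
  moreover have "(\<Sum>j\<le>N n. f j n) + ut (s n) (N n) * (\<Sum>j\<le>N n. q j) = (\<Sum>j\<le>N n. q j * ut (s n) (N n - j))" for n
    unfolding sum_distrib_left sum.distrib[symmetric] by (intro sum.cong) (auto simp: f_def algebra_simps)
  ultimately show ?thesis by simp
qed

definition second_mom :: real where "second_mom = (\<Sum>m. (real m)\<^sup>2 * a m)"

text \<open>An exponential \<open>exp (- \<delta> * n)\<close> would solve the unrestricted renewal
  equation if the coefficients tilted by \<open>exp (\<delta> * m)\<close> summed to 1. Only two
  moments of \<open>a\<close> are at hand, so the tilt is linearized.\<close>

definition tilt_defect :: "real \<Rightarrow> real \<Rightarrow> complex" where
  "tilt_defect x \<delta> = 1 - (\<Sum>m. \<alpha> x m * (1 + of_real (\<delta> * real m)))"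

text \<open>The difference between \<open>ut\<close> and \<open>c * exp (- \<delta> * n)\<close> is the convolution of \<open>ut\<close> with the defect of
  the exponential in the renewal equation. Its leading part \<open>of_bool (j = 0) - c * B j\<close> does not depend
  on \<open>x\<close> and sums to \<open>0\<close>; the residual is what remains.\<close>
definition residual :: "real \<Rightarrow> real \<Rightarrow> nat \<Rightarrow> complex" where
  "residual x \<delta> j = of_real (c * B j) - of_real (c * exp (- \<delta> * real j)) +
     (\<Sum>m\<le>j. \<alpha> x m * of_real (c * exp (- \<delta> * real (j - m))))"

text \<open>The four terms come from replacing \<open>exp (- \<delta> * j)\<close> by 1 in front of
  \<open>B j\<close>, from the linearized tilt, from truncating its sum at \<open>j\<close>, and
  from the quadratic remainder of the exponential.\<close>

lemma residual_bound:
  assumes "\<delta> \<ge> 0"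
  shows "cmod (residual x \<delta> j) \<le>
     c * (\<delta> * (real j * B j) + cmod (tilt_defect x \<delta>) + (K * \<bar>x\<bar> + \<delta>) * G j + \<delta>\<^sup>2 * second_mom)"
proof -
  define e where "e = exp (- \<delta> * real j)"
  have e: "0 < e" "e \<le> 1" using assms by (auto simp: e_def)
  \<comment> \<open>\<open>h\<close> sums to minus the tilt defect, and its tail beyond
    \<open>j\<close> is controlled by \<open>G j\<close>; \<open>r\<close> is the remainder of the
    exponential after its linear part.\<close>
  define h where "h = (\<lambda>m. \<alpha> x m * (1 + of_real (\<delta> * real m)) - of_real (a m))"
  define r where "r = (\<lambda>m. exp (\<delta> * real m) - 1 - \<delta> * real m)"
  have h_le: "cmod (h m) \<le> (K * \<bar>x\<bar> + \<delta>) * (real m * a m)" for m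
  proof -
    have "h m = (\<alpha> x m - of_real (a m)) + \<alpha> x m * of_real (\<delta> * real m)"
      by (simp add: h_def algebra_simps)
    then have "cmod (h m) \<le> cmod (\<alpha> x m - of_real (a m)) + cmod (\<alpha> x m) * (\<delta> * real m)"
      using assms norm_triangle_ineq[of "\<alpha> x m - of_real (a m)" "\<alpha> x m * of_real (\<delta> * real m)"]
      by (simp only: norm_mult norm_of_real) simp
    also have "\<dots> \<le> K * \<bar>x\<bar> * (real m * a m) + a m * (\<delta> * real m)"
      using assms by (intro add_mono \<alpha>_lipschitz mult_right_mono \<alpha>_le) auto
    finally show ?thesis by (simp add: algebra_simps)
  qed
  have gs: "summable (\<lambda>m. (K * \<bar>x\<bar> + \<delta>) * (real m * a m))"
    using first_moment by (intro summable_mult) (simp add: sums_iff)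
  have hs: "summable h" by (rule summable_comparison_test'[OF gs]) (use h_le in auto)
  have as: "summable (\<lambda>m. complex_of_real (a m))" using a_summable by (rule summable_of_real)
  have "(\<lambda>m. \<alpha> x m * (1 + of_real (\<delta> * real m))) sums (suminf h + 1)"
    using sums_add[OF summable_sums[OF hs] summable_sums[OF as]] suminf_a
    by (simp add: h_def suminf_of_real[OF a_summable, symmetric])
  then have td: "tilt_defect x \<delta> = - suminf h"
    unfolding tilt_defect_def by (simp add: sums_iff)
  have tail: "cmod (suminf h - (\<Sum>m\<le>j. h m)) \<le> (K * \<bar>x\<bar> + \<delta>) * G j"
    using tail_norm_le[OF h_le gs, of j] first_moment
    by (simp add: G_def sums_iff suminf_mult sum_distrib_left right_diff_distrib)
  have hsum: "(\<Sum>m\<le>j. h m) = (\<Sum>m\<le>j. \<alpha> x m * (1 + of_real (\<delta> * real m))) - (1 - of_real (B j))"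
    unfolding h_def sum_subtractf by (simp add: B_def)
  have exps: "exp (- \<delta> * real (j - m)) = e * (r m + 1 + \<delta> * real m)" if "m \<le> j" for m
    using that by (simp add: e_def r_def exp_add[symmetric] of_nat_diff algebra_simps)
  have "(\<Sum>m\<le>j. \<alpha> x m * of_real (c * exp (- \<delta> * real (j - m)))) =
      of_real c * (\<Sum>m\<le>j. \<alpha> x m * of_real (e * (r m + 1 + \<delta> * real m)))"
    unfolding sum_distrib_left
    by (intro sum.cong refl) (simp only: exps atMost_iff of_real_mult mult.left_commute)
  then have "residual x \<delta> j = of_real c * (of_real (B j) - of_real e +
     (\<Sum>m\<le>j. \<alpha> x m * of_real (e * (r m + 1 + \<delta> * real m))))"
    unfolding residual_def e_def[symmetric] by (simp only: ring_distribs of_real_mult)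
  also have "(\<Sum>m\<le>j. \<alpha> x m * of_real (e * (r m + 1 + \<delta> * real m))) =
     of_real e * ((\<Sum>m\<le>j. h m) + (1 - of_real (B j))) + (\<Sum>m\<le>j. \<alpha> x m * of_real (e * r m))"
    unfolding hsum sum_distrib_left diff_add_cancel sum.distrib[symmetric]
    by (intro sum.cong) (auto simp: algebra_simps)
  finally have eq: "residual x \<delta> j = of_real c * (of_real ((1 - e) * B j)
     - of_real e * tilt_defect x \<delta> - of_real e * (suminf h - (\<Sum>m\<le>j. h m)) + (\<Sum>m\<le>j. \<alpha> x m * of_real (e * r m)))"
    unfolding td by (simp add: algebra_simps)
  have t1: "cmod (of_real ((1 - e) * B j)) \<le> \<delta> * (real j * B j)"
  proof -
    have "1 - e \<le> \<delta> * real j" using exp_ge_add_one_self[of "- \<delta> * real j"] by (simp add: e_def)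
    then have "(1 - e) * B j \<le> \<delta> * real j * B j" by (rule mult_right_mono[OF _ B_nonneg])
    moreover have "0 \<le> (1 - e) * B j" using e B_nonneg by simp
    ultimately show ?thesis unfolding norm_of_real by simp
  qed
  have t2: "cmod (of_real e * z) \<le> cmod z" for z
    using e by (simp add: norm_mult mult_left_le_one_le)
  have t3: "cmod (\<Sum>m\<le>j. \<alpha> x m * of_real (e * r m)) \<le> \<delta>\<^sup>2 * second_mom"
  proof -
    have "cmod (\<alpha> x m * of_real (e * r m)) \<le> \<delta>\<^sup>2 * ((real m)\<^sup>2 * a m)" if "m \<le> j" for m
    proof -
      have y: "\<delta> * real m \<ge> 0" using assms by simp
      have r0: "r m \<ge> 0" using exp_ge_add_one_self[of "\<delta> * real m"] unfolding r_def by linarith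
      \<comment> \<open>The growth of the remainder bound is absorbed by \<open>e\<close>: for
        \<open>m \<le> j\<close> the product of the two exponentials is at most 1.\<close>
      have "e * r m \<le> e * ((\<delta> * real m)\<^sup>2 * exp (\<delta> * real m))"
        using exp_remainder_2[OF y] e unfolding r_def by (intro mult_left_mono) auto
      also have "\<dots> = (\<delta> * real m)\<^sup>2 * exp (\<delta> * (real m - real j))"
        by (simp add: e_def exp_diff exp_minus algebra_simps divide_simps)
      also have "\<dots> \<le> (\<delta> * real m)\<^sup>2 * 1"
        using that assms by (intro mult_left_mono) (auto simp: mult_nonneg_nonpos)
      finally have "e * r m \<le> (\<delta> * real m)\<^sup>2" by simp
      then have "cmod (\<alpha> x m) * (e * r m) \<le> a m * (\<delta> * real m)\<^sup>2"
        using r0 e by (intro mult_mono \<alpha>_le a_nonneg) auto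
      then show ?thesis using r0 e
        by (simp add: norm_mult power_mult_distrib algebra_simps)
    qed
    then have "cmod (\<Sum>m\<le>j. \<alpha> x m * of_real (e * r m)) \<le> (\<Sum>m\<le>j. \<delta>\<^sup>2 * ((real m)\<^sup>2 * a m))"
      by (intro sum_norm_le) auto
    also have "\<dots> \<le> \<delta>\<^sup>2 * second_mom"
      unfolding sum_distrib_left[symmetric] second_mom_def
      by (intro mult_left_mono sum_le_suminf second_moment) (auto simp: a_nonneg)
    finally show ?thesis .
  qed
  have "cmod (residual x \<delta> j) = c * cmod (of_real ((1 - e) * B j)
     - of_real e * tilt_defect x \<delta> - of_real e * (suminf h - (\<Sum>m\<le>j. h m)) + (\<Sum>m\<le>j. \<alpha> x m * of_real (e * r m)))"
    unfolding eq using c_pos by (simp only: norm_mult[of "of_real c"] norm_of_real abs_of_pos)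
  also have "\<dots> \<le> c * (cmod (of_real ((1 - e) * B j)) + cmod (of_real e * tilt_defect x \<delta>)
       + cmod (of_real e * (suminf h - (\<Sum>m\<le>j. h m))) + cmod (\<Sum>m\<le>j. \<alpha> x m * of_real (e * r m)))"
    using c_pos by (intro mult_left_mono norm_triangle_le add_mono norm_triangle_le_diff order_refl) auto
  also have "\<dots> \<le> c * (\<delta> * (real j * B j) + cmod (tilt_defect x \<delta>) + (K * \<bar>x\<bar> + \<delta>) * G j + \<delta>\<^sup>2 * second_mom)"
    using c_pos by (intro mult_left_mono add_mono t1 t3 t2 order_trans[OF t2 tail]) auto
  finally show ?thesis .
qed

text \<open>Exact for every \<open>\<delta>\<close>: with \<open>C\<close> the series of the
  exponential, \<open>?T - C\<close> equals \<open>?T * (1 - C * (1 - ?\<alpha>))\<close> because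
  \<open>?T * (1 - ?\<alpha>) = 1\<close>. The coefficients of the second factor split into
  \<open>q\<close> and the residual.\<close>

lemma ut_expansion:
  fixes \<delta> :: real
  defines "q \<equiv> \<lambda>j. of_bool (j = 0) - complex_of_real (c * B j)"
  shows "ut x n = of_real (c * exp (- \<delta> * real n)) +
    (\<Sum>j\<le>n. q j * ut x (n - j)) + (\<Sum>j\<le>n. residual x \<delta> j * ut x (n - j))"
proof -
  define C where "C = Abs_fps (\<lambda>n. complex_of_real (c * exp (- \<delta> * real n)))"
  let ?T = "Abs_fps (ut x)" and ?\<alpha> = "Abs_fps (\<alpha> x)"
  have rhs: "fps_nth (1 - C * (1 - ?\<alpha>)) j = q j + residual x \<delta> j" for j
  proof -
    have "fps_nth (?\<alpha> * C) j = (\<Sum>m\<le>j. \<alpha> x m * of_real (c * exp (- \<delta> * real (j - m))))"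
      by (simp add: C_def fps_mult_nth atLeast0AtMost)
    then show ?thesis
      by (simp add: right_diff_distrib mult.commute[of C] residual_def q_def) (simp add: C_def)
  qed
  have "?T - C = ?T * (1 - C * (1 - ?\<alpha>))"
  proof -
    have "?T * (1 - C * (1 - ?\<alpha>)) = ?T - C * (?T * (1 - ?\<alpha>))"
      by (simp only: right_diff_distrib mult_1_right mult.left_commute[of ?T C] mult.commute[of ?T C])
    then show ?thesis by (simp only: ut_fps mult_1_right)
  qed
  also have "\<dots> = (1 - C * (1 - ?\<alpha>)) * ?T" by (simp add: mult.commute)
  finally have "fps_nth (?T - C) n = (\<Sum>j\<le>n. (q j + residual x \<delta> j) * ut x (n - j))"
    by (simp only: fps_mult_nth rhs atLeast0AtMost fps_nth_Abs_fps)
  then show ?thesis by (simp add: C_def sum.distrib ring_distribs algebra_simps)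
qed

text \<open>The parts with \<open>B\<close> and \<open>G\<close> are summable over \<open>j\<close>
  and keep a small prefactor. The other two do not decay in \<open>j\<close> and pick up
  \<open>n + 1\<close>, which is harmless at the scale \<open>n * x\<^sup>2 = O(1)\<close>: there
  the tilt defect is \<open>o(x\<^sup>2)\<close> and \<open>\<delta>\<^sup>2\<close> is of order
  \<open>x\<^sup>4\<close>.\<close>

lemma residual_sum_bound:
  assumes "\<delta> \<ge> 0"
  shows "cmod (\<Sum>j\<le>n. residual x \<delta> j * ut x (n - j)) \<le>
    c * (\<delta> * (\<Sum>j. real j * B j) + real (Suc n) * cmod (tilt_defect x \<delta>)
      + (K * \<bar>x\<bar> + \<delta>) * suminf G + real (Suc n) * \<delta>\<^sup>2 * second_mom)"
proof -
  have G0: "G n \<ge> 0" for n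
    using sum_le_suminf[of "\<lambda>m. real m * a m" "{..n}"] first_moment a_nonneg by (simp add: G_def sums_iff)
  have "cmod (\<Sum>j\<le>n. residual x \<delta> j * ut x (n - j)) \<le> (\<Sum>j\<le>n. cmod (residual x \<delta> j))"
    using ut_le_1 by (intro sum_norm_le) (auto simp: norm_mult intro: mult_right_le_one_le)
  also have "\<dots> \<le> (\<Sum>j\<le>n. c * (\<delta> * (real j * B j) + cmod (tilt_defect x \<delta>) + (K * \<bar>x\<bar> + \<delta>) * G j + \<delta>\<^sup>2 * second_mom))"
    by (intro sum_mono residual_bound assms)
  also have "\<dots> = c * (\<delta> * (\<Sum>j\<le>n. real j * B j) + real (Suc n) * cmod (tilt_defect x \<delta>)
      + (K * \<bar>x\<bar> + \<delta>) * (\<Sum>j\<le>n. G j) + real (Suc n) * \<delta>\<^sup>2 * second_mom)"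
    by (simp add: sum_distrib_left[symmetric] sum.distrib)
  also have "\<dots> \<le> c * (\<delta> * (\<Sum>j. real j * B j) + real (Suc n) * cmod (tilt_defect x \<delta>)
      + (K * \<bar>x\<bar> + \<delta>) * suminf G + real (Suc n) * \<delta>\<^sup>2 * second_mom)"
    using c_pos assms K_nonneg
    by (intro mult_left_mono add_mono order_refl sum_le_suminf B_first_moment G_summable)
       (auto simp: B_nonneg G0)
  finally show ?thesis .
qed

text \<open>This \<open>\<delta>\<close> is dictated by cancellation: the coefficients lose mass
  \<open>\<sigma> * x\<^sup>2 / 2\<close>, and the linear tilt restores \<open>\<delta>\<close>
  times the mean gap \<open>1 / c\<close>.\<close>

lemma tilt_defect_limit:
  assumes quad: "((\<lambda>x. (1 - (\<Sum>m. \<alpha> x m)) / of_real (x\<^sup>2)) \<longlongrightarrow> of_real (\<sigma> / 2)) (at 0)"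
  shows "((\<lambda>x. tilt_defect x (x\<^sup>2 * \<sigma> * c / 2) / of_real (x\<^sup>2)) \<longlongrightarrow> 0) (at 0)"
proof -
  have sa: "summable (\<lambda>m. \<alpha> x m)" for x
    by (rule summable_comparison_test'[OF a_summable, of 0]) (rule \<alpha>_le)
  have sm: "summable (\<lambda>m. real m * a m)" using first_moment by (simp add: sums_iff)
  have sma: "summable (\<lambda>m. of_real (real m) * \<alpha> x m)" for x
    by (rule summable_comparison_test'[OF sm, of 0]) (auto simp: norm_mult intro!: mult_left_mono \<alpha>_le)
  have td: "tilt_defect x \<delta> = (1 - (\<Sum>m. \<alpha> x m)) - of_real \<delta> * (\<Sum>m. of_real (real m) * \<alpha> x m)" for x \<delta>
  proof -
    have "(\<lambda>m. \<alpha> x m + of_real \<delta> * (of_real (real m) * \<alpha> x m)) sums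
        ((\<Sum>m. \<alpha> x m) + of_real \<delta> * (\<Sum>m. of_real (real m) * \<alpha> x m))"
      by (intro sums_add sums_mult summable_sums sa sma)
    then show ?thesis
      unfolding tilt_defect_def by (simp add: sums_iff algebra_simps)
  qed
  have lim: "((\<lambda>x. \<Sum>m. of_real (real m) * \<alpha> x m) \<longlongrightarrow> (\<Sum>m. of_real (real m * a m))) (at 0)"
  proof (rule tannerys_theorem[where M = "\<lambda>m. real m * a m", THEN conjunct2, THEN conjunct2])
    show "((\<lambda>x. of_real (real m) * \<alpha> x m) \<longlongrightarrow> of_real (real m * a m)) (at 0)" for m
    proof -
      have "((\<lambda>x. K * \<bar>x\<bar> * (real m * a m)) \<longlongrightarrow> K * \<bar>0\<bar> * (real m * a m)) (at 0)"
        by (intro tendsto_intros)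
      then have "((\<lambda>x. \<alpha> x m - of_real (a m)) \<longlongrightarrow> 0) (at 0)"
        by (intro Lim_null_comparison[OF always_eventually[OF allI[OF \<alpha>_lipschitz]]]) simp
      then have "((\<lambda>x. \<alpha> x m) \<longlongrightarrow> of_real (a m)) (at 0)" by (rule LIM_zero_cancel)
      then show ?thesis by (auto intro!: tendsto_intros)
    qed
    show "\<forall>\<^sub>F (k, x) in sequentially \<times>\<^sub>F at 0. cmod (of_real (real k) * \<alpha> x k) \<le> real k * a k"
      by (intro always_eventually) (auto simp: norm_mult intro!: mult_left_mono \<alpha>_le)
  qed (use sm in auto)
  also have "(\<Sum>m. complex_of_real (real m * a m)) = of_real (1 / c)"
    using first_moment suminf_of_real[OF sm, where 'a = complex] by (simp add: sums_iff)
  finally have "((\<lambda>x. (1 - (\<Sum>m. \<alpha> x m)) / of_real (x\<^sup>2) - of_real (\<sigma> * c / 2) * (\<Sum>m. of_real (real m) * \<alpha> x m))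
      \<longlongrightarrow> of_real (\<sigma> / 2) - of_real (\<sigma> * c / 2) * of_real (1 / c)) (at 0)"
    by (intro tendsto_intros quad)
  also have "of_real (\<sigma> / 2) - of_real (\<sigma> * c / 2) * of_real (1 / c) = (0::complex)"
    using c_pos by simp
  finally show ?thesis
    by (rule Lim_transform_eventually)
       (auto simp: td eventually_at_filter diff_divide_distrib intro!: always_eventually)
qed

text \<open>Heuristically, about \<open>c * N\<close> blocks precede \<open>N\<close> and each
  contributes a factor \<open>1 - \<sigma> * x\<^sup>2 / 2\<close>; the prefactor \<open>c\<close>
  is the limiting probability that \<open>N\<close> is itself a renewal.\<close>

theorem renewal_clt:
  assumes quad: "((\<lambda>x. (1 - (\<Sum>m. \<alpha> x m)) / of_real (x\<^sup>2)) \<longlongrightarrow> of_real (\<sigma> / 2)) (at 0)"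
    and \<sigma>: "\<sigma> \<ge> 0"
    and s: "filterlim s (at 0) sequentially" and N: "filterlim N at_top sequentially"
    and Ns: "(\<lambda>n. real (N n) * (s n)\<^sup>2) \<longlonglongrightarrow> \<tau>"
  shows "(\<lambda>n. ut (s n) (N n)) \<longlonglongrightarrow> of_real (c * exp (- (c * \<sigma> * \<tau> / 2)))"
proof -
  define \<delta> where "\<delta> = (\<lambda>x::real. x\<^sup>2 * \<sigma> * c / 2)"
  define q where "q = (\<lambda>j. of_bool (j = 0) - complex_of_real (c * B j))"
  have \<delta>0: "\<delta> x \<ge> 0" for x using \<sigma> c_pos by (simp add: \<delta>_def)
  have s0: "s \<longlonglongrightarrow> 0" and sne: "\<forall>\<^sub>F n in sequentially. s n \<noteq> 0"
    using s by (auto simp: filterlim_at)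
  have \<delta>s: "(\<lambda>n. \<delta> (s n)) \<longlonglongrightarrow> 0"
    unfolding \<delta>_def by (rule tendsto_eq_intros s0 refl | simp)+
  have N\<delta>: "(\<lambda>n. real (N n) * \<delta> (s n)) \<longlonglongrightarrow> \<tau> * \<sigma> * c / 2"
    using tendsto_mult[OF Ns tendsto_const[of "\<sigma> * c / 2"]] by (simp add: \<delta>_def mult.assoc)
  have main: "(\<lambda>n. complex_of_real (c * exp (- \<delta> (s n) * real (N n)))) \<longlonglongrightarrow>
      of_real (c * exp (- (c * \<sigma> * \<tau> / 2)))"
    using tendsto_minus[OF N\<delta>] by (intro tendsto_intros) (simp add: ac_simps)
  \<comment> \<open>By \<open>suminf_B\<close> the factor \<open>c\<close> normalizes
    \<open>B\<close> to mass 1, so \<open>q\<close> has total mass 0 as the convolution lemma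
    demands.\<close>
  have sB: "(\<lambda>j. complex_of_real (c * B j)) sums 1"
    using sums_of_real[OF sums_mult[OF summable_sums[OF B_summable], of c], where 'a = complex] suminf_B by simp
  have s1: "(\<lambda>j. of_bool (j = 0) :: complex) sums 1"
    using sums_single[of 0 "\<lambda>_. 1::complex"] by (simp add: of_bool_def)
  have q0: "suminf q = 0"
    using sums_diff[OF s1 sB] by (simp add: q_def sums_iff)
  have "summable (\<lambda>j. of_bool (j = 0) + c * B j)"
    using sums_single[of 0 "\<lambda>_. 1::real"]
    by (intro summable_add summable_mult B_summable) (simp add: of_bool_def sums_iff)
  then have q1: "summable (\<lambda>j. cmod (q j))"
  proof (rule summable_comparison_test'[of _ 0])
    show "norm (cmod (q j)) \<le> of_bool (j = 0) + c * B j" for j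
      using norm_triangle_ineq4[of "of_bool (j = 0)" "complex_of_real (c * B j)"] c_pos B_nonneg[of j]
      by (cases "j = 0") (simp_all add: q_def norm_mult)
  qed
  note qlim = convolution_null_sum_tendsto_0[OF q1 q0 s0 N]
  have td: "(\<lambda>n. cmod (tilt_defect (s n) (\<delta> (s n)) / of_real ((s n)\<^sup>2))) \<longlonglongrightarrow> 0"
    using filterlim_compose[OF tilt_defect_limit[OF quad] s] unfolding \<delta>_def
    by (rule tendsto_norm_zero)
  \<comment> \<open>Multiply and divide by \<open>(s n)\<^sup>2\<close>: the number of terms becomes
    bounded and the defect still tends to 0.\<close>
  have "(\<lambda>n. ((real (N n) * (s n)\<^sup>2 + (s n)\<^sup>2) * cmod (tilt_defect (s n) (\<delta> (s n)) / of_real ((s n)\<^sup>2))))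
     \<longlonglongrightarrow> (\<tau> + 0\<^sup>2) * 0"
    by (intro tendsto_intros Ns s0 td)
  then have "(\<lambda>n. ((real (N n) * (s n)\<^sup>2 + (s n)\<^sup>2) * cmod (tilt_defect (s n) (\<delta> (s n)) / of_real ((s n)\<^sup>2))))
     \<longlonglongrightarrow> 0" by simp
  then have Nd: "(\<lambda>n. real (Suc (N n)) * cmod (tilt_defect (s n) (\<delta> (s n)))) \<longlonglongrightarrow> 0"
    by (rule Lim_transform_eventually)
       (use sne in \<open>eventually_elim, auto simp: norm_divide norm_power field_simps\<close>)
  have "(\<lambda>n. (real (N n) * \<delta> (s n) + \<delta> (s n)) * \<delta> (s n)) \<longlonglongrightarrow> (\<tau> * \<sigma> * c / 2 + 0) * 0"
    by (intro tendsto_intros N\<delta> \<delta>s)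
  then have N2: "(\<lambda>n. real (Suc (N n)) * (\<delta> (s n))\<^sup>2) \<longlonglongrightarrow> 0"
    by (simp add: algebra_simps power2_eq_square)
  have "(\<lambda>n. c * (\<delta> (s n) * (\<Sum>j. real j * B j) + real (Suc (N n)) * cmod (tilt_defect (s n) (\<delta> (s n)))
      + (K * \<bar>s n\<bar> + \<delta> (s n)) * suminf G + real (Suc (N n)) * (\<delta> (s n))\<^sup>2 * second_mom))
     \<longlonglongrightarrow> c * (0 * (\<Sum>j. real j * B j) + 0 + (K * \<bar>0\<bar> + 0) * suminf G + 0 * second_mom)"
    by (intro tendsto_intros \<delta>s Nd N2 s0)
  then have "(\<lambda>n. \<Sum>j\<le>N n. residual (s n) (\<delta> (s n)) j * ut (s n) (N n - j)) \<longlonglongrightarrow> 0"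
    by (intro Lim_null_comparison[OF always_eventually[OF allI[OF residual_sum_bound[OF \<delta>0]]]]) simp
  note lim = tendsto_add[OF tendsto_add[OF main qlim] this]
  have "ut (s n) (N n) = of_real (c * exp (- \<delta> (s n) * real (N n))) +
     (\<Sum>j\<le>N n. q j * ut (s n) (N n - j)) + (\<Sum>j\<le>N n. residual (s n) (\<delta> (s n)) j * ut (s n) (N n - j))" for n
    unfolding q_def by (rule ut_expansion)
  with lim show ?thesis by (simp only: add_0_right)
qed

end

section \<open>Symmetric cuts of permutations\<close>

definition noninv :: "'a::linorder set \<Rightarrow> ('a \<Rightarrow> 'b::linorder) \<Rightarrow> nat" where
  "noninv S \<pi> = card {(i, j). i \<in> S \<and> j \<in> S \<and> i < j \<and> \<pi> i < \<pi> j}"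

definition cycles_of_length :: "'a set \<Rightarrow> nat \<Rightarrow> ('a \<Rightarrow> 'a) \<Rightarrow> 'a set set" where
  "cycles_of_length S i \<pi> = {orbit \<pi> x | x. x \<in> S \<and> card (orbit \<pi> x) = i}"

definition num_cycles :: "'a set \<Rightarrow> nat \<Rightarrow> ('a \<Rightarrow> 'a) \<Rightarrow> nat" where
  "num_cycles S i \<pi> = card (cycles_of_length S i \<pi>)"

lemma finite_noninv_pairs: "finite S \<Longrightarrow> finite {(i, j). i \<in> S \<and> j \<in> S \<and> i < j \<and> \<pi> i < \<pi> j}"
  by (rule finite_subset[of _ "S \<times> S"]) auto

lemma cycles_of_length_image:
  "cycles_of_length S i \<pi> = orbit \<pi> ` {x \<in> S. card (orbit \<pi> x) = i}"
  by (auto simp: cycles_of_length_def)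

lemma num_cycles_le: "finite S \<Longrightarrow> num_cycles S i \<pi> \<le> card S"
  unfolding num_cycles_def cycles_of_length_image
  by (rule order_trans[OF card_image_le card_mono]) auto

lemma noninv_Un:
  assumes "finite S" "finite T" "S \<inter> T = {}"
    and "\<And>x. x \<in> S \<Longrightarrow> \<pi> x = \<pi>1 x" "\<And>x. x \<in> T \<Longrightarrow> \<pi> x = \<pi>2 x"
    and cross: "\<And>x y. x \<in> S \<Longrightarrow> y \<in> T \<Longrightarrow> (x < y \<longrightarrow> \<pi> y \<le> \<pi> x) \<and> (y < x \<longrightarrow> \<pi> x \<le> \<pi> y)"
  shows "noninv (S \<union> T) \<pi> = noninv S \<pi>1 + noninv T \<pi>2"
proof -
  have "{(i, j). i \<in> S \<union> T \<and> j \<in> S \<union> T \<and> i < j \<and> \<pi> i < \<pi> j} =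
     {(i, j). i \<in> S \<and> j \<in> S \<and> i < j \<and> \<pi>1 i < \<pi>1 j} \<union> {(i, j). i \<in> T \<and> j \<in> T \<and> i < j \<and> \<pi>2 i < \<pi>2 j}"
    using assms(4,5) cross by (auto simp: not_le[symmetric])
  then show ?thesis unfolding noninv_def
    using assms(1-3) by (simp add: card_Un_disjoint finite_noninv_pairs Int_def)
qed

lemma cycles_of_length_cong:
  assumes "\<pi> permutes S" "\<And>x. x \<in> S \<Longrightarrow> \<pi>' x = \<pi> x"
  shows "cycles_of_length S i \<pi>' = cycles_of_length S i \<pi>"
proof -
  have "orbit \<pi>' x = orbit \<pi> x" if "x \<in> S" for x
    by (rule orbit_cong0[OF that]) (auto simp: assms permutes_in_image)
  then show ?thesis unfolding cycles_of_length_def by (intro Collect_cong) metis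
qed

lemma num_cycles_Un:
  assumes "finite S" "finite T" "S \<inter> T = {}" "\<pi>1 permutes S" "\<pi>2 permutes T"
    and "\<And>x. x \<in> S \<Longrightarrow> \<pi> x = \<pi>1 x" "\<And>x. x \<in> T \<Longrightarrow> \<pi> x = \<pi>2 x"
  shows "num_cycles (S \<union> T) i \<pi> = num_cycles S i \<pi>1 + num_cycles T i \<pi>2"
proof -
  have "cycles_of_length (S \<union> T) i \<pi> = cycles_of_length S i \<pi> \<union> cycles_of_length T i \<pi>"
    by (auto simp: cycles_of_length_def)
  also have "\<dots> = cycles_of_length S i \<pi>1 \<union> cycles_of_length T i \<pi>2"
    using cycles_of_length_cong[OF assms(4), of \<pi>] cycles_of_length_cong[OF assms(5), of \<pi>] assms(6,7) by auto
  moreover have "cycles_of_length S i \<pi>1 \<inter> cycles_of_length T i \<pi>2 = {}"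
  proof -
    have "orbit \<pi>1 x \<noteq> orbit \<pi>2 y" if "x \<in> S" "y \<in> T" for x y
      using permutes_orbit_subset[OF assms(4) that(1)] permutes_orbit_subset[OF assms(5) that(2)]
        orbit_nonempty[of \<pi>1 x] assms(3) by blast
    then show ?thesis by (auto simp: cycles_of_length_def)
  qed
  ultimately show ?thesis
    unfolding num_cycles_def using assms(1,2)
    by (simp add: card_Un_disjoint cycles_of_length_image)
qed

lemma noninv_map_permutation:
  fixes g :: "'a::linorder \<Rightarrow> 'b::linorder"
  assumes "bij_betw g S T" "strict_mono_on S g" "\<pi> permutes S"
  shows "noninv T (map_permutation S g \<pi>) = noninv S \<pi>"
proof -
  have inj: "inj_on g S" and T: "T = g ` S" using assms(1) by (auto simp: bij_betw_def)
  have less: "g x < g y \<longleftrightarrow> x < y" if "x \<in> S" "y \<in> S" for x y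
    using strict_mono_on_less[OF assms(2) that] .
  have app: "map_permutation S g \<pi> (g x) = g (\<pi> x)" if "x \<in> S" for x
    using map_permutation_apply[OF inj that] .
  have "{(i, j). i \<in> T \<and> j \<in> T \<and> i < j \<and> map_permutation S g \<pi> i < map_permutation S g \<pi> j} =
     map_prod g g ` {(i, j). i \<in> S \<and> j \<in> S \<and> i < j \<and> \<pi> i < \<pi> j}"
    using assms(3) by (auto simp: T app less permutes_in_image image_iff) 
  moreover have "inj_on (map_prod g g) {(i, j). i \<in> S \<and> j \<in> S \<and> i < j \<and> \<pi> i < \<pi> j}"
    using inj by (auto simp: inj_on_def)
  ultimately show ?thesis unfolding noninv_def by (simp add: card_image)
qed

lemma num_cycles_map_permutation:
  assumes "finite S" "bij_betw g S T" "\<pi> permutes S"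
  shows "num_cycles T i (map_permutation S g \<pi>) = num_cycles S i \<pi>"
proof -
  have inj: "inj_on g S" and T: "T = g ` S" using assms(2) by (auto simp: bij_betw_def)
  have perm: "permutation \<pi>" using assms(1,3) permutation_permutes by blast
  have orb: "orbit (map_permutation S g \<pi>) (g x) = g ` orbit \<pi> x" if "x \<in> S" for x
    using permutes_orbit_subset[OF assms(3) that]
    by (intro orbit_inverse[symmetric] permutation_self_in_orbit perm map_permutation_apply[OF inj]) auto
  have cd: "card (g ` orbit \<pi> x) = card (orbit \<pi> x)" if "x \<in> S" for x
    using permutes_orbit_subset[OF assms(3) that] inj by (intro card_image) (rule inj_on_subset)
  have "cycles_of_length T i (map_permutation S g \<pi>) = (`) g ` cycles_of_length S i \<pi>"
  proof -
    have "{y \<in> T. card (orbit (map_permutation S g \<pi>) y) = i} = g ` {x \<in> S. card (orbit \<pi> x) = i}"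
      by (auto simp: T orb cd)
    then show ?thesis
      unfolding cycles_of_length_image by (auto simp: image_image orb intro!: image_cong)
  qed
  moreover have "inj_on ((`) g) (cycles_of_length S i \<pi>)"
  proof (rule inj_on_subset[OF inj_on_image_Pow[OF inj]])
    show "cycles_of_length S i \<pi> \<subseteq> Pow S"
      using permutes_orbit_subset[OF assms(3)] by (auto simp: cycles_of_length_def)
  qed
  ultimately show ?thesis unfolding num_cycles_def by (simp add: card_image)
qed

lemma bij_betw_map_permutation:
  assumes "bij_betw g S T"
  shows "bij_betw (map_permutation S g) {\<pi>. \<pi> permutes S} {\<pi>. \<pi> permutes T}"
proof (rule bij_betw_byWitness[where f' = "map_permutation T (inv_into S g)"])
  have inv: "bij_betw (inv_into S g) T S" by (rule bij_betw_inv_into[OF assms])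
  have inj: "inj_on g S" and T: "T = g ` S" using assms by (auto simp: bij_betw_def)
  show "\<forall>\<pi>\<in>{\<pi>. \<pi> permutes S}. map_permutation T (inv_into S g) (map_permutation S g \<pi>) = \<pi>"
    using assms inj by (auto simp: T intro!: map_permutation_compose_inv)
  show "\<forall>\<pi>\<in>{\<pi>. \<pi> permutes T}. map_permutation S g (map_permutation T (inv_into S g) \<pi>) = \<pi>"
    using inv by (auto simp: T f_inv_into_f intro!: map_permutation_compose_inv)
qed (auto intro: map_permutation_permutes[OF assms] map_permutation_permutes[OF bij_betw_inv_into[OF assms]])

lemma sum_permutes_relabel:
  assumes "bij_betw g S T"
  shows "(\<Sum>\<pi>\<in>{\<pi>. \<pi> permutes T \<and> P \<pi>}. f \<pi>) =
    (\<Sum>\<pi>\<in>{\<pi>. \<pi> permutes S \<and> P (map_permutation S g \<pi>)}. f (map_permutation S g \<pi>))"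
proof (rule sum.reindex_bij_betw[symmetric])
  show "bij_betw (map_permutation S g) {\<pi>. \<pi> permutes S \<and> P (map_permutation S g \<pi>)} {\<pi>. \<pi> permutes T \<and> P \<pi>}"
  proof (rule bij_betw_subset[OF bij_betw_map_permutation[OF assms]])
    have "{\<pi>. \<pi> permutes T \<and> P \<pi>} = {\<pi> \<in> map_permutation S g ` {\<pi>. \<pi> permutes S}. P \<pi>}"
      unfolding bij_betw_imp_surj_on[OF bij_betw_map_permutation[OF assms]] by simp
    also have "\<dots> = map_permutation S g ` {\<pi>. \<pi> permutes S \<and> P (map_permutation S g \<pi>)}"
      by (auto intro: imageI)
    finally show "map_permutation S g ` {\<pi>. \<pi> permutes S \<and> P (map_permutation S g \<pi>)} = {\<pi>. \<pi> permutes T \<and> P \<pi>}" ..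
  qed blast
qed

section \<open>Cuts and the factorization they induce\<close>

text \<open>The flag \<open>e\<close> tells whether there is a central position 0, that is, whether
  the number of positions is odd.\<close>

definition ball_int :: "bool \<Rightarrow> nat \<Rightarrow> int set" where
  "ball_int e n = {x. \<bar>x\<bar> \<le> int n \<and> (e \<or> x \<noteq> 0)}"

definition annulus :: "nat \<Rightarrow> nat \<Rightarrow> int set" where
  "annulus j n = {x. int j < \<bar>x\<bar> \<and> \<bar>x\<bar> \<le> int n}"

text \<open>The cut at level \<open>j\<close>. Level \<open>n\<close> is vacuously a cut, which
  guarantees that an innermost one exists.\<close>

definition swaps :: "nat \<Rightarrow> nat \<Rightarrow> (int \<Rightarrow> int) \<Rightarrow> bool" where
  "swaps j n \<pi> \<longleftrightarrow> (\<forall>x\<in>annulus j n. \<pi> x \<in> annulus j n \<and> (\<pi> x > 0 \<longleftrightarrow> x < 0))"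

definition cut_perms :: "nat \<Rightarrow> bool \<Rightarrow> nat \<Rightarrow> (int \<Rightarrow> int) set" where
  "cut_perms k e n = {\<pi>. \<pi> permutes ball_int e n \<and> (\<forall>i<k. swaps i n \<pi>)}"

text \<open>The index \<open>k\<close> merges two families: \<open>k = 0\<close> gives the innermost
  block, \<open>k = 1\<close> the irreducible blocks between consecutive cuts, for which the inner
  boundary, moved to level 0, must itself be a cut.\<close>

definition core_perms :: "nat \<Rightarrow> bool \<Rightarrow> nat \<Rightarrow> (int \<Rightarrow> int) set" where
  "core_perms k e n = {\<pi> \<in> cut_perms k e n. \<forall>i. k \<le> i \<and> i < n \<longrightarrow> \<not> swaps i n \<pi>}"

definition swap_perms :: "nat \<Rightarrow> nat \<Rightarrow> (int \<Rightarrow> int) set" where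
  "swap_perms j n = {\<pi>. \<pi> permutes annulus j n \<and> swaps j n \<pi>}"

lemma finite_ball_int [simp]: "finite (ball_int e n)"
  by (rule finite_subset[of _ "{- int n..int n}"]) (auto simp: ball_int_def)

lemma finite_annulus [simp]: "finite (annulus j n)"
  by (rule finite_subset[of _ "{- int n..int n}"]) (auto simp: annulus_def)

lemma ball_int_Un_annulus: "j \<le> n \<Longrightarrow> ball_int e j \<union> annulus j n = ball_int e n"
  by (auto simp: ball_int_def annulus_def)

lemma ball_int_Int_annulus: "ball_int e j \<inter> annulus j n = {}"
  by (auto simp: ball_int_def annulus_def)

lemma annulus_0: "annulus 0 n = ball_int False n"
  by (auto simp: ball_int_def annulus_def)

lemma swaps_refl [simp]: "swaps n n \<pi>"
  by (auto simp: swaps_def annulus_def)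

lemma finite_perm_sets [simp]:
  "finite (cut_perms k e n)" "finite (core_perms k e n)" "finite (swap_perms j n)"
  unfolding core_perms_def cut_perms_def swap_perms_def
  by (auto intro: finite_subset[OF _ finite_permutations[OF finite_ball_int]]
    finite_subset[OF _ finite_permutations[OF finite_annulus]])

lemma comp_permutes_disjoint:
  assumes "\<pi>1 permutes S" "\<pi>2 permutes T" "S \<inter> T = {}"
  shows "x \<in> S \<Longrightarrow> (\<pi>1 \<circ> \<pi>2) x = \<pi>1 x" "x \<in> T \<Longrightarrow> (\<pi>1 \<circ> \<pi>2) x = \<pi>2 x"
proof -
  show "x \<in> S \<Longrightarrow> (\<pi>1 \<circ> \<pi>2) x = \<pi>1 x"
    using assms(2,3) by (simp add: permutes_not_in disjoint_iff)
  assume "x \<in> T"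
  then have "\<pi>2 x \<in> T" using assms(2) by (simp add: permutes_in_image)
  then show "(\<pi>1 \<circ> \<pi>2) x = \<pi>2 x"
    using assms(3) permutes_not_in[OF assms(1), of "\<pi>2 x"] by auto
qed

text \<open>A swapping outer block neither creates nor destroys inner cuts, so a minimal cut of the
  product is visible as irreducibility of the inner factor.\<close>

lemma swaps_comp:
  assumes \<pi>1: "\<pi>1 permutes ball_int e j" and \<pi>2: "\<pi>2 \<in> swap_perms j n" and "i \<le> j" "j \<le> n"
  shows "swaps i n (\<pi>1 \<circ> \<pi>2) \<longleftrightarrow> swaps i j \<pi>1"
proof -
  have p2: "\<pi>2 permutes annulus j n" and sw: "swaps j n \<pi>2" using \<pi>2 by (auto simp: swap_perms_def)
  note c = comp_permutes_disjoint[OF \<pi>1 p2 ball_int_Int_annulus]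
  have split: "annulus i n = annulus i j \<union> annulus j n"
    using assms(3,4) by (auto simp: annulus_def)
  have sub: "annulus i j \<subseteq> ball_int e j" by (auto simp: annulus_def ball_int_def)
  have in_ball: "\<pi>1 x \<in> ball_int e j" if "x \<in> annulus i j" for x
    using that sub \<pi>1 by (auto simp: permutes_in_image)
  have ann: "y \<in> annulus i n \<longleftrightarrow> y \<in> annulus i j" if "y \<in> ball_int e j" for y
    using that assms(4) by (auto simp: annulus_def ball_int_def)
  have 1: "(\<pi>1 \<circ> \<pi>2) x = \<pi>1 x" if "x \<in> annulus i j" for x using c(1) sub that by blast
  have 2: "(\<pi>1 \<circ> \<pi>2) x \<in> annulus i n \<and> ((\<pi>1 \<circ> \<pi>2) x > 0 \<longleftrightarrow> x < 0)" if "x \<in> annulus j n" for x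
    using sw that c(2)[OF that] unfolding swaps_def split by auto
  have "swaps i n (\<pi>1 \<circ> \<pi>2) \<longleftrightarrow>
     (\<forall>x\<in>annulus i j. (\<pi>1 \<circ> \<pi>2) x \<in> annulus i n \<and> ((\<pi>1 \<circ> \<pi>2) x > 0 \<longleftrightarrow> x < 0))"
    unfolding swaps_def using 2 by (subst (1) split) blast
  also have "\<dots> \<longleftrightarrow> swaps i j \<pi>1"
    unfolding swaps_def using 1 ann in_ball by simp
  finally show ?thesis .
qed

definition min_cut :: "nat \<Rightarrow> nat \<Rightarrow> (int \<Rightarrow> int) \<Rightarrow> nat" where
  "min_cut k n \<pi> = (LEAST j. k \<le> j \<and> swaps j n \<pi>)"

lemma min_cut:
  assumes "k \<le> n"
  shows "k \<le> min_cut k n \<pi>" "min_cut k n \<pi> \<le> n" "swaps (min_cut k n \<pi>) n \<pi>"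
    "k \<le> i \<Longrightarrow> i < min_cut k n \<pi> \<Longrightarrow> \<not> swaps i n \<pi>"
  unfolding min_cut_def
  using LeastI[of "\<lambda>j. k \<le> j \<and> swaps j n \<pi>" n] Least_le[of "\<lambda>j. k \<le> j \<and> swaps j n \<pi>" n]
    not_less_Least[of i "\<lambda>j. k \<le> j \<and> swaps j n \<pi>"] assms by auto

lemma split_at_cut:
  assumes \<pi>: "\<pi> permutes ball_int e n" and sw: "swaps j n \<pi>" and "j \<le> n"
  defines "\<pi>1 \<equiv> restrict_id \<pi> (ball_int e j)" and "\<pi>2 \<equiv> restrict_id \<pi> (annulus j n)"
  shows "\<pi>1 permutes ball_int e j" "\<pi>2 \<in> swap_perms j n" "\<pi>1 \<circ> \<pi>2 = \<pi>"
proof -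
  have inj: "inj_on \<pi> A" for A using permutes_inj[OF \<pi>] by (rule inj_on_subset) auto
  have "\<pi> ` annulus j n \<subseteq> annulus j n" using sw by (auto simp: swaps_def)
  then have an: "\<pi> ` annulus j n = annulus j n" by (rule endo_inj_surj[OF finite_annulus _ inj])
  have "\<pi> ` (ball_int e n - annulus j n) = ball_int e n - annulus j n"
    using inj_on_image_set_diff[OF inj[of UNIV], of "ball_int e n" "annulus j n"] an permutes_image[OF \<pi>] by simp
  moreover have "ball_int e n - annulus j n = ball_int e j"
    using ball_int_Un_annulus[OF \<open>j \<le> n\<close>, of e] ball_int_Int_annulus[of e j n] by blast
  ultimately have bl: "\<pi> ` ball_int e j = ball_int e j" by simp
  show 1: "\<pi>1 permutes ball_int e j"
    unfolding \<pi>1_def using bl inj by (intro bij_imp_permutes bij_betw_restrict_id) (auto simp: bij_betw_def)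
  have 2: "\<pi>2 permutes annulus j n"
    unfolding \<pi>2_def using an inj by (intro bij_imp_permutes bij_betw_restrict_id) (auto simp: bij_betw_def)
  then show "\<pi>2 \<in> swap_perms j n"
    using sw by (auto simp: swap_perms_def swaps_def \<pi>2_def)
  show "\<pi>1 \<circ> \<pi>2 = \<pi>"
  proof
    fix x
    consider "x \<in> ball_int e j" | "x \<in> annulus j n" | "x \<notin> ball_int e n"
      using ball_int_Un_annulus[OF \<open>j \<le> n\<close>, of e] by blast
    then show "(\<pi>1 \<circ> \<pi>2) x = \<pi> x"
    proof cases
      case 1
      then show ?thesis using comp_permutes_disjoint(1)[OF \<open>\<pi>1 permutes _\<close> 2 ball_int_Int_annulus] by (simp add: \<pi>1_def)
    next
      case 2
      then show ?thesis using comp_permutes_disjoint(2)[OF \<open>\<pi>1 permutes _\<close> \<open>\<pi>2 permutes _\<close> ball_int_Int_annulus] by (simp add: \<pi>2_def)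
    next
      case 3
      then have "x \<notin> annulus j n" "x \<notin> ball_int e j" using ball_int_Un_annulus[OF \<open>j \<le> n\<close>, of e] by blast+
      then show ?thesis using 3 \<pi> by (simp add: \<pi>1_def \<pi>2_def permutes_not_in)
    qed
  qed
qed

lemma comp_cut_perms:
  assumes "\<pi>1 \<in> core_perms k e j" "\<pi>2 \<in> swap_perms j n" "k \<le> j" "j \<le> n"
  shows "\<pi>1 \<circ> \<pi>2 \<in> cut_perms k e n" "min_cut k n (\<pi>1 \<circ> \<pi>2) = j"
    "restrict_id (\<pi>1 \<circ> \<pi>2) (ball_int e j) = \<pi>1" "restrict_id (\<pi>1 \<circ> \<pi>2) (annulus j n) = \<pi>2"
proof -
  have p1: "\<pi>1 permutes ball_int e j" and p2: "\<pi>2 permutes annulus j n"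
    using assms by (auto simp: core_perms_def cut_perms_def swap_perms_def)
  note sc = swaps_comp[OF p1 assms(2) _ assms(4)]
  have "\<pi>1 \<circ> \<pi>2 permutes ball_int e n"
    using ball_int_Un_annulus[OF assms(4), of e]
    by (intro permutes_compose permutes_subset[OF p1] permutes_subset[OF p2]) auto
  then show "\<pi>1 \<circ> \<pi>2 \<in> cut_perms k e n"
    using assms sc by (auto simp: cut_perms_def core_perms_def)
  show "min_cut k n (\<pi>1 \<circ> \<pi>2) = j"
    unfolding min_cut_def
  proof (rule Least_equality)
    show "k \<le> j \<and> swaps j n (\<pi>1 \<circ> \<pi>2)" using assms sc[of j] by simp
    show "j \<le> i" if "k \<le> i \<and> swaps i n (\<pi>1 \<circ> \<pi>2)" for i
      using that assms(1) sc[of i] by (cases "i < j") (auto simp: core_perms_def)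
  qed
  note c = comp_permutes_disjoint[OF p1 p2 ball_int_Int_annulus]
  show "restrict_id (\<pi>1 \<circ> \<pi>2) (ball_int e j) = \<pi>1"
    using c p1 by (auto simp: restrict_id_def fun_eq_iff permutes_not_in)
  show "restrict_id (\<pi>1 \<circ> \<pi>2) (annulus j n) = \<pi>2"
    using c p2 by (auto simp: restrict_id_def fun_eq_iff permutes_not_in)
qed

text \<open>Unique factorization at the innermost cut of level at least \<open>k\<close>: the inner
  factor has no such cut below \<open>j\<close>, while the outer one is an arbitrary swapping
  permutation and may be cut again.\<close>

lemma sum_cut_perms:
  assumes "k \<le> n"
  shows "(\<Sum>\<pi>\<in>cut_perms k e n. f \<pi>) =
    (\<Sum>j=k..n. \<Sum>\<pi>1\<in>core_perms k e j. \<Sum>\<pi>2\<in>swap_perms j n. f (\<pi>1 \<circ> \<pi>2))"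
proof -
  have "(\<Sum>j=k..n. \<Sum>\<pi>1\<in>core_perms k e j. \<Sum>\<pi>2\<in>swap_perms j n. f (\<pi>1 \<circ> \<pi>2)) =
     (\<Sum>(j, \<pi>1, \<pi>2)\<in>Sigma {k..n} (\<lambda>j. core_perms k e j \<times> swap_perms j n). f (\<pi>1 \<circ> \<pi>2))"
    by (simp add: sum.Sigma sum.cartesian_product)
  also have "\<dots> = (\<Sum>\<pi>\<in>cut_perms k e n. f \<pi>)"
  proof (rule sum.reindex_bij_witness[where j = "\<lambda>(j, \<pi>1, \<pi>2). \<pi>1 \<circ> \<pi>2" and
      i = "\<lambda>\<pi>. (min_cut k n \<pi>, restrict_id \<pi> (ball_int e (min_cut k n \<pi>)), restrict_id \<pi> (annulus (min_cut k n \<pi>) n))"],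
      goal_cases)
    case (1 a)
    obtain j \<pi>1 \<pi>2 where "a = (j, \<pi>1, \<pi>2)" by (cases a)
    with 1 show ?case using comp_cut_perms[of \<pi>1 k e j \<pi>2 n] by simp
  next
    case (2 a)
    then show ?case by (auto simp: comp_cut_perms)
  next
    case (3 \<pi>)
    let ?j = "min_cut k n \<pi>"
    have "\<pi> permutes ball_int e n" using 3 by (simp add: cut_perms_def)
    from split_at_cut[OF this min_cut(3,2)[OF assms]] show ?case by simp
  next
    case (4 \<pi>)
    let ?j = "min_cut k n \<pi>"
    have p: "\<pi> permutes ball_int e n" using 4 by (simp add: cut_perms_def)
    note s = split_at_cut[OF this min_cut(3,2)[OF assms]]
    have "swaps i ?j (restrict_id \<pi> (ball_int e ?j)) \<longleftrightarrow> swaps i n \<pi>" if "i \<le> ?j" for i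
      using swaps_comp[OF s(1,2) that min_cut(2)[OF assms]] s(3) by simp
    then show ?case
      using 4 s(1,2) min_cut[OF assms, where \<pi> = \<pi>] by (auto simp: core_perms_def cut_perms_def)
  next
    case (5 a)
    then show ?case by auto
  qed
  finally show ?thesis by simp
qed

section \<open>Total weights in closed form\<close>

text \<open>Source and target may differ because a swapping permutation is a pair of bijections
  between the negative and the positive side.\<close>

definition bijs :: "'a set \<Rightarrow> 'b set \<Rightarrow> ('a \<Rightarrow> 'b) set" where
  "bijs S T = {f \<in> extensional S. bij_betw f S T}"

lemma finite_bijs: "finite S \<Longrightarrow> finite T \<Longrightarrow> finite (bijs S T)"
  by (rule finite_subset[OF _ finite_PiE[of S "\<lambda>_. T"]]) (auto simp: bijs_def PiE_def bij_betw_def)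

lemma noninv_cong: "(\<And>x. x \<in> S \<Longrightarrow> f x = g x) \<Longrightarrow> noninv S f = noninv S g"
  unfolding noninv_def by (intro arg_cong[of _ _ card]) auto

lemma noninv_remove_Max:
  assumes "finite S" "x \<in> S" "\<And>y. y \<in> S \<Longrightarrow> y \<le> x" "bij_betw f S T"
  shows "noninv S f = noninv (S - {x}) f + card {z \<in> T. z < f x}"
proof -
  have inj: "inj_on f S" and T: "T = f ` S" using assms(4) by (auto simp: bij_betw_def)
  have "{(i, j). i \<in> S \<and> j \<in> S \<and> i < j \<and> f i < f j} =
     {(i, j). i \<in> S - {x} \<and> j \<in> S - {x} \<and> i < j \<and> f i < f j} \<union> (\<lambda>i. (i, x)) ` {i \<in> S. f i < f x}"
  proof (rule set_eqI, clarify)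
    fix i j
    have "i < x" if "i \<in> S" "i \<noteq> x" for i using assms(3)[OF that(1)] that(2) by (rule le_neq_trans)
    moreover have "i \<noteq> x" if "j \<in> S" "i < j" using assms(3)[OF that(1)] that(2) by auto
    ultimately show "(i, j) \<in> {(i, j). i \<in> S \<and> j \<in> S \<and> i < j \<and> f i < f j} \<longleftrightarrow>
      (i, j) \<in> {(i, j). i \<in> S - {x} \<and> j \<in> S - {x} \<and> i < j \<and> f i < f j} \<union> (\<lambda>i. (i, x)) ` {i \<in> S. f i < f x}"
      using assms(2) by (cases "j = x") auto
  qed
  then have "noninv S f = noninv (S - {x}) f + card ((\<lambda>i. (i, x)) ` {i \<in> S. f i < f x})"
    unfolding noninv_def using assms(1)
    by (simp only:) (subst card_Un_disjoint, auto intro: finite_subset[OF _ finite_noninv_pairs[of S f]])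
  also have "card ((\<lambda>i. (i, x)) ` {i \<in> S. f i < f x}) = card {i \<in> S. f i < f x}"
    by (intro card_image) (auto simp: inj_on_def)
  also have "\<dots> = card (f ` {i \<in> S. f i < f x})"
    by (intro card_image[symmetric] inj_on_subset[OF inj]) auto
  also have "f ` {i \<in> S. f i < f x} = {z \<in> T. z < f x}" by (auto simp: T)
  finally show ?thesis .
qed

lemma sum_power_rank:
  fixes T :: "'a::linorder set" and p :: "'b::comm_semiring_1"
  assumes "finite T"
  shows "(\<Sum>y\<in>T. p ^ card {z \<in> T. z < y}) = (\<Sum>k<card T. p ^ k)"
proof -
  let ?r = "\<lambda>y. card {z \<in> T. z < y}"
  have less: "?r x < ?r y" if "x \<in> T" "x < y" for x y
    using assms that by (intro psubset_card_mono) auto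
  then have inj: "inj_on ?r T"
  proof (intro inj_onI)
    fix x y assume "x \<in> T" "y \<in> T" "?r x = ?r y"
    then show "x = y" using less[of x y] less[of y x] by (cases x y rule: linorder_cases) auto
  qed
  have "?r y < card T" if "y \<in> T" for y
    using assms that by (intro psubset_card_mono) auto
  then have "?r ` T = {..<card T}"
    by (intro card_subset_eq) (auto simp: card_image[OF inj])
  then have "bij_betw ?r T {..<card T}" using inj by (simp add: bij_betw_def)
  then show ?thesis by (rule sum.reindex_bij_betw)
qed

text \<open>The largest element of \<open>S\<close> forms non-inversions exactly with the preimages
  of values below its own image, so it contributes \<open>p\<close> to the rank of that image.
  Iterating gives the q-factorial, whatever the two ordered sets are.\<close>

lemma sum_bijs_noninv:
  fixes S :: "'a::linorder set" and T :: "'b::linorder set" and p :: "'c::comm_semiring_1"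
  assumes "finite S" "finite T" "card S = N" "card T = N"
  shows "(\<Sum>f\<in>bijs S T. p ^ noninv S f) = (\<Prod>i=1..N. \<Sum>k<i. p ^ k)"
  using assms
proof (induction N arbitrary: S T)
  case 0
  then have "bijs S T = {\<lambda>_. undefined}" by (auto simp: bijs_def bij_betw_def)
  then show ?case using 0 by (simp add: noninv_def)
next
  case (Suc N)
  define x where "x = Max S"
  have ne: "S \<noteq> {}" using Suc.prems by auto
  have x: "x \<in> S" "\<And>y. y \<in> S \<Longrightarrow> y \<le> x" using Suc.prems ne by (auto simp: x_def)
  let ?S = "S - {x}"
  have "(\<Sum>f\<in>bijs S T. p ^ noninv S f) =
     (\<Sum>(y, g)\<in>Sigma T (\<lambda>y. bijs ?S (T - {y})). p ^ card {z \<in> T. z < y} * p ^ noninv ?S g)"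
  proof (rule sum.reindex_bij_witness[where i = "\<lambda>(y, g). g(x := y)" and j = "\<lambda>f. (f x, restrict f ?S)"], goal_cases)
    case (1 f)
    then have "f \<in> extensional S" by (simp add: bijs_def)
    then show ?case using x by (auto simp: fun_eq_iff restrict_def extensional_def)
  next
    case (2 f)
    then have f: "bij_betw f S T" by (simp add: bijs_def)
    then have "bij_betw f ?S (T - {f x})" using x(1)
      by (intro bij_betw_DiffI) (auto simp: bij_betw_def)
    then have "bij_betw (restrict f ?S) ?S (T - {f x})"
      by (rule bij_betw_cong[THEN iffD1, rotated]) auto
    then show ?case using f x by (auto simp: bijs_def bij_betw_def)
  next
    case (3 yg)
    then obtain y g where yg: "yg = (y, g)" "y \<in> T" "g \<in> bijs ?S (T - {y})" by auto
    then have "restrict g ?S = g" by (auto simp: bijs_def extensional_restrict)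
    moreover have "restrict (g(x := y)) ?S = restrict g ?S" by (auto simp: restrict_def)
    ultimately show ?case using yg by simp
  next
    case (4 yg)
    then obtain y g where yg: "yg = (y, g)" "y \<in> T" "g \<in> extensional ?S" "bij_betw g ?S (T - {y})" by (auto simp: bijs_def)
    have "bij_betw (g(x := y)) ?S (T - {y})"
      using yg(4) by (rule bij_betw_cong[THEN iffD1, rotated]) auto
    then have "bij_betw (g(x := y)) (?S \<union> {x}) ((T - {y}) \<union> {y})"
      by (rule bij_betw_combine) (auto simp: bij_betw_def)
    moreover have "?S \<union> {x} = S" "(T - {y}) \<union> {y} = T" using x(1) yg(2) by auto
    ultimately show ?case using yg x(1) by (auto simp: bijs_def extensional_def)
  next
    case (5 f)
    then have f: "bij_betw f S T" by (simp add: bijs_def)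
    have "noninv ?S (restrict f ?S) = noninv ?S f" by (rule noninv_cong) auto
    then show ?case using noninv_remove_Max[OF Suc.prems(1) x f]
      by (simp add: power_add mult.commute)
  qed
  also have "\<dots> = (\<Sum>y\<in>T. \<Sum>g\<in>bijs ?S (T - {y}). p ^ card {z \<in> T. z < y} * p ^ noninv ?S g)"
    using Suc.prems by (simp add: sum.Sigma finite_bijs)
  also have "\<dots> = (\<Sum>y\<in>T. p ^ card {z \<in> T. z < y} * (\<Prod>i=1..N. \<Sum>k<i. p ^ k))"
  proof (intro sum.cong refl)
    fix y assume "y \<in> T"
    then show "(\<Sum>g\<in>bijs ?S (T - {y}). p ^ card {z \<in> T. z < y} * p ^ noninv ?S g) =
       p ^ card {z \<in> T. z < y} * (\<Prod>i=1..N. \<Sum>k<i. p ^ k)"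
      using Suc.IH[of ?S "T - {y}"] Suc.prems x(1) by (simp add: sum_distrib_left[symmetric])
  qed
  also have "\<dots> = (\<Sum>k<Suc N. p ^ k) * (\<Prod>i=1..N. \<Sum>k<i. p ^ k)"
    using sum_power_rank[OF Suc.prems(2), of p] Suc.prems(4) by (simp only: sum_distrib_right[symmetric])
  finally show ?case by (simp add: mult.commute)
qed

lemma q_factorial:
  fixes p :: real
  shows "(1 - p) ^ N * (\<Prod>i=1..N. \<Sum>k<i. p ^ k) = (\<Prod>i=1..N. 1 - p ^ i)"
proof (induction N)
  case (Suc N)
  have "(1 - p) * (\<Sum>k<Suc N. p ^ k) = 1 - p ^ Suc N" using sum_gp_basic[of p N] by (simp only: lessThan_Suc_atMost)
  with Suc show ?case by (simp add: mult_ac del: sum.lessThan_Suc)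
qed simp

lemma sum_permutes_noninv:
  fixes S :: "'a::linorder set" and p :: "'c::comm_semiring_1"
  assumes "finite S"
  shows "(\<Sum>\<pi>\<in>{\<pi>. \<pi> permutes S}. p ^ noninv S \<pi>) = (\<Prod>i=1..card S. \<Sum>k<i. p ^ k)"
proof -
  have "(\<Sum>\<pi>\<in>{\<pi>. \<pi> permutes S}. p ^ noninv S \<pi>) = (\<Sum>f\<in>bijs S S. p ^ noninv S f)"
  proof (rule sum.reindex_bij_witness[where i = "\<lambda>f. restrict_id f S" and j = "\<lambda>\<pi>. restrict \<pi> S"], goal_cases)
    case (1 \<pi>)
    then show ?case by (auto simp: fun_eq_iff restrict_id_def permutes_not_in)
  next
    case (2 \<pi>)
    then have "bij_betw (restrict \<pi> S) S S"
      by (intro bij_betw_cong[THEN iffD1, OF _ permutes_imp_bij[of \<pi> S]]) auto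
    then show ?case by (simp add: bijs_def)
  next
    case (3 f)
    then show ?case by (auto simp: fun_eq_iff restrict_id_def bijs_def extensional_def)
  next
    case (4 f)
    then show ?case by (auto simp: bijs_def intro!: bij_imp_permutes bij_betw_restrict_id)
  next
    case (5 \<pi>)
    have "noninv S (restrict \<pi> S) = noninv S \<pi>" by (rule noninv_cong) auto
    then show ?case by simp
  qed
  then show ?thesis using sum_bijs_noninv[OF assms assms refl refl] by simp
qed

text \<open>Negative positions have positive images and conversely, so pairs with one position on
  each side are always inversions. The two bijections are thus independent, and each contributes a
  q-factorial.\<close>

lemma sum_swap_perms_noninv:
  fixes p :: "'c::comm_semiring_1"
  shows "(\<Sum>\<pi>\<in>swap_perms 0 n. p ^ noninv (annulus 0 n) \<pi>) = (\<Prod>i=1..n. \<Sum>k<i. p ^ k)\<^sup>2"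
proof -
  define L :: "int set" where "L = {- int n..-1}"
  define R :: "int set" where "R = {1..int n}"
  have fin: "finite L" "finite R" by (auto simp: L_def R_def)
  have cards: "card L = n" "card R = n" by (auto simp: L_def R_def)
  have LR: "annulus 0 n = L \<union> R" "L \<inter> R = {}" by (auto simp: annulus_def L_def R_def)
  have pos: "x \<in> L \<Longrightarrow> x < 0" "x \<in> R \<Longrightarrow> x > 0" for x by (auto simp: L_def R_def)
  have sw: "swaps 0 n \<pi> \<longleftrightarrow> \<pi> ` L \<subseteq> R \<and> \<pi> ` R \<subseteq> L" for \<pi>
  proof -
    have 1: "(\<pi> x \<in> L \<union> R \<and> (0 < \<pi> x \<longleftrightarrow> x < 0)) \<longleftrightarrow> \<pi> x \<in> R" if "x \<in> L" for x
      using that pos by force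
    have 2: "(\<pi> x \<in> L \<union> R \<and> (0 < \<pi> x \<longleftrightarrow> x < 0)) \<longleftrightarrow> \<pi> x \<in> L" if "x \<in> R" for x
      using that pos by force
    show ?thesis
      unfolding swaps_def LR ball_Un image_subset_iff by (simp only: 1 2 cong: ball_cong)
  qed
  have "(\<Sum>\<pi>\<in>swap_perms 0 n. p ^ noninv (annulus 0 n) \<pi>) =
     (\<Sum>(f, g)\<in>bijs L R \<times> bijs R L. p ^ noninv L f * p ^ noninv R g)"
  proof (rule sum.reindex_bij_witness[where j = "\<lambda>\<pi>. (restrict \<pi> L, restrict \<pi> R)" and
      i = "\<lambda>(f, g) x. if x \<in> L then f x else if x \<in> R then g x else x"], goal_cases)
    case (1 \<pi>)
    then have "\<pi> permutes L \<union> R" by (simp add: swap_perms_def LR)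
    then show ?case by (auto simp: fun_eq_iff permutes_not_in)
  next
    case (2 \<pi>)
    then have p: "\<pi> permutes L \<union> R" and s: "\<pi> ` L \<subseteq> R" "\<pi> ` R \<subseteq> L" by (auto simp: swap_perms_def LR sw)
    have inj: "inj_on \<pi> A" for A using permutes_inj[OF p] by (rule inj_on_subset) auto
    have "\<pi> ` L = R" using s(1) fin cards by (intro card_subset_eq) (auto simp: card_image[OF inj])
    moreover have "\<pi> ` R = L" using s(2) fin cards by (intro card_subset_eq) (auto simp: card_image[OF inj])
    ultimately show ?case using inj by (auto simp: bijs_def bij_betw_def inj_on_def)
  next
    case (3 fg)
    then obtain f g where "fg = (f, g)" "f \<in> extensional L" "g \<in> extensional R" by (auto simp: bijs_def)
    then show ?case using LR(2) by (auto simp: fun_eq_iff extensional_def)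
  next
    case (4 fg)
    then obtain f g where fg: "fg = (f, g)" "bij_betw f L R" "bij_betw g R L" by (auto simp: bijs_def)
    let ?\<pi> = "\<lambda>x. if x \<in> L then f x else if x \<in> R then g x else x"
    have 1: "bij_betw ?\<pi> L R" using fg(2) by (rule bij_betw_cong[THEN iffD1, rotated]) auto
    have 2: "bij_betw ?\<pi> R L" using fg(3) LR(2) by (intro bij_betw_cong[THEN iffD1, OF _ fg(3)]) auto
    have "bij_betw ?\<pi> (L \<union> R) (R \<union> L)" by (rule bij_betw_combine[OF 1 2]) (use LR in auto)
    then have "?\<pi> permutes L \<union> R" by (intro bij_imp_permutes) (auto simp: Un_commute)
    moreover have "swaps 0 n ?\<pi>" unfolding sw using 1 2 unfolding bij_betw_def by blast
    ultimately show ?case by (simp add: fg(1) swap_perms_def LR)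
  next
    case (5 \<pi>)
    then have s: "\<pi> ` L \<subseteq> R" "\<pi> ` R \<subseteq> L" by (auto simp: swap_perms_def sw)
    have c: "\<pi> y \<le> \<pi> x" "\<not> y < x" if "x \<in> L" "y \<in> R" for x y
      using that s pos by (smt (verit) image_subset_iff)+
    have "noninv (annulus 0 n) \<pi> = noninv L \<pi> + noninv R \<pi>"
      unfolding LR by (rule noninv_Un[OF fin LR(2)]) (use c in auto)
    moreover have "noninv L (restrict \<pi> L) = noninv L \<pi>" "noninv R (restrict \<pi> R) = noninv R \<pi>"
      by (auto intro!: noninv_cong)
    ultimately show ?case by (simp add: power_add)
  qed
  also have "\<dots> = (\<Sum>f\<in>bijs L R. p ^ noninv L f) * (\<Sum>g\<in>bijs R L. p ^ noninv R g)"
    by (simp add: sum_product sum.cartesian_product)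
  also have "\<dots> = (\<Prod>i=1..n. \<Sum>k<i. p ^ k)\<^sup>2"
    using fin cards by (simp add: sum_bijs_noninv[where N = n] power2_eq_square)
  finally show ?thesis .
qed

text \<open>The finite q-Pochhammer symbol (p; p)_n; its limit is Euler's product.\<close>

definition euler_prod :: "real \<Rightarrow> nat \<Rightarrow> real" where
  "euler_prod p n = (\<Prod>i=1..n. 1 - p ^ i)"

lemma euler_prod_pos:
  assumes "0 \<le> p" "p < 1"
  shows "0 < euler_prod p n"
  unfolding euler_prod_def
proof (rule prod_pos)
  fix i assume "i \<in> {1..n}"
  then have "p ^ i \<le> p ^ 1" using assms by (intro power_decreasing) auto
  then show "0 < 1 - p ^ i" using assms by simp
qed

lemma euler_prod_Suc: "euler_prod p (Suc n) = euler_prod p n * (1 - p ^ Suc n)"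
  by (simp add: euler_prod_def)

lemma euler_prod_decseq:
  assumes "0 \<le> p" "p < 1"
  shows "decseq (euler_prod p)"
  unfolding decseq_Suc_iff euler_prod_Suc
  using euler_prod_pos[OF assms] assms by (auto simp: mult_left_le less_imp_le)

lemma euler_prod_le_1:
  assumes "0 \<le> p" "p < 1"
  shows "euler_prod p n \<le> 1"
  using decseqD[OF euler_prod_decseq[OF assms], of 0 n] by (simp add: euler_prod_def)

lemma euler_prod_limit:
  assumes "0 < p" "p < 1"
  obtains L where "L > 0" "euler_prod p \<longlonglongrightarrow> L"
proof -
  define f where "f = (\<lambda>i. 1 - p ^ Suc i)"
  have f: "f i \<noteq> 0" for i
    using power_Suc_less_one[of p i] assms by (simp add: f_def)
  have eq: "euler_prod p (Suc n) = (\<Prod>i\<le>n. f i)" for n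
    unfolding euler_prod_def f_def lessThan_Suc_atMost[symmetric] by (rule prod.atLeast1_atMost_eq[unfolded One_nat_def[symmetric]])
  have "summable (\<lambda>i. norm (f i - 1))"
  proof -
    have "summable (\<lambda>i. p * p ^ i)"
      using assms by (intro summable_mult summable_geometric) auto
    then show ?thesis using assms by (simp add: f_def abs_mult power_abs)
  qed
  then have conv: "convergent_prod f"
    by (intro abs_convergent_prod_imp_convergent_prod summable_imp_abs_convergent_prod)
  have lim: "euler_prod p \<longlonglongrightarrow> prodinf f"
    by (rule LIMSEQ_imp_Suc) (use convergent_prod_LIMSEQ[OF conv] in \<open>simp add: eq\<close>)
  have "prodinf f \<ge> 0"
    using euler_prod_pos[of p] assms by (intro LIMSEQ_le_const[OF lim]) (auto intro: less_imp_le)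
  moreover have "prodinf f \<noteq> 0" using conv f by (rule prodinf_nonzero)
  ultimately have "prodinf f > 0" by simp
  then show ?thesis using lim by (rule that)
qed

lemma card_ball_int: "card (ball_int e n) = 2 * n + of_bool e"
proof -
  have "ball_int e n = (if e then {- int n..int n} else {- int n..-1} \<union> {1..int n})"
    by (auto simp: ball_int_def)
  then show ?thesis by (simp add: card_Un_disjoint nat_add_distrib nat_mult_distrib)
qed

lemma card_ball_int_split: "j \<le> n \<Longrightarrow> card (ball_int e n) = card (ball_int e j) + card (annulus j n)"
  using ball_int_Un_annulus[of j n e] ball_int_Int_annulus[of e j n]
  by (simp add: card_Un_disjoint[symmetric])

text \<open>Pushing both halves outwards preserves order and sides, so the weight of an annulus
  depends on its width only.\<close>

definition shift_out :: "nat \<Rightarrow> int \<Rightarrow> int" where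
  "shift_out j x = x + sgn x * int j"

lemma bij_betw_shift_out: "bij_betw (shift_out j) (annulus 0 n) (annulus j (j + n))"
  by (rule bij_betw_byWitness[where f' = "\<lambda>x. x - sgn x * int j"])
     (auto simp: annulus_def shift_out_def sgn_if split: if_splits)

lemma strict_mono_shift_out: "strict_mono_on S (shift_out j)"
  by (auto simp: strict_mono_on_def shift_out_def sgn_if)

lemma swaps_shift_out:
  assumes "\<pi> permutes annulus 0 n"
  shows "swaps j (j + n) (map_permutation (annulus 0 n) (shift_out j) \<pi>) \<longleftrightarrow> swaps 0 n \<pi>"
proof -
  let ?g = "shift_out j" and ?A = "annulus 0 n"
  have inj: "inj_on ?g ?A" and im: "annulus j (j + n) = ?g ` ?A"
    using bij_betw_shift_out[of j n] by (auto simp: bij_betw_def)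
  have sg: "?g x > 0 \<longleftrightarrow> x > 0" "?g x < 0 \<longleftrightarrow> x < 0" for x
    by (auto simp: shift_out_def sgn_if)
  show ?thesis
    unfolding swaps_def im
    using assms by (simp add: map_permutation_apply[OF inj] sg permutes_in_image)
qed

section \<open>The renewal structure of an additive statistic\<close>

text \<open>The linear bound is what converts moments of the block size into moments of the
  statistic.\<close>

locale cut_statistic =
  fixes p :: real and stat :: "int set \<Rightarrow> (int \<Rightarrow> int) \<Rightarrow> real" and C :: real
  assumes p: "0 < p" "p < 1"
    and stat_Un: "\<lbrakk>finite S; finite T; S \<inter> T = {}; \<pi>1 permutes S; \<pi>2 permutes T\<rbrakk>
       \<Longrightarrow> stat (S \<union> T) (\<pi>1 \<circ> \<pi>2) = stat S \<pi>1 + stat T \<pi>2"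
    and stat_map: "\<lbrakk>finite S; bij_betw g S T; \<pi> permutes S\<rbrakk> \<Longrightarrow> stat T (map_permutation S g \<pi>) = stat S \<pi>"
    and stat_bound: "finite S \<Longrightarrow> \<bar>stat S \<pi>\<bar> \<le> C * real (card S)"
    and C_nonneg: "C \<ge> 0"
begin

text \<open>The power of \<open>1 - p\<close> is multiplicative over disjoint sets and turns
  q-factorials into convergent Euler products; with it the irreducible blocks have total mass
  1.\<close>

definition weight :: "int set \<Rightarrow> (int \<Rightarrow> int) \<Rightarrow> real" where
  "weight S \<pi> = p ^ noninv S \<pi> * (1 - p) ^ card S"

definition F :: "real \<Rightarrow> int set \<Rightarrow> (int \<Rightarrow> int) \<Rightarrow> complex" where
  "F x S \<pi> = of_real (weight S \<pi>) * cis (x * stat S \<pi>)"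

definition core :: "nat \<Rightarrow> bool \<Rightarrow> real \<Rightarrow> nat \<Rightarrow> complex" where
  "core k e x j = (\<Sum>\<pi>\<in>core_perms k e j. F x (ball_int e j) \<pi>)"

definition core0 :: "nat \<Rightarrow> bool \<Rightarrow> nat \<Rightarrow> real" where
  "core0 k e j = (\<Sum>\<pi>\<in>core_perms k e j. weight (ball_int e j) \<pi>)"

definition U :: "real \<Rightarrow> nat \<Rightarrow> complex" where
  "U x n = (\<Sum>\<pi>\<in>swap_perms 0 n. F x (annulus 0 n) \<pi>)"

definition W :: "bool \<Rightarrow> real \<Rightarrow> nat \<Rightarrow> complex" where
  "W e x n = (\<Sum>\<pi>\<in>{\<pi>. \<pi> permutes ball_int e n}. F x (ball_int e n) \<pi>)"

lemma weight_nonneg: "weight S \<pi> \<ge> 0"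
  using p by (simp add: weight_def)

text \<open>Inner positions and images have modulus at most \<open>j\<close>, outer ones exceed
  \<open>j\<close>, and outer positions change sign: no pair across the cut is a
  non-inversion.\<close>

lemma weight_comp:
  assumes "\<pi>1 permutes ball_int e j" "\<pi>2 \<in> swap_perms j n" "j \<le> n"
  shows "weight (ball_int e n) (\<pi>1 \<circ> \<pi>2) = weight (ball_int e j) \<pi>1 * weight (annulus j n) \<pi>2"
proof -
  have p2: "\<pi>2 permutes annulus j n" and sw: "swaps j n \<pi>2" using assms(2) by (auto simp: swap_perms_def)
  note c = comp_permutes_disjoint[OF assms(1) p2 ball_int_Int_annulus]
  have "noninv (ball_int e j \<union> annulus j n) (\<pi>1 \<circ> \<pi>2) = noninv (ball_int e j) \<pi>1 + noninv (annulus j n) \<pi>2"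
  proof (rule noninv_Un[OF finite_ball_int finite_annulus ball_int_Int_annulus c])
    fix x y assume xy: "x \<in> ball_int e j" "y \<in> annulus j n"
    then have "\<pi>1 x \<in> ball_int e j" using assms(1) by (simp add: permutes_in_image)
    then have "\<bar>\<pi>1 x\<bar> \<le> int j" by (simp add: ball_int_def)
    moreover have "\<bar>x\<bar> \<le> int j" "int j < \<bar>y\<bar>" using xy by (auto simp: ball_int_def annulus_def)
    moreover have "int j < \<bar>\<pi>2 y\<bar>" "\<pi>2 y > 0 \<longleftrightarrow> y < 0"
      using sw xy(2) by (auto simp: swaps_def annulus_def)
    ultimately show "(x < y \<longrightarrow> (\<pi>1 \<circ> \<pi>2) y \<le> (\<pi>1 \<circ> \<pi>2) x) \<and> (y < x \<longrightarrow> (\<pi>1 \<circ> \<pi>2) x \<le> (\<pi>1 \<circ> \<pi>2) y)"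
      unfolding c(1)[OF xy(1)] c(2)[OF xy(2)] by linarith
  qed
  then show ?thesis
    using card_ball_int_split[OF assms(3), of e]
    by (simp add: weight_def ball_int_Un_annulus[OF assms(3)] power_add)
qed

lemma F_comp:
  assumes "\<pi>1 permutes ball_int e j" "\<pi>2 \<in> swap_perms j n" "j \<le> n"
  shows "F x (ball_int e n) (\<pi>1 \<circ> \<pi>2) = F x (ball_int e j) \<pi>1 * F x (annulus j n) \<pi>2"
proof -
  have p2: "\<pi>2 permutes annulus j n" using assms(2) by (auto simp: swap_perms_def)
  have "stat (ball_int e n) (\<pi>1 \<circ> \<pi>2) = stat (ball_int e j) \<pi>1 + stat (annulus j n) \<pi>2"
    using stat_Un[OF finite_ball_int finite_annulus ball_int_Int_annulus assms(1) p2]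
    by (simp add: ball_int_Un_annulus[OF assms(3)])
  then show ?thesis
    using weight_comp[OF assms] by (simp add: F_def cis_mult[symmetric] ring_distribs)
qed

lemma sum_swap_perms_shift:
  "(\<Sum>\<pi>\<in>swap_perms j (j + n). F x (annulus j (j + n)) \<pi>) = U x n"
proof -
  let ?g = "shift_out j"
  have "(\<Sum>\<pi>\<in>swap_perms j (j + n). F x (annulus j (j + n)) \<pi>) =
     (\<Sum>\<pi>\<in>{\<pi>. \<pi> permutes annulus 0 n \<and> swaps j (j + n) (map_permutation (annulus 0 n) ?g \<pi>)}.
        F x (annulus j (j + n)) (map_permutation (annulus 0 n) ?g \<pi>))"
    unfolding swap_perms_def by (rule sum_permutes_relabel[OF bij_betw_shift_out])
  also have "\<dots> = U x n"
    unfolding U_def swap_perms_def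
  proof (intro sum.cong)
    fix \<pi> assume "\<pi> \<in> {\<pi>. \<pi> permutes annulus 0 n \<and> swaps 0 n \<pi>}"
    then have \<pi>: "\<pi> permutes annulus 0 n" by simp
    show "F x (annulus j (j + n)) (map_permutation (annulus 0 n) ?g \<pi>) = F x (annulus 0 n) \<pi>"
      using stat_map[OF finite_annulus bij_betw_shift_out \<pi>]
        noninv_map_permutation[OF bij_betw_shift_out strict_mono_shift_out \<pi>]
        bij_betw_same_card[OF bij_betw_shift_out[of j n]]
      by (simp add: F_def weight_def)
  qed (auto simp: swaps_shift_out)
  finally show ?thesis .
qed

text \<open>One identity used twice: \<open>k = 0\<close> expresses \<open>W\<close> through
  \<open>U\<close>, and \<open>k = 1\<close> is the renewal equation of \<open>U\<close>.\<close>

lemma sum_cut_perms_F: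
  assumes "k \<le> n"
  shows "(\<Sum>\<pi>\<in>cut_perms k e n. F x (ball_int e n) \<pi>) = (\<Sum>j=k..n. core k e x j * U x (n - j))"
proof -
  have "(\<Sum>\<pi>\<in>cut_perms k e n. F x (ball_int e n) \<pi>) =
    (\<Sum>j=k..n. \<Sum>\<pi>1\<in>core_perms k e j. \<Sum>\<pi>2\<in>swap_perms j n. F x (ball_int e n) (\<pi>1 \<circ> \<pi>2))"
    by (rule sum_cut_perms[OF assms])
  also have "\<dots> = (\<Sum>j=k..n. \<Sum>\<pi>1\<in>core_perms k e j. \<Sum>\<pi>2\<in>swap_perms j n.
     F x (ball_int e j) \<pi>1 * F x (annulus j n) \<pi>2)"
    by (intro sum.cong refl F_comp) (auto simp: core_perms_def cut_perms_def)
  also have "\<dots> = (\<Sum>j=k..n. core k e x j * (\<Sum>\<pi>2\<in>swap_perms j n. F x (annulus j n) \<pi>2))"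
    by (simp add: core_def sum_product)
  also have "\<dots> = (\<Sum>j=k..n. core k e x j * U x (n - j))"
    
  proof (intro sum.cong refl)
    fix j assume "j \<in> {k..n}"
    then show "core k e x j * (\<Sum>\<pi>2\<in>swap_perms j n. F x (annulus j n) \<pi>2) = core k e x j * U x (n - j)"
      using sum_swap_perms_shift[where j = j and n = "n - j" and x = x] by simp
  qed
  finally show ?thesis .
qed

lemma W_decomp: "W e x n = (\<Sum>j\<le>n. core 0 e x j * U x (n - j))"
  using sum_cut_perms_F[where k = 0 and n = n and e = e and x = x] by (simp add: W_def cut_perms_def atLeast0AtMost)

lemma U_eq_cut: "U x n = (\<Sum>\<pi>\<in>cut_perms 1 False n. F x (ball_int False n) \<pi>)"
  by (simp add: U_def cut_perms_def swap_perms_def annulus_0)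

lemma U_0: "U x 0 = 1"
proof -
  have "annulus 0 0 = {}" by (auto simp: annulus_def)
  moreover have "stat {} id = 0" using stat_bound[of "{}" id] by simp
  ultimately show ?thesis
    by (simp add: U_def swap_perms_def F_def weight_def noninv_def cong: conj_cong)
qed

text \<open>The value at \<open>0\<close> is set by hand: \<open>core_perms 1 False 0\<close> is not empty but contains \<open>id\<close>.\<close>
definition \<alpha> :: "real \<Rightarrow> nat \<Rightarrow> complex" where
  "\<alpha> x m = (if m = 0 then 0 else core 1 False x m)"

definition a :: "nat \<Rightarrow> real" where
  "a m = (if m = 0 then 0 else core0 1 False m)"

lemma U_rec: "U x n = (if n = 0 then 1 else \<Sum>m=1..n. \<alpha> x m * U x (n - m))"
  using sum_cut_perms_F[where k = 1 and n = n and e = False and x = x] U_eq_cut[of x n]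
  by (auto simp: U_0 \<alpha>_def intro!: sum.cong)

lemma core_at_0: "core k e 0 j = of_real (core0 k e j)"
  by (simp add: core_def core0_def F_def)

lemma \<alpha>_at_0: "\<alpha> 0 m = of_real (a m)"
  by (simp add: \<alpha>_def a_def core_at_0)

lemma core0_nonneg: "core0 k e j \<ge> 0"
  by (simp add: core0_def sum_nonneg weight_nonneg)

lemma norm_core_le: "cmod (core k e x j) \<le> core0 k e j"
  unfolding core_def core0_def
  by (rule sum_norm_le) (simp add: F_def norm_mult weight_nonneg)

definition u :: "nat \<Rightarrow> real" where "u n = (euler_prod p n)\<^sup>2"

lemma U_at_0: "U 0 n = of_real (u n)"
proof -
  have "card (annulus 0 n) = 2 * n" by (simp add: annulus_0 card_ball_int)
  then have "(\<Sum>\<pi>\<in>swap_perms 0 n. weight (annulus 0 n) \<pi>) = ((1 - p) ^ n * (\<Prod>i=1..n. \<Sum>k<i. p ^ k))\<^sup>2"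
    using sum_swap_perms_noninv[of p n]
    by (simp add: weight_def sum_distrib_right[symmetric] power_mult_distrib power_mult[symmetric] mult.commute)
  then have "(\<Sum>\<pi>\<in>swap_perms 0 n. weight (annulus 0 n) \<pi>) = u n"
    by (simp only: q_factorial u_def euler_prod_def)
  then show ?thesis
    by (simp add: U_def F_def of_real_sum[symmetric] del: of_real_sum)
qed

lemma W_at_0: "W e 0 n = of_real (euler_prod p (2 * n + of_bool e))"
proof -
  have "(\<Sum>\<pi>\<in>{\<pi>. \<pi> permutes ball_int e n}. weight (ball_int e n) \<pi>) = euler_prod p (card (ball_int e n))"
    using sum_permutes_noninv[of "ball_int e n" p] q_factorial[of p "card (ball_int e n)"]
    by (simp add: weight_def sum_distrib_right[symmetric] euler_prod_def mult.commute)
  then show ?thesis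
    by (simp add: W_def F_def of_real_sum[symmetric] card_ball_int del: of_real_sum)
qed

definition L :: real where "L = lim (euler_prod p)"

lemma L: "L > 0" "euler_prod p \<longlonglongrightarrow> L"
  using euler_prod_limit[OF p] limI unfolding L_def by metis+

definition c :: real where "c = L\<^sup>2"

lemma u_rec: "u n = (if n = 0 then 1 else \<Sum>m=1..n. a m * u (n - m))"
proof -
  have "complex_of_real (u n) = of_real (if n = 0 then 1 else \<Sum>m=1..n. a m * u (n - m))"
    using U_rec[of 0 n] by (simp add: U_at_0 \<alpha>_at_0)
  then show ?thesis by (simp only: of_real_eq_iff)
qed

lemma u_limit: "u \<longlonglongrightarrow> c"
  unfolding u_def c_def by (intro tendsto_intros L)

text \<open>One step lowers \<open>u\<close> by at most \<open>2 * p ^ Suc n\<close>. Subtracting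
  the geometric tail of these bounds gives the sequence \<open>v\<close>, which increases to
  \<open>c\<close>.\<close>

lemma u_excess: "u n - c \<le> 2 / (1 - p) * p ^ Suc n"
proof -
  define v where "v = (\<lambda>n. u n - 2 / (1 - p) * p ^ Suc n)"
  have "v n \<le> v (Suc n)" for n
  proof -
    have e: "0 \<le> euler_prod p n" "euler_prod p n \<le> 1"
      using euler_prod_pos[of p n] euler_prod_le_1[of p n] p by auto
    have "(euler_prod p n)\<^sup>2 \<le> 1" using e by (simp add: power_le_one)
    have "u n - u (Suc n) = (euler_prod p n)\<^sup>2 * (p ^ Suc n * (2 - p ^ Suc n))"
      unfolding u_def euler_prod_Suc power_mult_distrib by (simp add: algebra_simps power2_eq_square)
    also have "\<dots> \<le> 1 * (p ^ Suc n * (2 - 0))"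
      using p \<open>(euler_prod p n)\<^sup>2 \<le> 1\<close> power_le_one[of p "Suc n"]
      by (intro mult_mono) auto
    also have "\<dots> = 2 / (1 - p) * p ^ Suc n - 2 / (1 - p) * p ^ Suc (Suc n)"
    proof -
      have "D * y - D * (p * y) = D * (1 - p) * y" for D y :: real by (simp add: algebra_simps)
      moreover have "2 / (1 - p) * (1 - p) = 2" 
      proof -
        have "1 - p \<noteq> 0" using p by simp
        then show ?thesis unfolding times_divide_eq_left by (rule nonzero_mult_div_cancel_right)
      qed
      ultimately have "2 / (1 - p) * p ^ Suc n - 2 / (1 - p) * (p * p ^ Suc n) = 2 * p ^ Suc n"
        by (simp only:)
      then show ?thesis by (simp only: power_Suc[of p "Suc n"]) simp
    qed
    finally show ?thesis by (simp add: v_def)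
  qed
  then have "incseq v" by (rule incseq_SucI)
  moreover have "v \<longlonglongrightarrow> c - 2 / (1 - p) * 0"
    unfolding v_def using p by (intro tendsto_intros u_limit LIMSEQ_Suc[OF LIMSEQ_realpow_zero]) auto
  ultimately have "v n \<le> c" by (intro incseq_le) auto
  then show ?thesis by (simp add: v_def)
qed

lemma u_decseq: "decseq u"
  unfolding decseq_Suc_iff u_def
  using euler_prod_decseq[of p] euler_prod_pos[of p] p
  by (auto simp: decseq_Suc_iff less_imp_le intro!: power_mono)

lemma norm_cis_diff: "cmod (cis x - 1) \<le> \<bar>x\<bar>"
  using iexp_approx1[of x 0] by (simp add: cis_conv_exp)

text \<open>The Lipschitz constant is \<open>2 * C\<close> because a block of radius
  \<open>m\<close> without centre has \<open>2 * m\<close> positions.\<close>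

sublocale perturbed_renewal a u c \<alpha> U "2 * C"
proof unfold_locales
  show "a 0 = 0" by (simp add: a_def)
  show "0 \<le> a m" for m by (simp add: a_def core0_nonneg)
  show "u n = (if n = 0 then 1 else \<Sum>m=1..n. a m * u (n - m))" for n by (rule u_rec)
  show "decseq u" by (rule u_decseq)
  show "u \<longlonglongrightarrow> c" by (rule u_limit)
  show "0 < c" using L by (simp add: c_def)
  show "summable (\<lambda>n. u n - c)"
  proof (rule summable_comparison_test'[of _ 0])
    show "summable (\<lambda>n. 2 / (1 - p) * p ^ Suc n)"
      using p by (intro summable_mult) (simp add: summable_geometric summable_mult)
    show "norm (u n - c) \<le> 2 / (1 - p) * p ^ Suc n" for n
      using u_excess[of n] decseq_ge[OF u_decseq u_limit, of n] by simp
  qed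
  show "cmod (\<alpha> x m) \<le> a m" for x m by (simp add: \<alpha>_def a_def norm_core_le)
  show "cmod (\<alpha> x m - of_real (a m)) \<le> 2 * C * \<bar>x\<bar> * (real m * a m)" for x m
  proof (cases "m = 0")
    case False
    have "\<alpha> x m - of_real (a m) = (\<Sum>\<pi>\<in>core_perms 1 False m.
        of_real (weight (ball_int False m) \<pi>) * (cis (x * stat (ball_int False m) \<pi>) - 1))"
      using False by (simp add: \<alpha>_def a_def core_def core0_def F_def sum_subtractf right_diff_distrib)
    also have "cmod \<dots> \<le> (\<Sum>\<pi>\<in>core_perms 1 False m. weight (ball_int False m) \<pi> * (2 * C * \<bar>x\<bar> * real m))"
    proof (rule sum_norm_le)
      fix \<pi>
      have "cmod (cis (x * stat (ball_int False m) \<pi>) - 1) \<le> \<bar>x\<bar> * \<bar>stat (ball_int False m) \<pi>\<bar>"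
        using norm_cis_diff by (metis abs_mult)
      also have "\<dots> \<le> \<bar>x\<bar> * (C * real (card (ball_int False m)))"
        by (intro mult_left_mono stat_bound) auto
      also have "\<dots> = 2 * C * \<bar>x\<bar> * real m" by (simp add: card_ball_int)
      finally show "cmod (of_real (weight (ball_int False m) \<pi>) * (cis (x * stat (ball_int False m) \<pi>) - 1))
          \<le> weight (ball_int False m) \<pi> * (2 * C * \<bar>x\<bar> * real m)"
        unfolding norm_mult norm_of_real abs_of_nonneg[OF weight_nonneg]
        by (rule mult_left_mono[OF _ weight_nonneg])
    qed
    also have "\<dots> = 2 * C * \<bar>x\<bar> * (real m * a m)"
      using False by (simp add: a_def core0_def sum_distrib_right[symmetric])
    finally show ?thesis .
  qed (simp add: \<alpha>_def a_def)
  show "0 \<le> 2 * C" using C_nonneg by simp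
  show "U x n = (if n = 0 then 1 else \<Sum>m=1..n. \<alpha> x m * U x (n - m))" for x n by (rule U_rec)
qed

text \<open>With \<open>y2\<close> below, the Taylor coefficients of \<open>\<alpha>\<close> at
  \<open>x = 0\<close>: moments of the statistic over irreducible blocks of radius
  \<open>m\<close>.\<close>

definition y1 :: "nat \<Rightarrow> real" where
  "y1 m = (if m = 0 then 0 else
     \<Sum>\<pi>\<in>core_perms 1 False m. weight (ball_int False m) \<pi> * stat (ball_int False m) \<pi>)"

definition y2 :: "nat \<Rightarrow> real" where
  "y2 m = (if m = 0 then 0 else
     \<Sum>\<pi>\<in>core_perms 1 False m. weight (ball_int False m) \<pi> * (stat (ball_int False m) \<pi>)\<^sup>2)"

lemma stat_ball_bound: "\<bar>stat (ball_int False m) \<pi>\<bar> \<le> 2 * C * real m"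
  using stat_bound[of "ball_int False m" \<pi>] by (simp add: card_ball_int)

lemma y1_bound: "\<bar>y1 m\<bar> \<le> 2 * C * (real m * a m)"
proof (cases "m = 0")
  case False
  have "\<bar>y1 m\<bar> \<le> (\<Sum>\<pi>\<in>core_perms 1 False m. \<bar>weight (ball_int False m) \<pi> * stat (ball_int False m) \<pi>\<bar>)"
    using False by (simp add: y1_def sum_abs)
  also have "\<dots> \<le> (\<Sum>\<pi>\<in>core_perms 1 False m. weight (ball_int False m) \<pi> * (2 * C * real m))"
    by (intro sum_mono) (simp add: abs_mult weight_nonneg mult_left_mono stat_ball_bound)
  also have "\<dots> = 2 * C * (real m * a m)"
    using False by (simp add: a_def core0_def sum_distrib_right[symmetric])
  finally show ?thesis .
qed (simp add: y1_def)

lemma y2_nonneg: "y2 m \<ge> 0"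
  by (simp add: y2_def sum_nonneg weight_nonneg)

lemma y2_bound: "y2 m \<le> 4 * C\<^sup>2 * ((real m)\<^sup>2 * a m)"
proof (cases "m = 0")
  case False
  have sq: "(stat (ball_int False m) \<pi>)\<^sup>2 \<le> (2 * C * real m)\<^sup>2" for \<pi>
    using stat_ball_bound by (metis abs_ge_zero power_mono power2_abs)
  have "y2 m \<le> (\<Sum>\<pi>\<in>core_perms 1 False m. weight (ball_int False m) \<pi> * (2 * C * real m)\<^sup>2)"
    using False by (auto simp: y2_def intro!: sum_mono mult_left_mono sq weight_nonneg)
  also have "\<dots> = 4 * C\<^sup>2 * ((real m)\<^sup>2 * a m)"
    using False by (simp add: a_def core0_def sum_distrib_right[symmetric] power_mult_distrib)
  finally show ?thesis .
qed (simp add: y2_def)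

lemma y1_summable: "summable y1"
proof (rule summable_comparison_test'[of _ 0])
  show "summable (\<lambda>m. 2 * C * (real m * a m))"
    using first_moment by (intro summable_mult) (simp add: sums_iff)
qed (simp add: y1_bound)

lemma y2_summable: "summable y2"
  by (rule summable_comparison_test'[OF summable_mult[OF second_moment, of "4 * C\<^sup>2"], of 0])
     (simp add: y2_nonneg y2_bound)

lemma cis_order_1: "cmod (cis y - 1 - \<i> * y) \<le> y\<^sup>2 / 2"
  using iexp_approx1[of y 1] by (simp add: cis_conv_exp algebra_simps numeral_2_eq_2)

lemma cis_order_2: "cmod (cis y - 1 - \<i> * of_real y + (of_real y)\<^sup>2 / 2) \<le> \<bar>y\<bar> ^ 3 / 6"
proof -
  have "(\<Sum>k\<le>2. (\<i> * complex_of_real y) ^ k / fact k) = 1 + \<i> * y - y\<^sup>2 / 2"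
    by (simp add: numeral_2_eq_2 power_mult_distrib)
  with iexp_approx1[of y 2] show ?thesis
    by (simp add: cis_conv_exp algebra_simps eval_nat_numeral)
qed

lemma \<alpha>_expansion_le: "cmod (\<alpha> x m - a m - \<i> * x * y1 m) \<le> x\<^sup>2 / 2 * y2 m"
proof (cases "m = 0")
  case False
  let ?B = "ball_int False m"
  have "\<alpha> x m - a m - \<i> * x * y1 m = (\<Sum>\<pi>\<in>core_perms 1 False m.
      of_real (weight ?B \<pi>) * (cis (x * stat ?B \<pi>) - 1 - \<i> * of_real (x * stat ?B \<pi>)))"
    using False by (simp add: \<alpha>_def a_def y1_def core_def core0_def F_def sum_subtractf right_diff_distrib
      sum_distrib_left mult_ac)
  also have "cmod \<dots> \<le> (\<Sum>\<pi>\<in>core_perms 1 False m. weight ?B \<pi> * ((x * stat ?B \<pi>)\<^sup>2 / 2))"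
  proof (rule sum_norm_le)
    fix \<pi>
    show "cmod (of_real (weight ?B \<pi>) * (cis (x * stat ?B \<pi>) - 1 - \<i> * of_real (x * stat ?B \<pi>)))
        \<le> weight ?B \<pi> * ((x * stat ?B \<pi>)\<^sup>2 / 2)"
      unfolding norm_mult norm_of_real abs_of_nonneg[OF weight_nonneg]
      by (rule mult_left_mono[OF cis_order_1 weight_nonneg])
  qed
  also have "\<dots> = x\<^sup>2 / 2 * y2 m"
    using False by (simp add: y2_def sum_distrib_left power_mult_distrib mult_ac)
  finally show ?thesis .
qed (simp add: \<alpha>_def a_def y1_def y2_def)

lemma \<alpha>_expansion_limit:
  "((\<lambda>x. (\<alpha> x m - a m - \<i> * x * y1 m) / of_real (x\<^sup>2)) \<longlongrightarrow> - of_real (y2 m / 2)) (at 0)"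
proof (cases "m = 0")
  case False
  let ?B = "ball_int False m"
  have one: "((\<lambda>x. (cis (x * y) - 1 - \<i> * of_real (x * y)) / of_real (x\<^sup>2)) \<longlongrightarrow> - of_real (y\<^sup>2 / 2)) (at 0)" for y
  proof (rule LIM_zero_cancel, rule Lim_null_comparison)
    show "\<forall>\<^sub>F x in at 0. cmod ((cis (x * y) - 1 - \<i> * of_real (x * y)) / of_real (x\<^sup>2) - - of_real (y\<^sup>2 / 2)) \<le> \<bar>x\<bar> * \<bar>y\<bar> ^ 3 / 6"
      unfolding eventually_at_filter
    proof (intro always_eventually allI impI)
      fix x :: real assume x: "x \<noteq> 0"
      have "(cis (x * y) - 1 - \<i> * of_real (x * y)) / of_real (x\<^sup>2) - - of_real (y\<^sup>2 / 2) =
        (cis (x * y) - 1 - \<i> * of_real (x * y) + (of_real (x * y))\<^sup>2 / 2) / of_real (x\<^sup>2)"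
        using x by (simp add: add_divide_distrib power_mult_distrib)
      also have "cmod \<dots> \<le> (\<bar>x * y\<bar> ^ 3 / 6) / x\<^sup>2"
      proof -
        have "cmod ((cis (x * y) - 1 - \<i> * of_real (x * y) + (of_real (x * y))\<^sup>2 / 2) / of_real (x\<^sup>2)) =
          cmod (cis (x * y) - 1 - \<i> * of_real (x * y) + (of_real (x * y))\<^sup>2 / 2) / x\<^sup>2"
          by (simp only: norm_divide norm_of_real abs_power2)
        also have "\<dots> \<le> (\<bar>x * y\<bar> ^ 3 / 6) / x\<^sup>2"
          by (rule divide_right_mono[OF cis_order_2]) simp
        finally show ?thesis .
      qed
      also have "\<dots> = \<bar>x\<bar> * \<bar>y\<bar> ^ 3 / 6"
      proof -
        have "\<bar>x * y\<bar> ^ 3 = x\<^sup>2 * (\<bar>x\<bar> * \<bar>y\<bar> ^ 3)"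
          by (simp only: abs_mult power_mult_distrib power3_eq_cube power2_abs[of x, symmetric]) (simp only: power2_eq_square mult_ac)
        then show ?thesis using x by simp
      qed
      finally show "cmod ((cis (x * y) - 1 - \<i> * of_real (x * y)) / of_real (x\<^sup>2) - - of_real (y\<^sup>2 / 2)) \<le> \<bar>x\<bar> * \<bar>y\<bar> ^ 3 / 6" .
    qed
    have "((\<lambda>x. \<bar>x\<bar> * \<bar>y\<bar> ^ 3 / 6) \<longlongrightarrow> \<bar>0\<bar> * \<bar>y\<bar> ^ 3 / 6) (at 0)"
      by (intro tendsto_intros) auto
    then show "((\<lambda>x. \<bar>x\<bar> * \<bar>y\<bar> ^ 3 / 6) \<longlongrightarrow> 0) (at 0)" by simp
  qed
  have "((\<lambda>x. \<Sum>\<pi>\<in>core_perms 1 False m. of_real (weight ?B \<pi>) *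
       ((cis (x * stat ?B \<pi>) - 1 - \<i> * of_real (x * stat ?B \<pi>)) / of_real (x\<^sup>2)))
     \<longlongrightarrow> (\<Sum>\<pi>\<in>core_perms 1 False m. of_real (weight ?B \<pi>) * - of_real ((stat ?B \<pi>)\<^sup>2 / 2))) (at 0)"
    by (intro tendsto_intros one)
  moreover have "(\<alpha> x m - a m - \<i> * x * y1 m) / of_real (x\<^sup>2) = (\<Sum>\<pi>\<in>core_perms 1 False m.
      of_real (weight ?B \<pi>) * ((cis (x * stat ?B \<pi>) - 1 - \<i> * of_real (x * stat ?B \<pi>)) / of_real (x\<^sup>2)))" for x
    using False unfolding times_divide_eq_right sum_divide_distrib[symmetric]
    by (simp add: \<alpha>_def a_def y1_def core_def core0_def F_def sum_subtractf right_diff_distrib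
      sum_distrib_left mult_ac)
  moreover have "(\<Sum>\<pi>\<in>core_perms 1 False m. of_real (weight ?B \<pi>) * - of_real ((stat ?B \<pi>)\<^sup>2 / 2)) = - complex_of_real (y2 m / 2)"
    using False by (simp add: y2_def sum_negf sum_divide_distrib)
  ultimately show ?thesis by simp
qed (simp add: \<alpha>_def a_def y1_def y2_def)

text \<open>The terms of order 0 and 1 drop out, as the total mass is 1 and the mean is 0. The
  second-order quotients converge for each \<open>m\<close> and are dominated by
  \<open>y2 m / 2\<close>, summable by the second moment of \<open>a\<close>.\<close>

lemma \<alpha>_quadratic:
  assumes "suminf y1 = 0"
  shows "((\<lambda>x. (1 - (\<Sum>m. \<alpha> x m)) / of_real (x\<^sup>2)) \<longlongrightarrow> of_real (suminf y2 / 2)) (at 0)"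
proof -
  define h where "h = (\<lambda>m x. (\<alpha> x m - a m - \<i> * x * y1 m) / of_real (x\<^sup>2))"
  have y2s: "summable (\<lambda>m. y2 m / 2)" using y2_summable by (rule summable_divide)
  have "((\<lambda>x. \<Sum>m. h m x) \<longlongrightarrow> (\<Sum>m. - of_real (y2 m / 2))) (at 0)"
  proof (rule tannerys_theorem[where M = "\<lambda>m. y2 m / 2", THEN conjunct2, THEN conjunct2])
    show "((\<lambda>x. h m x) \<longlongrightarrow> - of_real (y2 m / 2)) (at 0)" for m
      unfolding h_def by (rule \<alpha>_expansion_limit)
    have "cmod (h m x) \<le> y2 m / 2" for m x
    proof (cases "x = 0")
      case False
      have "cmod (h m x) \<le> (x\<^sup>2 / 2 * y2 m) / x\<^sup>2"
        unfolding h_def norm_divide norm_of_real abs_power2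
        by (rule divide_right_mono[OF \<alpha>_expansion_le]) simp
      then show ?thesis using False by simp
    qed (simp add: h_def y2_nonneg)
    then show "\<forall>\<^sub>F (k, x) in sequentially \<times>\<^sub>F at 0. cmod (h k x) \<le> y2 k / 2"
      by (intro always_eventually) auto
  qed (use y2s in auto)
  also have "(\<Sum>m. - complex_of_real (y2 m / 2)) = - of_real (suminf y2 / 2)"
    using suminf_minus[OF summable_of_real[OF y2s, where 'a = complex]] suminf_of_real[OF y2s, where 'a = complex]
      suminf_divide[OF y2_summable, of 2] by simp
  finally have "((\<lambda>x. - (\<Sum>m. h m x)) \<longlongrightarrow> - (- of_real (suminf y2 / 2))) (at 0)"
    by (rule tendsto_minus)
  moreover have "- (\<Sum>m. h m x) = (1 - (\<Sum>m. \<alpha> x m)) / of_real (x\<^sup>2)" for x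
  proof -
    have s\<alpha>: "summable (\<alpha> x)"
      by (rule summable_comparison_test'[OF a_summable, of 0]) (rule \<alpha>_le)
    have sa: "(\<lambda>m. complex_of_real (a m)) sums 1"
      using sums_of_real[OF summable_sums[OF a_summable], where 'a = complex] suminf_a by simp
    have sy: "(\<lambda>m. complex_of_real (y1 m)) sums 0"
      using sums_of_real[OF summable_sums[OF y1_summable], where 'a = complex] assms by simp
    have "(\<lambda>m. (\<alpha> x m - a m - \<i> * x * y1 m) / of_real (x\<^sup>2)) sums
       (((\<Sum>m. \<alpha> x m) - 1 - \<i> * x * 0) / of_real (x\<^sup>2))"
      by (intro sums_divide sums_diff sums_mult summable_sums[OF s\<alpha>] sa sy)
    then have "(\<Sum>m. h m x) = ((\<Sum>m. \<alpha> x m) - 1) / of_real (x\<^sup>2)"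
      unfolding h_def by (simp add: sums_iff)
    then show ?thesis by (simp add: minus_divide_left)
  qed
  ultimately show ?thesis by simp
qed

text \<open>The innermost block has summable weights that do not depend on \<open>N\<close>, so it
  tends to a constant factor, the same in numerator and denominator; only the Gaussian factor from
  \<open>U\<close> survives.\<close>

theorem W_limit:
  assumes mean: "suminf y1 = 0"
    and s: "filterlim s (at 0) sequentially" and N: "filterlim N at_top sequentially"
    and Ns: "(\<lambda>n. real (N n) * (s n)\<^sup>2) \<longlonglongrightarrow> \<tau>"
  shows "(\<lambda>n. W e (s n) (N n) / W e 0 (N n)) \<longlonglongrightarrow> of_real (exp (- (c * suminf y2 * \<tau> / 2)))"
proof -
  let ?g = "exp (- (c * suminf y2 * \<tau> / 2))"
  have s0: "s \<longlonglongrightarrow> 0" using s by (simp add: filterlim_at)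
  have Nj: "filterlim (\<lambda>n. N n - j) at_top sequentially" for j
    using filterlim_compose[OF filterlim_minus_const_nat_at_top N] by simp
  have Nge: "\<forall>\<^sub>F n in sequentially. N n \<ge> j" for j
    using N by (simp add: filterlim_at_top)
  have y2_0: "suminf y2 \<ge> 0" using y2_summable y2_nonneg by (rule suminf_nonneg)
  have U_lim: "(\<lambda>n. U (s n) (N n - j)) \<longlonglongrightarrow> of_real (c * ?g)" for j
  proof (rule renewal_clt[OF \<alpha>_quadratic[OF mean] y2_0 s Nj])
    have "(\<lambda>n. real (N n) * (s n)\<^sup>2 - real j * (s n)\<^sup>2) \<longlonglongrightarrow> \<tau> - real j * 0\<^sup>2"
      by (intro tendsto_intros Ns s0)
    then have "(\<lambda>n. real (N n) * (s n)\<^sup>2 - real j * (s n)\<^sup>2) \<longlonglongrightarrow> \<tau>" by simp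
    then show "(\<lambda>n. real (N n - j) * (s n)\<^sup>2) \<longlonglongrightarrow> \<tau>"
      by (rule Lim_transform_eventually) (use Nge[of j] in \<open>eventually_elim, simp add: of_nat_diff left_diff_distrib\<close>)
  qed
  have w_decomp: "euler_prod p (2 * n + of_bool e) = (\<Sum>j\<le>n. core0 0 e j * u (n - j))" for n
  proof -
    have "complex_of_real (euler_prod p (2 * n + of_bool e)) = of_real (\<Sum>j\<le>n. core0 0 e j * u (n - j))"
      using W_decomp[of e 0 n] by (simp add: W_at_0 U_at_0 core_at_0)
    then show ?thesis by (simp only: of_real_eq_iff)
  qed
  have r_summable: "summable (\<lambda>j. core0 0 e j)"
  proof (rule summableI_nonneg_bounded)
    show "(\<Sum>j<n. core0 0 e j) \<le> 1 / c" for n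
    proof -
      have "(\<Sum>j<n. core0 0 e j) * c \<le> (\<Sum>j\<le>n. core0 0 e j) * c"
        using core0_nonneg c_pos by (intro mult_right_mono sum_mono2) (auto simp: less_imp_le)
      also have "\<dots> \<le> (\<Sum>j\<le>n. core0 0 e j * u (n - j))"
        unfolding sum_distrib_right by (intro sum_mono mult_left_mono u_ge core0_nonneg)
      also have "\<dots> \<le> 1" unfolding w_decomp[symmetric] using p by (intro euler_prod_le_1) auto
      finally show ?thesis using c_pos by (simp add: field_simps)
    qed
  qed (rule core0_nonneg)
  \<comment> \<open>The sequence \<open>t\<close> is left free to treat the numerator with
    \<open>t = s\<close> and the denominator with \<open>t = 0\<close> alike.\<close>
  have tannery: "(\<lambda>n. \<Sum>j\<le>N n. core 0 e (t n) j * U (t n) (N n - j)) \<longlonglongrightarrow> of_real (suminf (core0 0 e) * z)"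
    if t: "\<And>j. (\<lambda>n. core 0 e (t n) j) \<longlonglongrightarrow> of_real (core0 0 e j)"
      and Ut: "\<And>j. (\<lambda>n. U (t n) (N n - j)) \<longlonglongrightarrow> of_real z" for t and z :: real
  proof -
    define f where "f = (\<lambda>j n. if j \<le> N n then core 0 e (t n) j * U (t n) (N n - j) else 0)"
    have "(\<lambda>n. \<Sum>j. f j n) \<longlonglongrightarrow> (\<Sum>j. of_real (core0 0 e j * z))"
    proof (rule tannerys_theorem[where M = "core0 0 e", THEN conjunct2, THEN conjunct2])
      show "(\<lambda>n. f j n) \<longlonglongrightarrow> of_real (core0 0 e j * z)" for j
      proof -
        have "(\<lambda>n. core 0 e (t n) j * U (t n) (N n - j)) \<longlonglongrightarrow> of_real (core0 0 e j * z)"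
          unfolding of_real_mult by (intro tendsto_intros t Ut)
        then show ?thesis
          by (rule Lim_transform_eventually) (use Nge[of j] in \<open>eventually_elim, simp add: f_def\<close>)
      qed
      have "cmod (f j n) \<le> core0 0 e j" for j n
        using mult_mono[OF norm_core_le[of 0 e "t n" j] ut_le_1[of "t n" "N n - j"]] core0_nonneg
        by (simp add: f_def norm_mult)
      then show "\<forall>\<^sub>F (k, x) in sequentially \<times>\<^sub>F sequentially. cmod (f k x) \<le> core0 0 e k"
        by (intro always_eventually) auto
    qed (use r_summable in auto)
    also have "(\<Sum>j. complex_of_real (core0 0 e j * z)) = of_real (suminf (core0 0 e) * z)"
      using suminf_of_real[OF summable_mult2[OF r_summable, of z], where 'a = complex] suminf_mult2[OF r_summable, of z]
      by simp
    also have "(\<lambda>n. \<Sum>j. f j n) = (\<lambda>n. \<Sum>j\<le>N n. core 0 e (t n) j * U (t n) (N n - j))"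
    proof
      fix n
      have "(\<Sum>j. f j n) = (\<Sum>j\<le>N n. f j n)"
        by (rule suminf_finite) (auto simp: f_def)
      then show "(\<Sum>j. f j n) = (\<Sum>j\<le>N n. core 0 e (t n) j * U (t n) (N n - j))"
        by (simp add: f_def)
    qed
    finally show ?thesis .
  qed
  have core_lim: "(\<lambda>n. core 0 e (s n) j) \<longlonglongrightarrow> of_real (core0 0 e j)" for j
  proof -
    have "(\<lambda>n. core 0 e (s n) j) \<longlonglongrightarrow> (\<Sum>\<pi>\<in>core_perms 0 e j.
        of_real (weight (ball_int e j) \<pi>) * cis (0 * stat (ball_int e j) \<pi>))"
      unfolding core_def F_def by (intro tendsto_intros s0)
    then show ?thesis by (simp add: core0_def)
  qed
  have W1: "(\<lambda>n. W e (s n) (N n)) \<longlonglongrightarrow> of_real (suminf (core0 0 e) * (c * ?g))"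
    unfolding W_decomp by (rule tannery[OF core_lim U_lim])
  have W0: "(\<lambda>n. W e 0 (N n)) \<longlonglongrightarrow> of_real (suminf (core0 0 e) * c)"
    unfolding W_decomp
  proof (rule tannery)
    show "(\<lambda>n. U 0 (N n - j)) \<longlonglongrightarrow> of_real c" for j
      unfolding U_at_0 by (intro tendsto_intros filterlim_compose[OF u_limit Nj])
  qed (simp add: core_at_0)
  \<comment> \<open>A second evaluation of the limit of the denominator, by Euler's product, shows
    that it is not 0.\<close>
  have "filterlim (\<lambda>n. 2 * N n + of_bool e) at_top sequentially"
    by (rule filterlim_at_top_mono[OF N]) (auto intro!: always_eventually)
  then have "(\<lambda>n. W e 0 (N n)) \<longlonglongrightarrow> of_real L"
    unfolding W_at_0 by (intro tendsto_of_real filterlim_compose[OF L(2)])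
  then have "complex_of_real (suminf (core0 0 e) * c) = of_real L"
    using W0 by (intro LIMSEQ_unique)
  then have nz: "suminf (core0 0 e) * c \<noteq> 0" using L(1) by (metis of_real_eq_iff less_irrefl)
  have "(\<lambda>n. W e (s n) (N n) / W e 0 (N n)) \<longlonglongrightarrow>
      of_real (suminf (core0 0 e) * (c * ?g)) / of_real (suminf (core0 0 e) * c)"
    by (intro tendsto_divide W1 W0) (use nz in \<open>simp only: of_real_eq_0_iff not_False_eq_True\<close>)
  also have "of_real (suminf (core0 0 e) * (c * ?g)) / of_real (suminf (core0 0 e) * c) = complex_of_real ?g"
    using nz by simp
  finally show ?thesis .
qed

end

section \<open>Cycle counts of Mallows permutations\<close>

text \<open>The scalar projections that determine the characteristic function of the vector.
  Centring by a multiple of \<open>card S\<close> keeps them additive over blocks.\<close>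

definition cycle_stat :: "nat \<Rightarrow> (nat \<Rightarrow> real) \<Rightarrow> (nat \<Rightarrow> real) \<Rightarrow> 'a set \<Rightarrow> ('a \<Rightarrow> 'a) \<Rightarrow> real" where
  "cycle_stat l \<theta> \<mu> S \<pi> = (\<Sum>k\<in>{1..l}. \<theta> k * (real (num_cycles S (2 * k) \<pi>) - \<mu> k * real (card S)))"

lemma cut_statistic_cycle_stat:
  assumes "0 < p" "p < 1"
  shows "cut_statistic p (cycle_stat l \<theta> \<mu>) (\<Sum>k\<in>{1..l}. \<bar>\<theta> k\<bar> * (1 + \<bar>\<mu> k\<bar>))"
proof
  show "0 < p" "p < 1" by fact+
next
  fix S T \<pi>1 \<pi>2
  assume a: "finite S" "finite T" "S \<inter> T = {}" "\<pi>1 permutes S" "\<pi>2 permutes (T :: int set)"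
  have "num_cycles (S \<union> T) i (\<pi>1 \<circ> \<pi>2) = num_cycles S i \<pi>1 + num_cycles T i \<pi>2" for i
    by (rule num_cycles_Un[OF a]) (use comp_permutes_disjoint[OF a(4,5,3)] in auto)
  then show "cycle_stat l \<theta> \<mu> (S \<union> T) (\<pi>1 \<circ> \<pi>2) = cycle_stat l \<theta> \<mu> S \<pi>1 + cycle_stat l \<theta> \<mu> T \<pi>2"
    using a by (simp add: cycle_stat_def card_Un_disjoint sum.distrib[symmetric] algebra_simps)
next
  fix S T :: "int set" and g \<pi>
  assume "finite S" "bij_betw g S T" "\<pi> permutes S"
  then show "cycle_stat l \<theta> \<mu> T (map_permutation S g \<pi>) = cycle_stat l \<theta> \<mu> S \<pi>"
    by (simp add: cycle_stat_def num_cycles_map_permutation bij_betw_same_card[of g S T])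
next
  fix S :: "int set" and \<pi> assume "finite S"
  have "\<bar>\<theta> k * (real (num_cycles S (2 * k) \<pi>) - \<mu> k * real (card S))\<bar> \<le> \<bar>\<theta> k\<bar> * (1 + \<bar>\<mu> k\<bar>) * real (card S)" for k
  proof -
    have "\<bar>real (num_cycles S (2 * k) \<pi>) - \<mu> k * real (card S)\<bar> \<le> real (num_cycles S (2 * k) \<pi>) + \<bar>\<mu> k\<bar> * real (card S)"
      using abs_triangle_ineq4[of "real (num_cycles S (2 * k) \<pi>)" "\<mu> k * real (card S)"] by (simp add: abs_mult)
    also have "\<dots> \<le> (1 + \<bar>\<mu> k\<bar>) * real (card S)"
      using num_cycles_le[OF \<open>finite S\<close>, of "2 * k" \<pi>] by (simp add: algebra_simps)
    finally have "\<bar>\<theta> k\<bar> * \<bar>real (num_cycles S (2 * k) \<pi>) - \<mu> k * real (card S)\<bar> \<le> \<bar>\<theta> k\<bar> * ((1 + \<bar>\<mu> k\<bar>) * real (card S))"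
      by (rule mult_left_mono) simp
    then show ?thesis by (simp add: abs_mult mult.assoc)
  qed
  then show "\<bar>cycle_stat l \<theta> \<mu> S \<pi>\<bar> \<le> (\<Sum>k\<in>{1..l}. \<bar>\<theta> k\<bar> * (1 + \<bar>\<mu> k\<bar>)) * real (card S)"
    unfolding cycle_stat_def sum_distrib_right by (intro sum_abs[THEN order_trans] sum_mono)
qed (auto intro!: sum_nonneg)

lemma cycle_count_eq: "cycle_count n i \<pi> = num_cycles {1..n} i \<pi>"
  by (simp add: cycle_count_def num_cycles_def cycles_of_length_def)

lemma inv_count_plus_noninv:
  assumes "\<pi> permutes {1..n}"
  shows "inv_count n \<pi> + noninv {1..n} \<pi> = card {(i, j). i \<in> {1..n} \<and> j \<in> {1..n} \<and> i < j}"
proof -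
  have ne: "i < j \<Longrightarrow> \<pi> i < \<pi> j \<or> \<pi> j < \<pi> i" for i j
    using injD[OF permutes_inj[OF assms], of i j] by linarith
  have "{(i, j). i \<in> {1..n} \<and> j \<in> {1..n} \<and> i < j} =
     {(i, j). i \<in> {1..n} \<and> j \<in> {1..n} \<and> i < j \<and> \<pi> i > \<pi> j} \<union>
     {(i, j). i \<in> {1..n} \<and> j \<in> {1..n} \<and> i < j \<and> \<pi> i < \<pi> j}"
    by (auto simp: neq_iff dest: ne)
  moreover have "finite {(i, j). i \<in> {1..n} \<and> j \<in> {1..n} \<and> i < j \<and> \<pi> i > \<pi> j}"
    by (rule finite_subset[of _ "{1..n} \<times> {1..n}"]) auto
  moreover have "finite {(i, j). i \<in> {1..n} \<and> j \<in> {1..n} \<and> i < j \<and> \<pi> i < \<pi> j}"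
    by (rule finite_noninv_pairs) simp
  moreover have "{(i, j). i \<in> {1..n} \<and> j \<in> {1..n} \<and> i < j \<and> \<pi> i > \<pi> j} \<inter>
     {(i, j). i \<in> {1..n} \<and> j \<in> {1..n} \<and> i < j \<and> \<pi> i < \<pi> j} = {}" by auto
  ultimately show ?thesis
    unfolding inv_count_def noninv_def by (simp only: card_Un_disjoint)
qed

lemma finite_perms: "finite (perms n)"
  unfolding perms_def by (rule finite_permutations) simp

text \<open>Inversions and non-inversions together exhaust all pairs, so \<open>q\<close> to the
  number of pairs is a common factor that cancels in the normalization.\<close>

lemma mallows_prob_noninv:
  assumes "q > 1" "\<pi> \<in> perms n"
  shows "mallows_prob n q \<pi> =
    (1 / q) ^ noninv {1..n} \<pi> / (\<Sum>\<sigma>\<in>perms n. (1 / q) ^ noninv {1..n} \<sigma>)"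
proof -
  define T where "T = card {(i, j). i \<in> {1..n} \<and> j \<in> {1..n} \<and> i < (j::nat)}"
  have w: "q ^ inv_count n \<sigma> = q ^ T * (1 / q) ^ noninv {1..n} \<sigma>" if "\<sigma> \<in> perms n" for \<sigma>
  proof -
    have "inv_count n \<sigma> + noninv {1..n} \<sigma> = T"
      using that inv_count_plus_noninv unfolding perms_def T_def by blast
    then have "q ^ T = q ^ inv_count n \<sigma> * q ^ noninv {1..n} \<sigma>"
      by (simp add: power_add[symmetric])
    then show ?thesis using assms by (simp add: power_one_over)
  qed
  have "(\<Sum>\<sigma>\<in>perms n. q ^ inv_count n \<sigma>) = q ^ T * (\<Sum>\<sigma>\<in>perms n. (1 / q) ^ noninv {1..n} \<sigma>)"
    unfolding sum_distrib_left by (intro sum.cong refl w)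
  then show ?thesis
    unfolding mallows_prob_def w[OF assms(2)] using assms(1) by simp
qed

text \<open>The increasing enumeration of \<open>ball_int e N\<close>; without a central position it
  jumps over 0 after the first \<open>N\<close> indices.\<close>

definition center :: "bool \<Rightarrow> nat \<Rightarrow> nat \<Rightarrow> int" where
  "center e N i = (if e \<or> i \<le> N then int i - int N - 1 else int i - int N)"

lemma strict_mono_center: "strict_mono_on S (center e N)"
  by (auto simp: strict_mono_on_def center_def)

lemma bij_betw_center: "bij_betw (center e N) {1..2 * N + of_bool e} (ball_int e N)"
proof -
  have inj: "inj_on (center e N) {1..2 * N + of_bool e}"
    by (rule strict_mono_on_imp_inj_on[OF strict_mono_center])
  moreover have "center e N ` {1..2 * N + of_bool e} = ball_int e N"
  proof (rule card_subset_eq)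
    show "center e N ` {1..2 * N + of_bool e} \<subseteq> ball_int e N"
      by (auto simp: center_def ball_int_def split: if_splits)
    show "card (center e N ` {1..2 * N + of_bool e}) = card (ball_int e N)"
      unfolding card_image[OF inj] card_ball_int by simp
  qed simp
  ultimately show ?thesis by (simp add: bij_betw_def)
qed

text \<open>The normalizing power of \<open>1 - p\<close> depends on \<open>n\<close> only and
  cancels in the quotient; centring the positions preserves order and cycle type.\<close>

lemma mallows_char:
  fixes q x :: real and N :: nat and e :: bool
  assumes "q > 1"
  defines "n \<equiv> 2 * N + of_bool e"
  shows "(\<Sum>\<pi>\<in>perms n. of_real (mallows_prob n q \<pi>) * cis (x * cycle_stat l \<theta> \<mu> {1..n} \<pi>)) =
    cut_statistic.W (1 / q) (cycle_stat l \<theta> \<mu>) e x N / cut_statistic.W (1 / q) (cycle_stat l \<theta> \<mu>) e 0 N"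
proof -
  define p where "p = 1 / q"
  have p: "0 < p" "p < 1" using assms(1) by (auto simp: p_def)
  interpret cut_statistic p "cycle_stat l \<theta> \<mu>" "\<Sum>k\<in>{1..l}. \<bar>\<theta> k\<bar> * (1 + \<bar>\<mu> k\<bar>)"
    by (rule cut_statistic_cycle_stat[OF p])
  have bij: "bij_betw (center e N) {1..n} (ball_int e N)"
    unfolding n_def by (rule bij_betw_center)
  have W: "W e y N = of_real ((1 - p) ^ n) *
     (\<Sum>\<pi>\<in>perms n. of_real (p ^ noninv {1..n} \<pi>) * cis (y * cycle_stat l \<theta> \<mu> {1..n} \<pi>))" for y
  proof -
    have "W e y N = (\<Sum>\<pi>\<in>{\<pi>. \<pi> permutes {1..n}}. F y (ball_int e N) (map_permutation {1..n} (center e N) \<pi>))"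
      unfolding W_def using sum_permutes_relabel[OF bij, where P = "\<lambda>_. True"] by simp
    also have "\<dots> = (\<Sum>\<pi>\<in>{\<pi>. \<pi> permutes {1..n}}. of_real ((1 - p) ^ n) *
        (of_real (p ^ noninv {1..n} \<pi>) * cis (y * cycle_stat l \<theta> \<mu> {1..n} \<pi>)))"
    proof (intro sum.cong refl)
      fix \<pi> assume "\<pi> \<in> {\<pi>. \<pi> permutes {1..n}}"
      then have \<pi>: "\<pi> permutes {1..n}" by simp
      have "noninv (ball_int e N) (map_permutation {1..n} (center e N) \<pi>) = noninv {1..n} \<pi>"
        by (rule noninv_map_permutation[OF bij strict_mono_center \<pi>])
      moreover have "cycle_stat l \<theta> \<mu> (ball_int e N) (map_permutation {1..n} (center e N) \<pi>) = cycle_stat l \<theta> \<mu> {1..n} \<pi>"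
        using num_cycles_map_permutation[OF _ bij \<pi>] bij_betw_same_card[OF bij] by (simp add: cycle_stat_def)
      ultimately show "F y (ball_int e N) (map_permutation {1..n} (center e N) \<pi>) =
        of_real ((1 - p) ^ n) * (of_real (p ^ noninv {1..n} \<pi>) * cis (y * cycle_stat l \<theta> \<mu> {1..n} \<pi>))"
        by (simp add: F_def weight_def card_ball_int n_def)
    qed
    finally show ?thesis by (simp add: sum_distrib_left perms_def)
  qed
  have "(\<Sum>\<pi>\<in>perms n. of_real (mallows_prob n q \<pi>) * cis (x * cycle_stat l \<theta> \<mu> {1..n} \<pi>)) =
     (\<Sum>\<pi>\<in>perms n. of_real (p ^ noninv {1..n} \<pi>) * cis (x * cycle_stat l \<theta> \<mu> {1..n} \<pi>)) /
     of_real (\<Sum>\<sigma>\<in>perms n. p ^ noninv {1..n} \<sigma>)"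
    unfolding sum_divide_distrib
    by (intro sum.cong refl) (simp add: mallows_prob_noninv[OF assms(1)] p_def)
  also have "\<dots> = W e x N / W e 0 N"
    unfolding W using p by simp
  finally show ?thesis by (simp only: p_def)
qed

section \<open>From finite sums to weak convergence\<close>

text \<open>Makes the finite weighted sums integrals against a probability measure, whose image laws
  are the input of the continuity theorem.\<close>

definition mallows_pmf :: "nat \<Rightarrow> real \<Rightarrow> (nat \<Rightarrow> nat) pmf" where
  "mallows_pmf n q = embed_pmf (\<lambda>\<pi>. if \<pi> \<in> perms n then mallows_prob n q \<pi> else 0)"

lemma pmf_mallows:
  assumes "q > 0"
  shows "pmf (mallows_pmf n q) \<pi> = (if \<pi> \<in> perms n then mallows_prob n q \<pi> else 0)"
  unfolding mallows_pmf_def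
proof (rule pmf_embed_pmf)
  have Z: "(\<Sum>\<sigma>\<in>perms n. q ^ inv_count n \<sigma>) > 0"
  proof (rule sum_pos[OF finite_perms])
    show "perms n \<noteq> {}" using permutes_id[of "{1..n}"] by (auto simp del: permutes_id simp: perms_def)
  qed (use assms in simp)
  have nn: "mallows_prob n q \<pi> \<ge> 0" for \<pi>
    using Z assms by (simp add: mallows_prob_def)
  then show "0 \<le> (if \<pi> \<in> perms n then mallows_prob n q \<pi> else 0)" for \<pi> by simp
  have "(\<integral>\<^sup>+ \<pi>. ennreal (if \<pi> \<in> perms n then mallows_prob n q \<pi> else 0) \<partial>count_space UNIV) =
     (\<Sum>\<pi>\<in>perms n. ennreal (if \<pi> \<in> perms n then mallows_prob n q \<pi> else 0))"
    by (rule nn_integral_count_space'[OF finite_perms]) auto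
  also have "\<dots> = ennreal (\<Sum>\<pi>\<in>perms n. mallows_prob n q \<pi>)"
    by (simp add: sum_ennreal nn)
  also have "(\<Sum>\<pi>\<in>perms n. mallows_prob n q \<pi>) = 1"
    unfolding mallows_prob_def sum_divide_distrib[symmetric] using Z by simp
  finally show "(\<integral>\<^sup>+ \<pi>. ennreal (if \<pi> \<in> perms n then mallows_prob n q \<pi> else 0) \<partial>count_space UNIV) = 1"
    by simp
qed

lemma integral_mallows_pmf:
  fixes f :: "(nat \<Rightarrow> nat) \<Rightarrow> 'b::{banach, second_countable_topology}"
  assumes "q > 0"
  shows "(LINT \<pi>|mallows_pmf n q. f \<pi>) = (\<Sum>\<pi>\<in>perms n. mallows_prob n q \<pi> *\<^sub>R f \<pi>)"
proof -
  have "(LINT \<pi>|mallows_pmf n q. f \<pi>) = (\<Sum>\<pi>\<in>perms n. pmf (mallows_pmf n q) \<pi> *\<^sub>R f \<pi>)"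
    by (rule integral_measure_pmf[OF finite_perms]) (auto simp: set_pmf_iff pmf_mallows[OF assms] split: if_splits)
  then show ?thesis by (simp add: pmf_mallows[OF assms])
qed

lemma mallows_conv_distrI:
  assumes "q > 0" "prob_space M" "sets M = sets (vec_space l)"
    and V: "\<And>n \<pi>. V n \<pi> \<in> PiE {1..l} (\<lambda>_. UNIV)"
    and conv: "\<And>t. t \<in> PiE {1..l} (\<lambda>_. UNIV) \<Longrightarrow>
      (\<lambda>n. \<Sum>\<pi>\<in>perms n. of_real (mallows_prob n q \<pi>) * cis (\<Sum>i\<in>{1..l}. t i * V n \<pi> i))
        \<longlonglongrightarrow> (LINT x|M. cis (\<Sum>i\<in>{1..l}. t i * x i))"
  shows "mallows_conv_distr q l V M"
  unfolding mallows_conv_distr_def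
proof (intro allI impI)
  fix f :: "(nat \<Rightarrow> real) \<Rightarrow> real"
  assume f: "f \<in> borel_measurable (vec_space l)" "continuous_on (PiE {1..l} (\<lambda>_. UNIV)) f"
    "bounded (f ` PiE {1..l} (\<lambda>_. UNIV))"
  let ?N = "\<lambda>n. distr (measure_pmf (mallows_pmf n q)) (vec_space l) (V n)"
  have Vm: "V n \<in> measurable (measure_pmf (mallows_pmf n q)) (vec_space l)" for n
    using V by (simp add: space_vec_space)
  have int: "(LINT x|?N n. g x) = (\<Sum>\<pi>\<in>perms n. mallows_prob n q \<pi> *\<^sub>R g (V n \<pi>))"
    if "g \<in> borel_measurable (vec_space l)" for n and g :: "(nat \<Rightarrow> real) \<Rightarrow> 'b::{banach, second_countable_topology}"
    using integral_distr[OF Vm that] integral_mallows_pmf[OF assms(1)] by simp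
  have "(\<lambda>n. LINT x|?N n. f x) \<longlonglongrightarrow> (LINT x|M. f x)"
  proof (rule vec_levy_continuity[OF _ _ assms(2,3) _ f])
    show "prob_space (?N n)" for n by (rule measure_pmf.prob_space_distr[OF Vm])
    show "sets (?N n) = sets (vec_space l)" for n by simp
    show "(\<lambda>n. LINT x|?N n. cis (\<Sum>i\<in>{1..l}. t i * x i)) \<longlonglongrightarrow> (LINT x|M. cis (\<Sum>i\<in>{1..l}. t i * x i))"
      if t: "t \<in> PiE {1..l} (\<lambda>_. UNIV)" for t
    proof -
      have "(\<lambda>x. 1 * cis (\<Sum>i\<in>{1..l}. t i * x i)) \<in> borel_measurable (vec_space l)"
        by (rule trig_measurable[OF trig.trig_cis])
      then have m: "(\<lambda>x. cis (\<Sum>i\<in>{1..l}. t i * x i)) \<in> borel_measurable (vec_space l)" by simp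
      show ?thesis unfolding int[OF m] using conv[OF t] by (simp add: scaleR_conv_of_real)
    qed
  qed
  then show "(\<lambda>n. mallows_expect n q (\<lambda>\<pi>. f (V n \<pi>))) \<longlonglongrightarrow> (LINT x|M. f x)"
    by (simp add: int[OF f(1)] mallows_expect_def)
qed

theorem theorem1p2:
  fixes q :: real
  assumes "q > 1"
  shows "\<exists>(\<mu> :: nat \<Rightarrow> real) (Q :: nat \<Rightarrow> nat \<Rightarrow> real).
           (\<forall>i j. Q i j = Q j i) \<and>
           (\<forall>l \<ge> 1. \<exists>M. is_mvnormal0 l Q M \<and>
              mallows_conv_distr q l
                (\<lambda>n \<pi>. restrict (\<lambda>k. (real (cycle_count n (2 * k) \<pi>) - \<mu> k * real n) / sqrt (real n))
                          {1..l})
                M)"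
proof -
  define p where "p = 1 / q"
  have p: "0 < p" "p < 1" using assms by (auto simp: p_def)
  define w where "w = (\<lambda>m. cut_statistic.weight p (ball_int False m))"
  define c where "c = cut_statistic.c p"
  define K where "K = core_perms 1 False"
  define X where "X = (\<lambda>k m \<pi>. real (num_cycles (ball_int False m) (2 * k) \<pi>))"
  define m1 where "m1 = (\<lambda>k m. if m = 0 then 0 else \<Sum>\<pi>\<in>K m. w m \<pi> * X k m \<pi>)"
  \<comment> \<open>Cuts have density \<open>c\<close> per level, a block holds
    \<open>suminf (m1 k)\<close> cycles of length \<open>2 * k\<close> in the mean, and a level is
    two positions.\<close>
  define \<mu> where "\<mu> = (\<lambda>k. c / 2 * suminf (m1 k))"
  define Y where "Y = (\<lambda>k m \<pi>. X k m \<pi> - \<mu> k * real (2 * m))"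
  define cov where "cov = (\<lambda>i j m. if m = 0 then 0 else \<Sum>\<pi>\<in>K m. w m \<pi> * (Y i m \<pi> * Y j m \<pi>))"
  define Q where "Q = (\<lambda>i j. c / 2 * suminf (cov i j))"
  have sym: "Q i j = Q j i" for i j by (simp only: Q_def cov_def mult.commute[of "Y i _ _" "Y j _ _"])
  \<comment> \<open>The weights, \<open>a\<close> and \<open>c\<close> depend on \<open>p\<close>
    alone. The zero statistic gives access to them before the centred statistics, which already
    contain \<open>\<mu>\<close>, are used.\<close>
  interpret Z: cut_statistic p "cycle_stat 0 (\<lambda>_. 0) (\<lambda>_. 0)" 0
    using cut_statistic_cycle_stat[OF p, of 0 "\<lambda>_. 0" "\<lambda>_. 0"] by simp
  have c0: "c > 0" using Z.c_pos by (simp add: c_def)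
  have w0: "w m \<pi> \<ge> 0" for m \<pi> by (simp add: w_def Z.weight_nonneg)
  have aw: "Z.a m = (if m = 0 then 0 else \<Sum>\<pi>\<in>K m. w m \<pi>)" for m
    by (simp add: Z.a_def Z.core0_def K_def w_def)
  have ma: "(\<lambda>m. real m * Z.a m) sums (1 / c)" using Z.first_moment by (simp add: c_def)
  have card2: "card (ball_int False m) = 2 * m" for m by (simp add: card_ball_int)
  have X_bd: "0 \<le> X k m \<pi>" "X k m \<pi> \<le> 2 * real m" for k m \<pi>
    using num_cycles_le[OF finite_ball_int, of False m "2 * k" \<pi>] by (auto simp: X_def card2)
  have m1_summable: "summable (m1 k)" for k
  proof (rule summable_comparison_test'[of "\<lambda>m. 2 * (real m * Z.a m)" 0])
    show "summable (\<lambda>m. 2 * (real m * Z.a m))" using ma by (intro summable_mult) (simp add: sums_iff)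
    show "norm (m1 k m) \<le> 2 * (real m * Z.a m)" for m
    proof (cases "m = 0")
      case False
      have "m1 k m \<le> (\<Sum>\<pi>\<in>K m. w m \<pi> * (2 * real m))"
        using False X_bd(2) w0 by (auto simp: m1_def intro!: sum_mono mult_left_mono)
      also have "\<dots> = 2 * (real m * Z.a m)" using False by (simp add: aw sum_distrib_right[symmetric])
      finally show ?thesis using False X_bd(1) w0 by (simp add: m1_def sum_nonneg)
    qed (simp add: m1_def)
  qed
  define D where "D = (\<lambda>k. 2 + 2 * \<bar>\<mu> k\<bar>)"
  have Y_bd: "\<bar>Y k m \<pi>\<bar> \<le> D k * real m" for k m \<pi>
  proof -
    have "\<bar>Y k m \<pi>\<bar> \<le> \<bar>X k m \<pi>\<bar> + \<bar>\<mu> k * real (2 * m)\<bar>" unfolding Y_def by (rule abs_triangle_ineq4)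
    also have "\<dots> \<le> D k * real m"
      using X_bd[of k m \<pi>] by (simp add: D_def abs_mult algebra_simps)
    finally show ?thesis .
  qed
  have cov_summable: "summable (cov i j)" for i j
  proof (rule summable_comparison_test'[of "\<lambda>m. D i * D j * ((real m)\<^sup>2 * Z.a m)" 0])
    show "summable (\<lambda>m. D i * D j * ((real m)\<^sup>2 * Z.a m))"
      by (intro summable_mult Z.second_moment)
    show "norm (cov i j m) \<le> D i * D j * ((real m)\<^sup>2 * Z.a m)" for m
    proof (cases "m = 0")
      case False
      have "\<bar>cov i j m\<bar> \<le> (\<Sum>\<pi>\<in>K m. \<bar>w m \<pi> * (Y i m \<pi> * Y j m \<pi>)\<bar>)"
        using False by (simp add: cov_def sum_abs)
      also have "\<dots> \<le> (\<Sum>\<pi>\<in>K m. w m \<pi> * ((D i * real m) * (D j * real m)))"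
      proof (rule sum_mono)
        fix \<pi>
        have "\<bar>Y i m \<pi>\<bar> * \<bar>Y j m \<pi>\<bar> \<le> (D i * real m) * (D j * real m)"
          by (intro mult_mono Y_bd) (auto simp: D_def)
        then show "\<bar>w m \<pi> * (Y i m \<pi> * Y j m \<pi>)\<bar> \<le> w m \<pi> * ((D i * real m) * (D j * real m))"
          using w0 by (simp add: abs_mult mult_left_mono)
      qed
      also have "\<dots> = D i * D j * ((real m)\<^sup>2 * Z.a m)"
        using False unfolding sum_distrib_right[symmetric] by (simp add: aw power2_eq_square mult_ac)
      finally show ?thesis by simp
    qed (simp add: cov_def)
  qed
  have stat: "cycle_stat l \<theta> \<mu> (ball_int False m) \<pi> = (\<Sum>k\<in>{1..l}. \<theta> k * Y k m \<pi>)" for l \<theta> m \<pi>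
    by (simp add: cycle_stat_def Y_def X_def card2)
  \<comment> \<open>The centring over a block totals \<open>\<mu> k\<close> times twice the mean
    radius \<open>1 / c\<close>, which is exactly \<open>suminf (m1 k)\<close>.\<close>
  have mean: "suminf (cut_statistic.y1 p (cycle_stat l \<theta> \<mu>)) = 0" for l \<theta>
  proof -
    interpret S: cut_statistic p "cycle_stat l \<theta> \<mu>" "\<Sum>k\<in>{1..l}. \<bar>\<theta> k\<bar> * (1 + \<bar>\<mu> k\<bar>)"
      by (rule cut_statistic_cycle_stat[OF p])
    have "S.y1 m = (\<Sum>k\<in>{1..l}. \<theta> k * (m1 k m - 2 * \<mu> k * (real m * Z.a m)))" for m
    proof (cases "m = 0")
      case False
      have "S.y1 m = (\<Sum>\<pi>\<in>K m. \<Sum>k\<in>{1..l}. w m \<pi> * (\<theta> k * Y k m \<pi>))"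
        using False by (simp add: S.y1_def K_def w_def stat sum_distrib_left)
      also have "\<dots> = (\<Sum>k\<in>{1..l}. \<Sum>\<pi>\<in>K m. w m \<pi> * (\<theta> k * Y k m \<pi>))"
        by (rule sum.swap)
      also have "\<dots> = (\<Sum>k\<in>{1..l}. \<theta> k * (m1 k m - 2 * \<mu> k * (real m * Z.a m)))"
        using False by (intro sum.cong refl)
          (simp add: m1_def aw Y_def sum_distrib_left sum_subtractf[symmetric] algebra_simps)
      finally show ?thesis .
    qed (simp add: S.y1_def m1_def)
    moreover have "(\<lambda>m. \<Sum>k\<in>{1..l}. \<theta> k * (m1 k m - 2 * \<mu> k * (real m * Z.a m))) sums
       (\<Sum>k\<in>{1..l}. \<theta> k * (suminf (m1 k) - 2 * \<mu> k * (1 / c)))"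
      by (intro sums_sum sums_mult sums_diff summable_sums m1_summable ma)
    ultimately have "S.y1 sums (\<Sum>k\<in>{1..l}. \<theta> k * (suminf (m1 k) - 2 * \<mu> k * (1 / c)))"
      by (simp add: fun_eq_iff[symmetric] cong: sums_cong)
    then show ?thesis using c0 by (simp add: sums_iff \<mu>_def)
  qed
  \<comment> \<open>The factor 2 undoes the \<open>c / 2\<close> in \<open>Q\<close>, which counts
    per position, whereas the renewal argument counts per level.\<close>
  have var: "c * suminf (cut_statistic.y2 p (cycle_stat l \<theta> \<mu>)) =
      2 * (\<Sum>i\<in>{1..l}. \<Sum>j\<in>{1..l}. \<theta> i * Q i j * \<theta> j)" for l \<theta>
  proof -
    interpret S: cut_statistic p "cycle_stat l \<theta> \<mu>" "\<Sum>k\<in>{1..l}. \<bar>\<theta> k\<bar> * (1 + \<bar>\<mu> k\<bar>)"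
      by (rule cut_statistic_cycle_stat[OF p])
    have "S.y2 m = (\<Sum>i\<in>{1..l}. \<Sum>j\<in>{1..l}. \<theta> i * \<theta> j * cov i j m)" for m
    proof (cases "m = 0")
      case False
      have "S.y2 m = (\<Sum>\<pi>\<in>K m. \<Sum>i\<in>{1..l}. \<Sum>j\<in>{1..l}. w m \<pi> * ((\<theta> i * Y i m \<pi>) * (\<theta> j * Y j m \<pi>)))"
        using False by (simp only: S.y2_def K_def w_def stat if_False power2_eq_square sum_product) (simp only: sum_distrib_left)
      also have "\<dots> = (\<Sum>i\<in>{1..l}. \<Sum>\<pi>\<in>K m. \<Sum>j\<in>{1..l}. w m \<pi> * ((\<theta> i * Y i m \<pi>) * (\<theta> j * Y j m \<pi>)))"
        by (rule sum.swap)
      also have "\<dots> = (\<Sum>i\<in>{1..l}. \<Sum>j\<in>{1..l}. \<Sum>\<pi>\<in>K m. w m \<pi> * ((\<theta> i * Y i m \<pi>) * (\<theta> j * Y j m \<pi>)))"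
        by (intro sum.cong refl sum.swap)
      also have "\<dots> = (\<Sum>i\<in>{1..l}. \<Sum>j\<in>{1..l}. \<theta> i * \<theta> j * cov i j m)"
        using False by (intro sum.cong refl) (simp add: cov_def sum_distrib_left mult_ac)
      finally show ?thesis .
    qed (simp add: S.y2_def cov_def)
    moreover have "(\<lambda>m. \<Sum>i\<in>{1..l}. \<Sum>j\<in>{1..l}. \<theta> i * \<theta> j * cov i j m) sums
       (\<Sum>i\<in>{1..l}. \<Sum>j\<in>{1..l}. \<theta> i * \<theta> j * suminf (cov i j))"
      by (intro sums_sum sums_mult summable_sums cov_summable)
    ultimately have "suminf S.y2 = (\<Sum>i\<in>{1..l}. \<Sum>j\<in>{1..l}. \<theta> i * \<theta> j * suminf (cov i j))"
      by (simp add: sums_iff fun_eq_iff[symmetric] cong: sums_cong suminf_cong)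
    then show ?thesis by (simp add: Q_def sum_distrib_left mult_ac)
  qed
  have psd: "0 \<le> (\<Sum>i\<in>{1..l}. \<Sum>j\<in>{1..l}. t i * Q i j * t j)" for l t
  proof -
    interpret S: cut_statistic p "cycle_stat l t \<mu>" "\<Sum>k\<in>{1..l}. \<bar>t k\<bar> * (1 + \<bar>\<mu> k\<bar>)"
      by (rule cut_statistic_cycle_stat[OF p])
    have "0 \<le> suminf S.y2" by (rule suminf_nonneg[OF S.y2_summable S.y2_nonneg])
    then have "0 \<le> c * suminf S.y2" using c0 by simp
    then show ?thesis unfolding var by simp
  qed
  have lim: "(\<lambda>n. \<Sum>\<pi>\<in>perms n. of_real (mallows_prob n q \<pi>) * cis (1 / sqrt (real n) * cycle_stat l t \<mu> {1..n} \<pi>))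
     \<longlonglongrightarrow> of_real (exp (- (\<Sum>i\<in>{1..l}. \<Sum>j\<in>{1..l}. t i * Q i j * t j) / 2))" for l t
  proof -
    interpret S: cut_statistic p "cycle_stat l t \<mu>" "\<Sum>k\<in>{1..l}. \<bar>t k\<bar> * (1 + \<bar>\<mu> k\<bar>)"
      by (rule cut_statistic_cycle_stat[OF p])
    define f where "f = (\<lambda>n. \<Sum>\<pi>\<in>perms n. of_real (mallows_prob n q \<pi>) * cis (1 / sqrt (real n) * cycle_stat l t \<mu> {1..n} \<pi>))"
    \<comment> \<open>Positions pair up around the centre with radius \<open>N\<close> only once the
      parity of \<open>n\<close> is fixed; the two subsequences share one limit.\<close>
    have half: "(\<lambda>N. f (2 * N + of_bool e)) \<longlonglongrightarrow> of_real (exp (- (\<Sum>i\<in>{1..l}. \<Sum>j\<in>{1..l}. t i * Q i j * t j) / 2))" for e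
    proof -
      define s where "s = (\<lambda>N. 1 / sqrt (real (2 * N + of_bool e)))"
      have inf: "filterlim (\<lambda>N. real (2 * N + of_bool e)) at_top sequentially"
        by (rule filterlim_at_top_mono[OF filterlim_real_sequentially]) (auto intro!: always_eventually)
      have "s \<longlonglongrightarrow> 0"
        unfolding s_def using filterlim_compose[OF sqrt_at_top inf]
        by (intro tendsto_divide_0[OF tendsto_const] filterlim_at_top_imp_at_infinity)
      moreover have "\<forall>\<^sub>F N in sequentially. s N \<noteq> 0"
        using eventually_gt_at_top[of 0] by eventually_elim (simp add: s_def)
      ultimately have s: "filterlim s (at 0) sequentially" by (simp add: filterlim_at)
      \<comment> \<open>Since the ratio of \<open>N\<close> to \<open>2 * N + of_bool e\<close>
        tends to 1/2, \<open>W_limit\<close> is used with \<open>\<tau> = 1 / 2\<close>; with the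
        factor 2 from \<open>var\<close> the exponent becomes minus half the quadratic form.\<close>
      have "(\<lambda>N. 1 / 2 - of_bool e / 2 * (1 / real (2 * N + of_bool e))) \<longlonglongrightarrow> 1 / 2 - of_bool e / 2 * 0"
        by (intro tendsto_intros tendsto_divide_0[OF tendsto_const] filterlim_at_top_imp_at_infinity[OF inf])
      then have "(\<lambda>N. 1 / 2 - of_bool e / 2 * (1 / real (2 * N + of_bool e))) \<longlonglongrightarrow> 1 / 2" by simp
      then have "(\<lambda>N. real N * (s N)\<^sup>2) \<longlonglongrightarrow> 1 / 2"
      proof (rule Lim_transform_eventually)
        show "\<forall>\<^sub>F N in sequentially. 1 / 2 - of_bool e / 2 * (1 / real (2 * N + of_bool e)) = real N * (s N)\<^sup>2"
          using eventually_gt_at_top[of 0]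
        proof eventually_elim
          case (elim N)
          have id: "1 / 2 - b / 2 * (1 / d) = x * (1 / d)" if "d = 2 * x + b" "d > 0" for x b d :: real
          proof -
            have "1 / 2 - b / 2 * (1 / d) = (d - b) / 2 * (1 / d)" using that(2) by (simp add: diff_divide_distrib)
            then show ?thesis using that(1) by simp
          qed
          have "(s N)\<^sup>2 = 1 / real (2 * N + of_bool e)"
            unfolding s_def power_divide by simp
          then show ?case using id[of "real (2 * N + of_bool e)" "real N" "of_bool e"] elim
            by (simp only: of_nat_0_less_iff) simp
        qed
      qed
      from S.W_limit[OF mean s filterlim_ident this, of e]
      have "(\<lambda>N. S.W e (s N) N / S.W e 0 N) \<longlonglongrightarrow> of_real (exp (- (c * suminf S.y2 * (1 / 2) / 2)))"
        by (simp add: c_def)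
      then show ?thesis
        unfolding f_def mallows_char[OF assms] var p_def[symmetric] s_def by simp
    qed
    have "f \<longlonglongrightarrow> of_real (exp (- (\<Sum>i\<in>{1..l}. \<Sum>j\<in>{1..l}. t i * Q i j * t j) / 2))"
      by (rule limseq_even_odd) (use half[of False] half[of True] in simp_all)
    then show ?thesis by (simp only: f_def)
  qed
  have "\<exists>M. is_mvnormal0 l Q M \<and> mallows_conv_distr q l
      (\<lambda>n \<pi>. restrict (\<lambda>k. (real (cycle_count n (2 * k) \<pi>) - \<mu> k * real n) / sqrt (real n)) {1..l}) M" for l
  proof -
    obtain M where M: "is_mvnormal0 l Q M"
      using mvnormal0_exists[OF sym psd] by blast
    have "mallows_conv_distr q l
      (\<lambda>n \<pi>. restrict (\<lambda>k. (real (cycle_count n (2 * k) \<pi>) - \<mu> k * real n) / sqrt (real n)) {1..l}) M"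
    proof (rule mallows_conv_distrI)
      fix t :: "nat \<Rightarrow> real" assume t: "t \<in> PiE {1..l} (\<lambda>_. UNIV)"
      have "(\<Sum>i\<in>{1..l}. t i * restrict (\<lambda>k. (real (cycle_count n (2 * k) \<pi>) - \<mu> k * real n) / sqrt (real n)) {1..l} i)
          = 1 / sqrt (real n) * cycle_stat l t \<mu> {1..n} \<pi>" for n \<pi>
        by (simp add: cycle_stat_def cycle_count_eq sum_distrib_left)
      then show "(\<lambda>n. \<Sum>\<pi>\<in>perms n. of_real (mallows_prob n q \<pi>) * cis (\<Sum>i\<in>{1..l}. t i *
          restrict (\<lambda>k. (real (cycle_count n (2 * k) \<pi>) - \<mu> k * real n) / sqrt (real n)) {1..l} i))
        \<longlonglongrightarrow> (LINT x|M. cis (\<Sum>i\<in>{1..l}. t i * x i))"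
        using lim[of l t] M t by (simp only: is_mvnormal0_def)
    qed (use assms M in \<open>auto simp: is_mvnormal0_def\<close>)
    with M show ?thesis by blast
  qed
  with sym show ?thesis by blast
qed

end
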